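(* Suppose that $W$ is a simply-laced Coxeter group, i.e., $m_{ij}\in\{0,2,3\}$ for all distinct $i,j\in I$. Then the Hecke-Hopf algebra $\mathbf{H}(W)$ is generated by $s_i,D_i$, $i\in I$, subject to the (defining) relations: - $s_i^2=1$, $s_iD_i+D_is_i=s_i-1$, $D_i^2=D_i$ for $i\in I$; - $s_js_i=s_is_j$, $D_js_i=s_iD_j$, $D_jD_i=D_iD_j$ if $m_{ij}=2$; - $s_js_is_j=s_is_js_i$, $D_is_js_i=s_js_iD_j$, $D_js_iD_j=s_iD_jD_i+D_iD_js_i+s_iD_js_i$ if $m_{ij}=3$.
   Context: A Coxeter group $W$ is generated by $s_i$, $i\in I$, subject to relations $(s_is_j)^{m_{ij}}=1$, where $m_{ij}=m_{ji}\in\mathbb{Z}_{\ge 0}$ are such that $m_{ij}=1$ iff $i=j$ ($m_{ij}=0$ imposes no relation). $\hat{\mathbf{H}}(W)$ is the (unital associative) $\mathbb{Z}$-algebra generated by $s_i,D_i$, $i\in I$, subject to relations: (i) $s_i^2=1$, $D_i^2=D_i$, $s_iD_i+D_is_i=s_i-1$ for $i\in I$; (ii) $(s_is_j)^{m_{ij}}=1$; (iii) $\underbrace{D_is_js_i\cdots s_{j'}}_{m_{ij}}=\underbrace{s_j\cdots s_{i'}s_{j'}D_{i'}}_{m_{ij}}$ for all distinct $i,j\in I$ with $m_{ij}\ne 0$, where $i'=i$ if $m_{ij}$ is even, $i'=j$ if $m_{ij}$ is odd, and $\{i',j'\}=\{i,j\}$ (each side has $m_{ij}$ factors with indices alternating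 between $i$ and $j$). It is a Hopf algebra over $\mathbb{Z}$ with $\Delta(s_i)=s_i\otimes s_i$, $\Delta(D_i)=D_i\otimes 1+s_i\otimes D_i$, $\varepsilon(s_i)=1$, $\varepsilon(D_i)=0$. $\mathcal{S}:=\{ws_iw^{-1}\mid w\in W,i\in I\}$. For each $s\in\mathcal{S}$ there is a unique $D_s\in\hat{\mathbf{H}}(W)$ such that $D_{s_i}=D_i$ for $i\in I$ and $D_{s_iss_i}=s_iD_ss_i$ for any $i\in I$, $s\in\mathcal{S}\setminus\{s_i\}$. $\hat{\mathbf{D}}(W)$ is the subalgebra of $\hat{\mathbf{H}}(W)$ generated by all $D_s$, $s\in\mathcal{S}$, and $\mathbf{K}(W):=\bigcap_{w\in W}w\hat{\mathbf{D}}(W)w^{-1}$. For $J\subset I$, $W_J$ is the (Coxeter) subgroup generated by $s_j$, $j\in J$; $\hat{\mathbf{D}}(W_J)$ is identified with the subalgebra of $\hat{\mathbf{D}}(W)$ generated by all $D_s$ with $s\in\mathcal{S}\cap W_J$. $\hat{\mathbf{D}}(W)$ is filtered by $\deg D_s=1$ (degree at most $r$ means: lies in the $\mathbb{Z}$-span of products of at most $r$ of the $D_s$). For distinct $i,j\in I$, $\mathbf{K}_{ij}(W)$ is the set of all elements of $\mathbf{K}(W_{\{i,j\}})\cap\operatorname{Ker}\varepsilon$ having degree at most $m_{ij}$. The Hecke-Hopf algebra of $W$ is $\mathbf{H}(W)=\hat{\mathbf{H}}(W)/\underline{\mathbf{J}}(W)$, where $\underline{\mathbf{J}}(W)$ is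 the ideal generated by all $\mathbf{K}_{ij}(W)$, $i\ne j$. Images of $s_i,D_i$ in $\mathbf{H}(W)$ are denoted by the same symbols. *)

theory Defs
  imports "HOL-Algebra.Algebra"
    "HOL-Algebra.Algebraic_Closure_Type"
    "HOL-Library.Poly_Mapping"
    "HOL-Library.FuncSet"
begin

section \<open>Algebras given by generators and relations\<close>

text \<open>With concatenation as addition, lists form the free monoid, so \<open>'g list \<Rightarrow>\<^sub>0 int\<close> with its
  convolution product is the free unital associative algebra over the integers on the set of
  generators \<open>'g\<close>.\<close>

instantiation list :: (type) monoid_add
begin

definition zero_list :: "'a list" where "zero_list = []"

definition plus_list :: "'a list \<Rightarrow> 'a list \<Rightarrow> 'a list" where "plus_list xs ys = xs @ ys"

instance by standard (simp_all add: zero_list_def plus_list_def)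

end

type_synonym 'g free_alg = "'g list \<Rightarrow>\<^sub>0 int"

abbreviation Free :: "'g free_alg ring" where
  "Free \<equiv> ring_of_type_algebra"

abbreviation var :: "'g \<Rightarrow> 'g free_alg" where
  "var x \<equiv> Poly_Mapping.single [x] 1"

text \<open>A relation \<open>l = r\<close> is recorded as the relator \<open>l - r\<close>; ideals in HOL-Algebra are two-sided.\<close>

definition pres :: "'g free_alg set \<Rightarrow> 'g free_alg set ring" where
  "pres R = Free Quot (Idl\<^bsub>Free\<^esub> R)"

definition pres_class :: "'g free_alg set \<Rightarrow> 'g free_alg \<Rightarrow> 'g free_alg set" where
  "pres_class R x = (Idl\<^bsub>Free\<^esub> R) +>\<^bsub>Free\<^esub> x"


section \<open>Coxeter groups\<close>

definition coxeter_matrix :: "('i \<Rightarrow> 'i \<Rightarrow> nat) \<Rightarrow> bool" where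
  "coxeter_matrix m \<longleftrightarrow> (\<forall>i j. m i j = m j i) \<and> (\<forall>i j. m i j = 1 \<longleftrightarrow> i = j)"

definition simply_laced :: "('i \<Rightarrow> 'i \<Rightarrow> nat) \<Rightarrow> bool" where
  "simply_laced m \<longleftrightarrow> (\<forall>i j. i \<noteq> j \<longrightarrow> m i j \<in> {0, 2, 3})"

text \<open>Elements of the Coxeter group are words in the generators modulo the congruence generated by
  \<open>(s\<^sub>i s\<^sub>j)\<^bsup>m i j\<^esup> = 1\<close>. As \<open>m i i = 1\<close>, this contains \<open>s\<^sub>i s\<^sub>i = 1\<close>, so every word is invertible and
  no letters for inverses are needed. For \<open>m i j = 0\<close> the relation is void.\<close>

inductive coxeter_step :: "('i \<Rightarrow> 'i \<Rightarrow> nat) \<Rightarrow> 'i list \<Rightarrow> 'i list \<Rightarrow> bool" for m where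
  "coxeter_step m (us @ concat (replicate (m i j) [i, j]) @ vs) (us @ vs)"

definition coxeter_rel :: "('i \<Rightarrow> 'i \<Rightarrow> nat) \<Rightarrow> ('i list \<times> 'i list) set" where
  "coxeter_rel m = {(xs, ys). equivclp (coxeter_step m) xs ys}"

definition coxeter_group :: "('i \<Rightarrow> 'i \<Rightarrow> nat) \<Rightarrow> 'i list set monoid" where
  "coxeter_group m = \<lparr>carrier = UNIV // coxeter_rel m,
          monoid.mult = (\<lambda>A B. \<Union>xs\<in>A. \<Union>ys\<in>B. coxeter_rel m `` {xs @ ys}),
          monoid.one = coxeter_rel m `` {[]}\<rparr>"

definition simple_refl :: "('i \<Rightarrow> 'i \<Rightarrow> nat) \<Rightarrow> 'i \<Rightarrow> 'i list set" where
  "simple_refl m i = coxeter_rel m `` {[i]}"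

definition parabolic :: "('i \<Rightarrow> 'i \<Rightarrow> nat) \<Rightarrow> 'i set \<Rightarrow> 'i list set set" where
  "parabolic m J = generate (coxeter_group m) (simple_refl m ` J)"

definition reflections :: "('i \<Rightarrow> 'i \<Rightarrow> nat) \<Rightarrow> 'i list set set" where
  "reflections m =
     {w \<otimes>\<^bsub>coxeter_group m\<^esub> simple_refl m i \<otimes>\<^bsub>coxeter_group m\<^esub> inv\<^bsub>coxeter_group m\<^esub> w
      | w i. w \<in> carrier (coxeter_group m)}"


section \<open>The algebra \<open>H_hat(W)\<close>\<close>

datatype 'i gen = GS 'i | GD 'i

abbreviation gen_s :: "'i \<Rightarrow> 'i gen free_alg" where "gen_s i \<equiv> var (GS i)"

abbreviation gen_D :: "'i \<Rightarrow> 'i gen free_alg" where "gen_D i \<equiv> var (GD i)"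

definition word_s :: "'i list \<Rightarrow> 'i gen free_alg" where
  "word_s xs = prod_list (map gen_s xs)"

text \<open>\<open>alternating i j n\<close> is the word \<open>i, j, i, \<dots>\<close> of length \<open>n\<close>.\<close>

fun alternating :: "'i \<Rightarrow> 'i \<Rightarrow> nat \<Rightarrow> 'i list" where
  "alternating i j 0 = []"
| "alternating i j (Suc n) = i # alternating j i n"

definition hat_relators :: "('i \<Rightarrow> 'i \<Rightarrow> nat) \<Rightarrow> 'i gen free_alg set" where
  "hat_relators m =
     {gen_s i ^ 2 - 1 | i. True}
   \<union> {gen_D i ^ 2 - gen_D i | i. True}
   \<union> {(gen_s i * gen_D i + gen_D i * gen_s i) - (gen_s i - 1) | i. True}
   \<union> {(gen_s i * gen_s j) ^ m i j - 1 | i j. True}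
   \<union> {gen_D i * word_s (alternating j i (m i j - 1))
        - word_s (alternating j i (m i j - 1)) * gen_D (if even (m i j) then i else j)
      | i j. i \<noteq> j \<and> m i j \<noteq> 0}"

definition Hhat :: "('i \<Rightarrow> 'i \<Rightarrow> nat) \<Rightarrow> 'i gen free_alg set ring" where
  "Hhat m = pres (hat_relators m)"

definition hs :: "('i \<Rightarrow> 'i \<Rightarrow> nat) \<Rightarrow> 'i \<Rightarrow> 'i gen free_alg set" where
  "hs m i = pres_class (hat_relators m) (gen_s i)"

definition hD :: "('i \<Rightarrow> 'i \<Rightarrow> nat) \<Rightarrow> 'i \<Rightarrow> 'i gen free_alg set" where
  "hD m i = pres_class (hat_relators m) (gen_D i)"

text \<open>The image in \<open>H_hat(W)\<close> of a group element \<open>w\<close>, which does not depend on the word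
  chosen for \<open>w\<close>.\<close>

definition hW :: "('i \<Rightarrow> 'i \<Rightarrow> nat) \<Rightarrow> 'i list set \<Rightarrow> 'i gen free_alg set" where
  "hW m w = the_elem ((\<lambda>xs. pres_class (hat_relators m) (word_s xs)) ` w)"

definition counit :: "('i \<Rightarrow> 'i \<Rightarrow> nat) \<Rightarrow> 'i gen free_alg set \<Rightarrow> int" where
  "counit m = (THE e. e \<in> ring_hom (Hhat m) \<Z> \<and> e \<in> extensional (carrier (Hhat m))
                 \<and> (\<forall>i. e (hs m i) = 1 \<and> e (hD m i) = 0))"

definition Drefl :: "('i \<Rightarrow> 'i \<Rightarrow> nat) \<Rightarrow> 'i list set \<Rightarrow> 'i gen free_alg set" where
  "Drefl m = (THE d. d \<in> reflections m \<rightarrow>\<^sub>E carrier (Hhat m)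
     \<and> (\<forall>i. d (simple_refl m i) = hD m i)
     \<and> (\<forall>i. \<forall>s \<in> reflections m - {simple_refl m i}.
          d (simple_refl m i \<otimes>\<^bsub>coxeter_group m\<^esub> s \<otimes>\<^bsub>coxeter_group m\<^esub> simple_refl m i)
            = hs m i \<otimes>\<^bsub>Hhat m\<^esub> d s \<otimes>\<^bsub>Hhat m\<^esub> hs m i))"


section \<open>The Hecke-Hopf algebra\<close>

text \<open>\<open>Dhat m J\<close> and \<open>Kalg m J\<close> are \<open>D_hat(W\<^sub>J)\<close> and \<open>K(W\<^sub>J)\<close>, as subsets of \<open>H_hat(W)\<close>.\<close>

definition Dhat :: "('i \<Rightarrow> 'i \<Rightarrow> nat) \<Rightarrow> 'i set \<Rightarrow> 'i gen free_alg set set" where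
  "Dhat m J = generate_ring (Hhat m) (Drefl m ` (reflections m \<inter> parabolic m J))"

definition Kalg :: "('i \<Rightarrow> 'i \<Rightarrow> nat) \<Rightarrow> 'i set \<Rightarrow> 'i gen free_alg set set" where
  "Kalg m J = (\<Inter>w \<in> parabolic m J.
      (\<lambda>x. hW m w \<otimes>\<^bsub>Hhat m\<^esub> x \<otimes>\<^bsub>Hhat m\<^esub> hW m (inv\<^bsub>coxeter_group m\<^esub> w)) ` Dhat m J)"

definition deg_le :: "('i \<Rightarrow> 'i \<Rightarrow> nat) \<Rightarrow> nat \<Rightarrow> 'i gen free_alg set set" where
  "deg_le m r = generate (add_monoid (Hhat m))
     {foldr (\<otimes>\<^bsub>Hhat m\<^esub>) (map (Drefl m) ss) \<one>\<^bsub>Hhat m\<^esub> | ss.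
        set ss \<subseteq> reflections m \<and> length ss \<le> r}"

definition Kij :: "('i \<Rightarrow> 'i \<Rightarrow> nat) \<Rightarrow> 'i \<Rightarrow> 'i \<Rightarrow> 'i gen free_alg set set" where
  "Kij m i j = {x \<in> Kalg m {i, j}. counit m x = 0 \<and> x \<in> deg_le m (m i j)}"

definition Jideal :: "('i \<Rightarrow> 'i \<Rightarrow> nat) \<Rightarrow> 'i gen free_alg set set" where
  "Jideal m = Idl\<^bsub>Hhat m\<^esub> (\<Union>i. \<Union>j \<in> - {i}. Kij m i j)"

definition HeckeHopf :: "('i \<Rightarrow> 'i \<Rightarrow> nat) \<Rightarrow> 'i gen free_alg set set ring" where
  "HeckeHopf m = Hhat m Quot Jideal m"

definition Hs :: "('i \<Rightarrow> 'i \<Rightarrow> nat) \<Rightarrow> 'i \<Rightarrow> 'i gen free_alg set set" where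
  "Hs m i = Jideal m +>\<^bsub>Hhat m\<^esub> hs m i"

definition HD :: "('i \<Rightarrow> 'i \<Rightarrow> nat) \<Rightarrow> 'i \<Rightarrow> 'i gen free_alg set set" where
  "HD m i = Jideal m +>\<^bsub>Hhat m\<^esub> hD m i"


section \<open>The simply-laced relations\<close>

definition simply_laced_relators :: "('i \<Rightarrow> 'i \<Rightarrow> nat) \<Rightarrow> 'i gen free_alg set" where
  "simply_laced_relators m =
     {gen_s i ^ 2 - 1 | i. True}
   \<union> {(gen_s i * gen_D i + gen_D i * gen_s i) - (gen_s i - 1) | i. True}
   \<union> {gen_D i ^ 2 - gen_D i | i. True}
   \<union> {gen_s j * gen_s i - gen_s i * gen_s j | i j. m i j = 2}
   \<union> {gen_D j * gen_s i - gen_s i * gen_D j | i j. m i j = 2}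
   \<union> {gen_D j * gen_D i - gen_D i * gen_D j | i j. m i j = 2}
   \<union> {gen_s j * gen_s i * gen_s j - gen_s i * gen_s j * gen_s i | i j. m i j = 3}
   \<union> {gen_D i * gen_s j * gen_s i - gen_s j * gen_s i * gen_D j | i j. m i j = 3}
   \<union> {gen_D j * gen_s i * gen_D j
        - (gen_s i * gen_D j * gen_D i + gen_D i * gen_D j * gen_s i + gen_s i * gen_D j * gen_s i)
      | i j. m i j = 3}"

end

theory Submission
  imports Defs
begin

text \<open>The elements \<open>D\<^sub>s\<close> exist because a group element carrying one simple root to another is a
  product of such elements of finite dihedral parabolic subgroups, for which the relations of \<open>H_hat(W)\<close>
  give the claim. An explicit representation shows that the products
  \<open>D\<^bsub>t\<^sub>1\<^esub> \<dots> D\<^bsub>t\<^sub>k\<^esub> w\<close> without equal neighbours are linearly independent, so membership in \<open>K\<^sub>i\<^sub>j\<close>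
  becomes a linear system for the coefficients of \<open>x\<close>: all components of \<open>w x w\<^sup>-\<^sup>1\<close> at group
  elements other than \<open>1\<close> vanish. For \<open>m\<^sub>i\<^sub>j = 2\<close> only the multiples of the commutator of
  \<open>D\<^sub>i\<close> and \<open>D\<^sub>j\<close> remain. For \<open>m\<^sub>i\<^sub>j = 3\<close>, with \<open>A = D\<^sub>i\<close>, \<open>B = D\<^sub>j\<close> and
  \<open>C = s\<^sub>i D\<^sub>j s\<^sub>i\<close>, all solutions lie in the ideal generated by \<open>A C - B A + C B - C\<close> and
  \<open>B C - A B + C A - C\<close>. Both of these belong to \<open>K\<^sub>i\<^sub>j\<close>, and the first is the last relator of the
  presentation multiplied by \<open>s\<^sub>i\<close>.\<close>

section \<open>Quotients of the free algebra\<close>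

text \<open>The relations give s_i D_i s_i = 1 - s_i - D_i, so a conjugate of D_i depends on more
  than the reflection it belongs to. The sign of the root removes the ambiguity: D_t is D_i
  conjugated by a word that takes alpha_i to the positive root of t, and prefixing s_i gives a word
  of the same kind unless t = s_i. Well-definedness then becomes the statement about elements
  carrying a simple root to a simple root.

  K_ij is an intersection of conjugates and comes without generators, so its elements can only be
  tested. The test has content because of the term -1 in s_i D_i = s_i - 1 - D_i s_i: there s_i
  disappears, and the word is left with a group component other than 1. In an element of K_ij these
  contributions must cancel. Conversely, membership is shown by a small set of elements that
  conjugation by s_i and s_j permutes.

  A pair with m_ij = 0 contributes nothing: degree 0 leaves the constants, and the counit removes
  them. Infinite dihedral subgroups therefore matter only for the roots.\<close>

lemma ring_of_type_algebra_simps [simp]: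
  "carrier ring_of_type_algebra = UNIV"
  "x \<otimes>\<^bsub>ring_of_type_algebra\<^esub> y = x * y"
  "\<one>\<^bsub>ring_of_type_algebra\<^esub> = 1"
  "\<zero>\<^bsub>ring_of_type_algebra\<^esub> = 0"
  "x \<oplus>\<^bsub>ring_of_type_algebra\<^esub> y = x + y"
  for x y :: "'a::ring_1"
  by (simp_all add: ring_of_type_algebra_def)

lemma ring_ring_of_type_algebra: "ring (ring_of_type_algebra :: 'a::ring_1 ring)"
proof -
  have "\<exists>y. y + x = 0 \<and> x + y = 0" for x :: 'a
    by (rule exI[of _ "- x"]) simp
  then show ?thesis
    by unfold_locales (auto simp: algebra_simps Units_def)
qed

lemma a_inv_ring_of_type_algebra [simp]:
  "\<ominus>\<^bsub>ring_of_type_algebra\<^esub> x = - x" for x :: "'a::ring_1"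
  by (rule abelian_group.minus_equality[OF ring.is_abelian_group[OF ring_ring_of_type_algebra]])
    simp_all

lemma a_minus_ring_of_type_algebra [simp]:
  "x \<ominus>\<^bsub>ring_of_type_algebra\<^esub> y = x - y" for x y :: "'a::ring_1"
  by (simp add: a_minus_def)

lemma ideal_ring_of_type_algebraI:
  fixes I :: "'a::ring_1 set"
  assumes "0 \<in> I" "\<And>x y. x \<in> I \<Longrightarrow> y \<in> I \<Longrightarrow> x - y \<in> I"
    and "\<And>x a. x \<in> I \<Longrightarrow> a * x \<in> I" "\<And>x a. x \<in> I \<Longrightarrow> x * a \<in> I"
  shows "ideal I ring_of_type_algebra"
proof (rule idealI[OF ring_ring_of_type_algebra])
  have neg: "- x \<in> I" if "x \<in> I" for x
    using assms(2)[OF assms(1) that] by simp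
  show "subgroup I (add_monoid ring_of_type_algebra)"
    apply unfold_locales
    subgoal by simp
    subgoal for x y using assms(2)[of x "- y"] neg[of y] by simp
    subgoal by (simp add: assms(1))
    subgoal for x using neg[of x] a_inv_ring_of_type_algebra[of x] unfolding a_inv_def by simp
    done
qed (use assms(3,4) in auto)

context
  fixes I :: "'a::ring_1 set"
  assumes I: "ideal I ring_of_type_algebra"
begin

interpretation I: ideal I ring_of_type_algebra by (rule I)

lemma ideal_zero: "0 \<in> I"
  using additive_subgroup.zero_closed[OF ideal.axioms(1)[OF I]] by simp

lemma ideal_add: "x \<in> I \<Longrightarrow> y \<in> I \<Longrightarrow> x + y \<in> I"
  using additive_subgroup.a_closed[OF ideal.axioms(1)[OF I], of x y] by simp

lemma ideal_minus: "x \<in> I \<Longrightarrow> - x \<in> I"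
  using additive_subgroup.a_inv_closed[OF ideal.axioms(1)[OF I], of x] by simp

lemma ideal_diff: "x \<in> I \<Longrightarrow> y \<in> I \<Longrightarrow> x - y \<in> I"
  using ideal_add[of x "- y"] ideal_minus[of y] by simp

lemma ideal_mult_left: "x \<in> I \<Longrightarrow> a * x \<in> I"
  using I.I_l_closed[of x a] by simp

lemma ideal_mult_right: "x \<in> I \<Longrightarrow> x * a \<in> I"
  using I.I_r_closed[of x a] by simp

end

text \<open>A quotient by an ideal depending on a parameter cannot be a type, but all quotients of a ring
  by its ideals can be packed into one. This makes type class reasoning available in quotients.\<close>

quotient_type (overloaded) 'a ideal_quotients = "'a::ring_1 set \<Rightarrow> 'a" /
  "\<lambda>F G. \<forall>I. ideal I ring_of_type_algebra \<longrightarrow> F I - G I \<in> I"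
proof (rule equivpI)
  show "reflp (\<lambda>F G :: 'a set \<Rightarrow> 'a. \<forall>I. ideal I ring_of_type_algebra \<longrightarrow> F I - G I \<in> I)"
    by (auto intro!: reflpI ideal_zero)
  show "symp (\<lambda>F G :: 'a set \<Rightarrow> 'a. \<forall>I. ideal I ring_of_type_algebra \<longrightarrow> F I - G I \<in> I)"
    by (rule sympI) (metis ideal_minus minus_diff_eq)
  show "transp (\<lambda>F G :: 'a set \<Rightarrow> 'a. \<forall>I. ideal I ring_of_type_algebra \<longrightarrow> F I - G I \<in> I)"
    by (rule transpI) (metis ideal_add add_diff_eq diff_add_cancel)
qed

instantiation ideal_quotients :: (ring_1) ring_1
begin

lift_definition zero_ideal_quotients :: "'a ideal_quotients" is "\<lambda>I. 0" .
lift_definition one_ideal_quotients :: "'a ideal_quotients" is "\<lambda>I. 1" .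
lift_definition plus_ideal_quotients ::
  "'a ideal_quotients \<Rightarrow> 'a ideal_quotients \<Rightarrow> 'a ideal_quotients" is "\<lambda>F G I. F I + G I"
proof -
  fix F F' G G' :: "'a set \<Rightarrow> 'a" and I :: "'a set"
  assume *: "\<And>I. ideal I ring_of_type_algebra \<Longrightarrow> F I - F' I \<in> I"
    "\<And>I. ideal I ring_of_type_algebra \<Longrightarrow> G I - G' I \<in> I" "ideal I ring_of_type_algebra"
  then have "(F I - F' I) + (G I - G' I) \<in> I"
    by (blast intro: ideal_add)
  then show "F I + G I - (F' I + G' I) \<in> I"
    by (simp add: algebra_simps)
qed
lift_definition uminus_ideal_quotients :: "'a ideal_quotients \<Rightarrow> 'a ideal_quotients"
  is "\<lambda>F I. - F I"
proof -
  fix F F' :: "'a set \<Rightarrow> 'a" and I :: "'a set"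
  assume "\<And>I. ideal I ring_of_type_algebra \<Longrightarrow> F I - F' I \<in> I" "ideal I ring_of_type_algebra"
  then have "- (F I - F' I) \<in> I"
    by (blast intro: ideal_minus)
  then show "- F I - - F' I \<in> I"
    by (simp add: algebra_simps)
qed
lift_definition minus_ideal_quotients ::
  "'a ideal_quotients \<Rightarrow> 'a ideal_quotients \<Rightarrow> 'a ideal_quotients" is "\<lambda>F G I. F I - G I"
proof -
  fix F F' G G' :: "'a set \<Rightarrow> 'a" and I :: "'a set"
  assume *: "\<And>I. ideal I ring_of_type_algebra \<Longrightarrow> F I - F' I \<in> I"
    "\<And>I. ideal I ring_of_type_algebra \<Longrightarrow> G I - G' I \<in> I" "ideal I ring_of_type_algebra"
  then have "(F I - F' I) - (G I - G' I) \<in> I"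
    by (blast intro: ideal_diff)
  then show "F I - G I - (F' I - G' I) \<in> I"
    by (simp add: algebra_simps)
qed
lift_definition times_ideal_quotients ::
  "'a ideal_quotients \<Rightarrow> 'a ideal_quotients \<Rightarrow> 'a ideal_quotients" is "\<lambda>F G I. F I * G I"
proof -
  fix F F' G G' :: "'a set \<Rightarrow> 'a" and I :: "'a set"
  assume *: "\<And>I. ideal I ring_of_type_algebra \<Longrightarrow> F I - F' I \<in> I"
    "\<And>I. ideal I ring_of_type_algebra \<Longrightarrow> G I - G' I \<in> I" "ideal I ring_of_type_algebra"
  then have "(F I - F' I) * G I + F' I * (G I - G' I) \<in> I"
    by (blast intro: ideal_add ideal_mult_left ideal_mult_right)
  then show "F I * G I - F' I * G' I \<in> I"
    by (simp add: algebra_simps)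
qed

instance
proof
  fix a b c :: "'a ideal_quotients"
  have null: "\<forall>I. ideal I ring_of_type_algebra \<longrightarrow> F I - G I \<in> I" if "F = G"
    for F G :: "'a set \<Rightarrow> 'a"
    using that by (simp add: ideal_zero)
  show "a + b + c = a + (b + c)" by transfer (rule null, simp add: fun_eq_iff algebra_simps)
  show "a + b = b + a" by transfer (rule null, simp add: fun_eq_iff algebra_simps)
  show "0 + a = a" by transfer (rule null, simp add: fun_eq_iff algebra_simps)
  show "- a + a = 0" by transfer (rule null, simp add: fun_eq_iff algebra_simps)
  show "a - b = a + - b" by transfer (rule null, simp add: fun_eq_iff algebra_simps)
  show "a * b * c = a * (b * c)" by transfer (rule null, simp add: fun_eq_iff algebra_simps)
  show "(a + b) * c = a * c + b * c" by transfer (rule null, simp add: fun_eq_iff algebra_simps)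
  show "a * (b + c) = a * b + a * c" by transfer (rule null, simp add: fun_eq_iff algebra_simps)
  show "1 * a = a" by transfer (rule null, simp)
  show "a * 1 = a" by transfer (rule null, simp)
  have "ideal {0 :: 'a} ring_of_type_algebra"
    by (rule ideal_ring_of_type_algebraI) auto
  then show "(0 :: 'a ideal_quotients) \<noteq> 1"
    by transfer (auto intro!: exI[of _ "{0}"])
qed

end

lemma free_alg_mult: "frag_of xs * frag_of ys = frag_of (xs @ ys)"
  by (simp add: mult_single plus_list_def)

lemma free_alg_one: "(1 :: 'g free_alg) = frag_of []"
  by (simp add: zero_list_def flip: single_one)

lemma word_s_Nil [simp]: "word_s [] = 1"
  and word_s_Cons [simp]: "word_s (x # xs) = gen_s x * word_s xs"
  and word_s_append: "word_s (xs @ ys) = word_s xs * word_s ys"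
  by (simp_all add: word_s_def)

section \<open>The counit on the free algebra, and presentations\<close>

definition eps :: "'i gen free_alg \<Rightarrow> int" where
  "eps p = Poly_Mapping.lookup
     (frag_extend (\<lambda>xs. if xs \<in> lists (range GS) then frag_of () else 0) p) ()"

lemma eps_of: "eps (frag_of xs) = (if xs \<in> lists (range GS) then 1 else 0)"
  by (simp add: eps_def)

lemma eps_diff [simp]: "eps (p - q) = eps p - eps q"
  by (simp add: eps_def frag_extend_diff lookup_minus)

lemma eps_add [simp]: "eps (p + q) = eps p + eps q"
  by (simp add: eps_def frag_extend_add lookup_add)

lemma eps_0 [simp]: "eps 0 = 0"
  by (simp add: eps_def)

lemma eps_minus [simp]: "eps (- p) = - eps p"
  using eps_diff[of 0 p] by simp

lemma eps_1 [simp]: "eps 1 = 1"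
  by (simp add: free_alg_one eps_of)

lemma eps_gen [simp]: "eps (gen_s i) = 1" "eps (gen_D i) = 0"
  by (auto simp: eps_of)

lemma eps_mult [simp]: "eps (p * q) = eps p * eps q"
  using subset_UNIV
proof (induction p rule: frag_induction)
  case (one xs)
  show ?case
    using subset_UNIV
  proof (induction q rule: frag_induction)
    case (one ys)
    then show ?case by (auto simp: eps_of free_alg_mult)
  qed (simp_all add: algebra_simps)
qed (simp_all add: algebra_simps)

lemma eps_power [simp]: "eps (p ^ n) = eps p ^ n"
  by (induction n) simp_all

lemma eps_word_s [simp]: "eps (word_s xs) = 1"
  by (induction xs) simp_all

lemma ideal_Idl: "ideal (Idl\<^bsub>Free\<^esub> R) Free"
  by (rule ring.genideal_ideal[OF ring_ring_of_type_algebra]) simp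

lemma Idl_incl: "r \<in> R \<Longrightarrow> r \<in> Idl\<^bsub>Free\<^esub> R"
  using ring.genideal_self[OF ring_ring_of_type_algebra, of R] by auto

lemma Idl_least: "ideal I Free \<Longrightarrow> R \<subseteq> I \<Longrightarrow> Idl\<^bsub>Free\<^esub> R \<subseteq> I"
  by (rule ring.genideal_minimal[OF ring_ring_of_type_algebra])

lemma ring_pres: "ring (pres R)"
  unfolding pres_def by (rule ideal.quotient_is_ring[OF ideal_Idl])

lemma pres_class_hom: "pres_class R \<in> ring_hom Free (pres R)"
proof -
  have "pres_class R = (+>\<^bsub>Free\<^esub>) (Idl\<^bsub>Free\<^esub> R)"
    by (rule ext) (simp add: pres_class_def)
  then show ?thesis
    unfolding pres_def using ideal.rcos_ring_hom[OF ideal_Idl] by simp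
qed

lemma carrier_pres: "carrier (pres R) = range (pres_class R)"
  by (auto simp: pres_def FactRing_def A_RCOSETS_def' pres_class_def)

lemma pres_class_closed [simp, intro]: "pres_class R p \<in> carrier (pres R)"
  by (simp add: carrier_pres)

lemma pres_class_mult: "pres_class R p \<otimes>\<^bsub>pres R\<^esub> pres_class R q = pres_class R (p * q)"
  and pres_class_add: "pres_class R p \<oplus>\<^bsub>pres R\<^esub> pres_class R q = pres_class R (p + q)"
  and pres_class_one: "\<one>\<^bsub>pres R\<^esub> = pres_class R 1"
  using ring_hom_mult[OF pres_class_hom, of p q R] ring_hom_add[OF pres_class_hom, of p q R]
    ring_hom_one[OF pres_class_hom, of R] by simp_all

lemma pres_class_zero: "\<zero>\<^bsub>pres R\<^esub> = pres_class R 0"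
  using ring_hom_zero[OF pres_class_hom ring_ring_of_type_algebra ring_pres, symmetric] by simp

lemma pres_class_minus: "\<ominus>\<^bsub>pres R\<^esub> pres_class R p = pres_class R (- p)"
proof -
  interpret ring "pres R" by (rule ring_pres)
  show ?thesis
    by (rule minus_equality) (simp_all add: pres_class_add pres_class_zero)
qed

lemma pres_class_eq_iff: "pres_class R p = pres_class R q \<longleftrightarrow> p - q \<in> Idl\<^bsub>Free\<^esub> R"
proof -
  interpret abelian_subgroup "Idl\<^bsub>Free\<^esub> R" Free
    by (rule abelian_subgroupI3[OF ideal.axioms(1)[OF ideal_Idl]
          ring.is_abelian_group[OF ring_ring_of_type_algebra]])
  have "p \<in> pres_class R p"
    using a_rcos_self[of p] by (simp add: pres_class_def)
  moreover have "p \<in> pres_class R q \<longleftrightarrow> p - q \<in> Idl\<^bsub>Free\<^esub> R"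
    using a_rcos_module_minus[OF ring_ring_of_type_algebra, of q p]
    by (simp add: pres_class_def)
  moreover have "pres_class R p = pres_class R q" if "p \<in> pres_class R q"
    using a_repr_independence[OF _ _ a_subgroup, of p q] that by (simp add: pres_class_def)
  ultimately show ?thesis by blast
qed

text \<open>The components at the other ideals are filled in by the counit, so that the map stays
  unital and kills the relators.\<close>

definition iota :: "'i gen free_alg set \<Rightarrow> 'i gen free_alg \<Rightarrow> 'i gen free_alg ideal_quotients" where
  "iota R p = abs_ideal_quotients (\<lambda>I. if I = Idl\<^bsub>Free\<^esub> R then p else of_int (eps p))"

lemma iota_add: "iota R (p + q) = iota R p + iota R q"
  and iota_diff: "iota R (p - q) = iota R p - iota R q"
  and iota_minus: "iota R (- p) = - iota R p"
  and iota_mult: "iota R (p * q) = iota R p * iota R q"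
  and iota_0: "iota R 0 = 0"
  and iota_1: "iota R 1 = 1"
  by (simp_all add: iota_def plus_ideal_quotients.abs_eq minus_ideal_quotients.abs_eq
      uminus_ideal_quotients.abs_eq times_ideal_quotients.abs_eq zero_ideal_quotients_def
      one_ideal_quotients_def if_distrib cong: if_cong)

lemma iota_power: "iota R (p ^ n) = iota R p ^ n"
  by (induction n) (simp_all add: iota_mult iota_1)

lemmas iota_simps = iota_add iota_diff iota_minus iota_mult iota_0 iota_1 iota_power

lemma ideal_kernel_eps: "ideal {p. eps p = 0} Free"
  by (rule ideal_ring_of_type_algebraI) auto

lemma eps_Idl:
  assumes "\<And>r. r \<in> R \<Longrightarrow> eps r = 0" "p \<in> Idl\<^bsub>Free\<^esub> R"
  shows "eps p = 0"
  using Idl_least[OF ideal_kernel_eps, of R] assms by blast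

text \<open>Every ideal other than \<open>Idl R\<close> sees only the integer
  \<open>eps p - eps q\<close>. As the relators lie in the kernel of \<open>eps\<close>, this
  integer vanishes as soon as the component at \<open>Idl R\<close> identifies \<open>p\<close> and
  \<open>q\<close>.\<close>

lemma iota_eq_iff:
  assumes "\<And>r. r \<in> R \<Longrightarrow> eps r = 0"
  shows "iota R p = iota R q \<longleftrightarrow> pres_class R p = pres_class R q"
proof -
  have "iota R p = iota R q \<longleftrightarrow> (\<forall>I. ideal I Free \<longrightarrow>
      (if I = Idl\<^bsub>Free\<^esub> R then p else of_int (eps p)) - (if I = Idl\<^bsub>Free\<^esub> R then q else of_int (eps q)) \<in> I)"
    unfolding iota_def by (rule ideal_quotients.abs_eq_iff)
  also have "\<dots> \<longleftrightarrow> p - q \<in> Idl\<^bsub>Free\<^esub> R"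
    using eps_Idl[OF assms, of R "p - q"] by (auto simp: ideal_Idl ideal_zero)
  finally show ?thesis
    by (simp add: pres_class_eq_iff)
qed

section \<open>Coxeter groups\<close>

text \<open>The source of all invariants of group elements below: the parity of the length, the
  action on functionals, and the image in the algebra.\<close>

lemma coxeter_rel_invariant:
  assumes "\<And>us i j vs. f (us @ concat (replicate (m i j) [i, j]) @ vs) = f (us @ vs)"
    and "equivclp (coxeter_step m) xs ys"
  shows "f xs = f ys"
  using assms(2) by (induction rule: equivclp_induct) (auto elim!: coxeter_step.cases simp: assms(1))

locale coxeter =
  fixes m :: "'i \<Rightarrow> 'i \<Rightarrow> nat"
  assumes coxeter_matrix: "coxeter_matrix m"
begin

abbreviation word_eq (infix "\<asymp>" 50) where "xs \<asymp> ys \<equiv> equivclp (coxeter_step m) xs ys"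

abbreviation cls :: "'i list \<Rightarrow> 'i list set" where "cls xs \<equiv> coxeter_rel m `` {xs}"

abbreviation W where "W \<equiv> coxeter_group m"

lemma m_sym: "m i j = m j i"
  and m_diag: "m i i = 1"
  using coxeter_matrix by (simp_all add: coxeter_matrix_def)

lemmas word_eq_refl = equivclp_refl[of "coxeter_step m"]
lemmas word_eq_sym = equivclp_sym[of "coxeter_step m"]
lemmas word_eq_trans = equivclp_trans[of "coxeter_step m"]

lemma mem_coxeter_rel [simp]: "(xs, ys) \<in> coxeter_rel m \<longleftrightarrow> xs \<asymp> ys"
  by (simp add: coxeter_rel_def)

lemma cls_eq_iff: "cls xs = cls ys \<longleftrightarrow> xs \<asymp> ys"
proof
  assume "cls xs = cls ys"
  moreover have "ys \<in> cls ys" by simp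
  ultimately show "xs \<asymp> ys" by auto
next
  assume "xs \<asymp> ys"
  then have "xs \<asymp> zs \<longleftrightarrow> ys \<asymp> zs" for zs
    by (blast intro: word_eq_sym word_eq_trans)
  then show "cls xs = cls ys" by auto
qed

lemma word_eq_context: "xs \<asymp> ys \<Longrightarrow> us @ xs @ vs \<asymp> us @ ys @ vs"
proof (induction rule: equivclp_induct)
  case (step ys zs)
  have "coxeter_step m (us @ a @ vs) (us @ b @ vs)" if "coxeter_step m a b" for a b
    using that
  proof cases
    case (1 us' i j vs')
    then show ?thesis
      using coxeter_step.intros[of m "us @ us'" i j "vs' @ vs"] by simp
  qed
  with step show ?case
    by (blast intro: equivclp_into_equivclp)
qed simp

lemma word_eq_append: "xs \<asymp> xs' \<Longrightarrow> ys \<asymp> ys' \<Longrightarrow> xs @ ys \<asymp> xs' @ ys'"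
  using word_eq_context[of xs xs' "[]" ys] word_eq_context[of ys ys' xs' "[]"]
  by (auto intro: word_eq_trans)

lemma word_eq_step: "concat (replicate (m i j) [i, j]) \<asymp> []"
  using coxeter_step.intros[of m "[]" i j "[]"] by (auto simp: coxeter_rel_def)

lemma word_eq_square: "[i, i] \<asymp> []"
  using word_eq_step[of i i] by (simp add: m_diag)

lemma word_eq_rev: "xs @ rev xs \<asymp> []"
proof (induction xs)
  case (Cons x xs)
  have "[x] @ (xs @ rev xs) @ [x] \<asymp> [x] @ [] @ [x]"
    by (rule word_eq_context[OF Cons])
  then show ?case
    using word_eq_square[of x] by (auto intro: word_eq_trans)
qed simp

lemma word_eq_rev': "rev xs @ xs \<asymp> []"
  using word_eq_rev[of "rev xs"] by simp

lemma word_eq_cancel_left: "xs @ ys \<asymp> xs @ zs \<longleftrightarrow> ys \<asymp> zs"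
proof
  assume "xs @ ys \<asymp> xs @ zs"
  then have "rev xs @ xs @ ys \<asymp> rev xs @ xs @ zs"
    by (rule word_eq_append[OF word_eq_refl])
  moreover have "rev xs @ xs @ ys \<asymp> ys" "rev xs @ xs @ zs \<asymp> zs"
    using word_eq_append[OF word_eq_rev'[of xs] word_eq_refl] by force+
  ultimately show "ys \<asymp> zs"
    by (blast intro: word_eq_sym word_eq_trans)
qed (auto intro: word_eq_append)

lemma word_eq_cancel_right: "ys @ xs \<asymp> zs @ xs \<longleftrightarrow> ys \<asymp> zs"
proof
  assume "ys @ xs \<asymp> zs @ xs"
  then have "(ys @ xs) @ rev xs \<asymp> (zs @ xs) @ rev xs"
    by (rule word_eq_append[OF _ word_eq_refl])
  moreover have "(ys @ xs) @ rev xs \<asymp> ys" "(zs @ xs) @ rev xs \<asymp> zs"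
    using word_eq_append[OF word_eq_refl word_eq_rev, of _ xs] by force+
  ultimately show "ys \<asymp> zs"
    by (blast intro: word_eq_sym word_eq_trans)
qed (auto intro: word_eq_append)

lemma word_eq_revI: "xs \<asymp> ys \<Longrightarrow> rev xs \<asymp> rev ys"
proof -
  assume "xs \<asymp> ys"
  then have "xs @ rev ys \<asymp> ys @ rev ys"
    by (rule word_eq_append) simp
  also have "\<dots> \<asymp> []" by (rule word_eq_rev)
  finally have "xs @ rev ys \<asymp> xs @ rev xs"
    by (blast intro: word_eq_rev word_eq_trans word_eq_sym)
  then show ?thesis
    by (auto simp: word_eq_cancel_left intro: word_eq_sym)
qed

lemma word_eq_comm: "m i j = 2 \<Longrightarrow> [i, j] \<asymp> [j, i]"
proof -
  assume "m i j = 2"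
  then have "[i, j] @ [i, j] \<asymp> []"
    using word_eq_step[of i j] by (simp add: numeral_2_eq_2)
  also have "[] \<asymp> [j, i] @ [i, j]"
    using word_eq_rev'[of "[i, j]"] by (auto intro: word_eq_sym)
  finally show ?thesis
    by (simp only: word_eq_cancel_right)
qed

lemma word_eq_braid: "m i j = 3 \<Longrightarrow> [i, j, i] \<asymp> [j, i, j]"
proof -
  assume "m i j = 3"
  then have "[i, j, i] @ [j, i, j] \<asymp> []"
    using word_eq_step[of i j] by (simp add: numeral_3_eq_3)
  also have "[] \<asymp> [j, i, j] @ [j, i, j]"
    using word_eq_rev'[of "[j, i, j]"] by (auto intro: word_eq_sym)
  finally show ?thesis
    by (simp only: word_eq_cancel_right)
qed

lemma carrier_W: "carrier W = range cls"
  by (auto simp: coxeter_group_def quotient_def)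

lemma cls_in_carrier [simp, intro]: "cls xs \<in> carrier W"
  by (auto simp: carrier_W)

lemma mult_cls: "cls xs \<otimes>\<^bsub>W\<^esub> cls ys = cls (xs @ ys)"
proof -
  have "cls xs \<otimes>\<^bsub>W\<^esub> cls ys = (\<Union>x\<in>cls xs. \<Union>y\<in>cls ys. cls (x @ y))"
    by (simp add: coxeter_group_def)
  also have "\<dots> = (\<Union>x\<in>cls xs. \<Union>y\<in>cls ys. cls (xs @ ys))"
  proof (intro SUP_cong refl)
    fix x y assume "x \<in> cls xs" "y \<in> cls ys"
    then show "cls (x @ y) = cls (xs @ ys)"
      unfolding cls_eq_iff by (auto intro: word_eq_append word_eq_sym)
  qed
  also have "\<dots> = cls (xs @ ys)"
  proof -
    have "xs \<in> cls xs" "ys \<in> cls ys" by simp_all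
    then show ?thesis by blast
  qed
  finally show ?thesis .
qed

lemma one_W: "\<one>\<^bsub>W\<^esub> = cls []"
  by (simp add: coxeter_group_def)

lemma group_W: "group W"
proof (rule groupI)
  fix x assume "x \<in> carrier W"
  then obtain xs where "x = cls xs" by (auto simp: carrier_W)
  then have "cls (rev xs) \<otimes>\<^bsub>W\<^esub> x = \<one>\<^bsub>W\<^esub>"
    by (simp only: mult_cls one_W cls_eq_iff word_eq_rev')
  then show "\<exists>y\<in>carrier W. y \<otimes>\<^bsub>W\<^esub> x = \<one>\<^bsub>W\<^esub>"
    by blast
qed (auto simp: carrier_W mult_cls one_W)

lemma inv_cls: "inv\<^bsub>W\<^esub> cls xs = cls (rev xs)"
  by (rule group.inv_equality[OF group_W]) (auto simp: mult_cls one_W cls_eq_iff word_eq_rev')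

lemma simple_refl_eq: "simple_refl m i = cls [i]"
  by (simp add: simple_refl_def)

lemma reflections_eq: "reflections m = {cls (xs @ i # rev xs) | xs i. True}"
proof -
  have eq: "cls xs \<otimes>\<^bsub>W\<^esub> simple_refl m i \<otimes>\<^bsub>W\<^esub> inv\<^bsub>W\<^esub> cls xs = cls (xs @ i # rev xs)" for xs i
    by (simp only: simple_refl_eq inv_cls mult_cls) simp
  show ?thesis
  proof (intro equalityI subsetI)
    fix t assume "t \<in> reflections m"
    then obtain xs i where "t = cls xs \<otimes>\<^bsub>W\<^esub> simple_refl m i \<otimes>\<^bsub>W\<^esub> inv\<^bsub>W\<^esub> cls xs"
      unfolding reflections_def carrier_W by blast
    then show "t \<in> {cls (xs @ i # rev xs) | xs i. True}"
      unfolding eq by blast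
  next
    fix t assume "t \<in> {cls (xs @ i # rev xs) | xs i. True}"
    then obtain xs i where "t = cls xs \<otimes>\<^bsub>W\<^esub> simple_refl m i \<otimes>\<^bsub>W\<^esub> inv\<^bsub>W\<^esub> cls xs"
      unfolding eq by blast
    then show "t \<in> reflections m"
      unfolding reflections_def using cls_in_carrier by blast
  qed
qed

text \<open>The sign character. It separates reflections from rotations without any solution of the
  word problem.\<close>

lemma even_length_word_eq: "xs \<asymp> ys \<Longrightarrow> even (length xs) = even (length ys)"
  by (rule coxeter_rel_invariant[of "\<lambda>xs. even (length xs)"]) (auto simp: length_concat sum_list_replicate)

lemma odd_length_reflection: "cls xs \<in> reflections m \<Longrightarrow> odd (length xs)"
proof -
  assume "cls xs \<in> reflections m"
  then obtain ys i where "cls xs = cls (ys @ i # rev ys)"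
    unfolding reflections_eq by blast
  then show ?thesis
    using even_length_word_eq[of xs "ys @ i # rev ys"] by (simp only: cls_eq_iff) simp
qed

lemma parabolic_eq: "parabolic m J = cls ` lists J"
proof -
  have "w \<in> cls ` lists J" if "w \<in> generate W (simple_refl m ` J)" for w
    using that
  proof (induction rule: generate.induct)
    case one
    then show ?case by (auto simp: one_W)
  next
    case (incl h)
    then show ?case by (auto simp: simple_refl_eq)
  next
    case (inv h)
    then show ?case by (auto simp: simple_refl_eq inv_cls)
  next
    case (eng h1 h2)
    then obtain xs ys where "xs \<in> lists J" "ys \<in> lists J" "h1 = cls xs" "h2 = cls ys"
      by blast
    then show ?case
      by (auto simp: mult_cls intro!: imageI)
  qed
  moreover have "cls xs \<in> generate W (simple_refl m ` J)" if "xs \<in> lists J" for xs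
    using that
  proof (induction xs)
    case Nil
    then show ?case using generate.one[of W] by (simp add: one_W)
  next
    case (Cons x xs)
    then have "simple_refl m x \<otimes>\<^bsub>W\<^esub> cls xs \<in> generate W (simple_refl m ` J)"
      by (intro generate.eng[OF generate.incl]) auto
    then show ?case by (simp add: simple_refl_eq mult_cls)
  qed
  ultimately show ?thesis
    by (auto simp: parabolic_def)
qed

section \<open>Length and dihedral tails of reduced words\<close>

definition len :: "'i list \<Rightarrow> nat" where
  "len xs = (LEAST n. \<exists>ys. xs \<asymp> ys \<and> length ys = n)"

lemma len_le: "xs \<asymp> ys \<Longrightarrow> len xs \<le> length ys"
  unfolding len_def by (rule Least_le) auto

lemma obtain_reduced: obtains ys where "xs \<asymp> ys" "length ys = len xs"
  using LeastI_ex[of "\<lambda>n. \<exists>ys. xs \<asymp> ys \<and> length ys = n"] word_eq_refl[of xs]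
  unfolding len_def by blast

lemma len_cong: "xs \<asymp> ys \<Longrightarrow> len xs = len ys"
  by (metis obtain_reduced len_le word_eq_trans word_eq_sym le_antisym)

lemma len_append_le: "len (xs @ ys) \<le> len xs + length ys"
  by (metis obtain_reduced[of xs] len_le length_append word_eq_append word_eq_refl)

end

lemma distinct_adj_alternating:
  assumes "distinct_adj v" "set v \<subseteq> {a, b}" "v \<noteq> []" "hd v = a"
  shows "v = alternating a b (length v)"
  using assms
proof (induction v arbitrary: a b)
  case (Cons x v)
  show ?case
  proof (cases v)
    case (Cons y w)
    then have "v = alternating b a (length v)"
      using Cons.prems by (intro Cons.IH) auto
    then show ?thesis using Cons.prems by simp
  qed (use Cons.prems in auto)
qed simp

lemma not_distinct_adj:
  assumes "\<not> distinct_adj v"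
  obtains a x b where "v = a @ [x, x] @ b"
  using assms
proof (induction v arbitrary: thesis)
  case (Cons y v)
  show ?case
  proof (cases "distinct_adj v")
    case True
    then obtain w where "v = y # w"
      using Cons.prems(2) by (cases v) auto
    then show ?thesis
      using Cons.prems(1)[of "[]" y w] by simp
  next
    case False
    then obtain a x b where "v = a @ [x, x] @ b"
      using Cons.IH by blast
    then show ?thesis
      using Cons.prems(1)[of "y # a" x b] by simp
  qed
qed simp

locale simply_laced_coxeter = coxeter m for m :: "'i \<Rightarrow> 'i \<Rightarrow> nat" +
  assumes simply_laced: "simply_laced m"
begin

lemma m_cases: "i \<noteq> j \<Longrightarrow> m i j = 0 \<or> m i j = 2 \<or> m i j = 3"
  using simply_laced by (auto simp: simply_laced_def)

text \<open>Reduced words in two letters alternate, and one that \<open>j\<close> does not shorten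
  cannot end in \<open>j\<close>. If it were longer than listed, a commutation or braid move would
  bring a \<open>j\<close> to its end all the same. For \<open>m j k = 0\<close> there is no such
  move, and every length occurs.\<close>

lemma dihedral_tail:
  assumes "set v \<subseteq> {j, k}" "j \<noteq> k" "v \<noteq> []"
    and red: "\<And>v'. v \<asymp> v' \<Longrightarrow> length v \<le> length v'"
    and red': "\<And>v'. v @ [j] \<asymp> v' \<Longrightarrow> length v \<le> length v'"
  shows "(m j k = 2 \<and> v = [k]) \<or> (m j k = 3 \<and> (v = [k] \<or> v = [j, k])) \<or>
    (m j k = 0 \<and> (\<exists>n. v = rev (alternating k j (Suc n))))"
proof -
  have adj: "distinct_adj v"
  proof (rule ccontr)
    assume "\<not> distinct_adj v"
    then obtain a x b where v: "v = a @ [x, x] @ b" by (rule not_distinct_adj)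
    then have "v \<asymp> a @ [] @ b"
      using word_eq_context[OF word_eq_square, of a x b] by simp
    then show False using red v by fastforce
  qed
  \<comment> \<open>The common contradiction: a \<open>j\<close> at the end of \<open>v\<close>,
    perhaps produced by a move, cancels against the appended \<open>j\<close> and leaves a word
    shorter than \<open>v\<close>.\<close>
  have short: False if "v = u @ [x]" "v @ [j] \<asymp> u' @ [j, j]" "length u' \<le> length u" for u x u'
  proof -
    have "u' @ [j, j] \<asymp> u'"
      using word_eq_context[OF word_eq_square[of j], of u' "[]"] by simp
    then show False
      using red'[of u'] that word_eq_trans by fastforce
  qed
  obtain u x where u: "v = u @ [x]"
    using \<open>v \<noteq> []\<close> by (cases v rule: rev_cases) auto
  have "x \<noteq> j"
    using short[OF u, of u] u by auto
  then have "x = k"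
    using assms(1) u by auto
  then obtain n where v: "rev v = alternating k j (Suc n)"
  proof -
    have "rev v = alternating k j (length (rev v))"
      using adj assms(1) u \<open>x = k\<close> distinct_adj_rev[of v]
      by (intro distinct_adj_alternating) (auto simp del: distinct_adj_rev)
    then show thesis
      using that[of "length u"] u by simp
  qed
  then have v': "v = rev (alternating k j (Suc n))"
    by (metis rev_rev_ident)
  have False if "m j k = 2" "n = Suc n'" for n'
  proof -
    let ?u = "rev (alternating k j n')"
    have "v @ [j] = ?u @ [j, k] @ [j]"
      using v' that by simp
    also have "\<dots> \<asymp> ?u @ [k, j] @ [j]"
      by (rule word_eq_context[OF word_eq_comm[OF that(1)]])
    finally show False
      using short[of "?u @ [j]" k "?u @ [k]"] v' that by simp
  qed
  moreover have False if "m j k = 3" "n = Suc (Suc n')" for n'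
  proof -
    let ?u = "rev (alternating j k n')"
    have "v @ [j] = ?u @ [k, j, k] @ [j]"
      using v' that by simp
    also have "\<dots> \<asymp> ?u @ [j, k, j] @ [j]"
      using word_eq_context[OF word_eq_braid[of k j]] that(1) m_sym by metis
    finally show False
      using short[of "?u @ [k, j]" k "?u @ [j, k]"] v' that by simp
  qed
  ultimately have "m j k = 2 \<longrightarrow> n = 0" "m j k = 3 \<longrightarrow> n = 0 \<or> n = 1"
    by (metis not0_implies_Suc One_nat_def)+
  moreover have "v = [k]" if "n = 0"
    using v' that by simp
  moreover have "v = [j, k]" if "n = 1"
    using v' that by simp
  ultimately show ?thesis
    using m_cases[OF assms(2)] v' by metis
qed

text \<open>The induction step for everything that relates lengths to roots. A tail in the letters
  \<open>j\<close> and \<open>k\<close> is split off that is as long as possible; what remains is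
  the minimal representative \<open>w\<close> of its coset, and neither letter shortens it.\<close>

lemma dihedral_decomposition:
  assumes "len (xs @ [j]) \<ge> len xs" "\<not> xs \<asymp> []"
  obtains k w v where "k \<noteq> j" "xs \<asymp> w @ v" "len w < len xs"
    "len (w @ [j]) \<ge> len w" "len (w @ [k]) \<ge> len w"
    "(m j k = 2 \<and> v = [k]) \<or> (m j k = 3 \<and> (v = [k] \<or> v = [j, k])) \<or>
      (m j k = 0 \<and> (\<exists>n. v = rev (alternating k j (Suc n))))"
proof -
  obtain ys where ys: "xs \<asymp> ys" "length ys = len xs"
    by (rule obtain_reduced)
  with assms(2) have "ys \<noteq> []" by blast
  then obtain ys' k where ys': "ys = ys' @ [k]"
    by (cases ys rule: rev_cases) auto
  have "k \<noteq> j"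
  proof
    assume "k = j"
    have "xs @ [j] \<asymp> ys' @ [j, j] @ []"
      using ys(1) ys' \<open>k = j\<close> word_eq_append[of xs ys "[j]" "[j]"] by simp
    also have "\<dots> \<asymp> ys' @ [] @ []"
      by (rule word_eq_context[OF word_eq_square])
    finally have "len (xs @ [j]) \<le> length ys'"
      using len_le[of "xs @ [j]" ys'] by simp
    then show False using assms(1) ys(2) ys' by simp
  qed
  define P where "P n \<longleftrightarrow> (\<exists>w v. xs \<asymp> w @ v \<and> set v \<subseteq> {j, k} \<and> len xs = len w + length v \<and> len w = n)" for n
  have "len xs \<le> len ys' + 1"
    using len_append_le[of ys' "[k]"] len_cong[OF ys(1)] ys' by simp
  moreover have "len ys' \<le> length ys'"
    by (rule len_le) simp
  ultimately have ly: "len ys' + 1 = len xs"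
    using ys ys' by simp
  \<comment> \<open>Splitting off just the last letter already satisfies \<open>P\<close>, so the
    minimum lies strictly below \<open>len xs\<close>.\<close>
  then have "P (len ys')"
    unfolding P_def using ys ys' ly by (intro exI[of _ ys'] exI[of _ "[k]"]) simp
  define n where "n = (LEAST n. P n)"
  have "P n" and le: "n \<le> len ys'"
    unfolding n_def using \<open>P (len ys')\<close> by (auto intro: LeastI Least_le)
  then obtain w v where wv: "xs \<asymp> w @ v" "set v \<subseteq> {j, k}" "len xs = len w + length v" "len w = n"
    unfolding P_def by blast
  \<comment> \<open>Otherwise the letter \<open>l\<close> could be moved from the end of
    \<open>w\<close> to the front of \<open>v\<close> with lengths still adding up.\<close>
  have min: "len (w @ [l]) \<ge> len w" if l: "l \<in> {j, k}" for l
  proof (rule ccontr)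
    assume *: "\<not> ?thesis"
    have "w @ [] @ v \<asymp> w @ [l, l] @ v"
      by (rule word_eq_context[OF word_eq_sym[OF word_eq_square]])
    then have eq: "xs \<asymp> (w @ [l]) @ (l # v)"
      using word_eq_trans[OF wv(1)] by simp
    then have "len xs \<le> len (w @ [l]) + length (l # v)"
      using len_append_le[of "w @ [l]" "l # v"] len_cong[OF eq] by simp
    then have "len xs = len (w @ [l]) + length (l # v)"
      using * wv(3) by simp
    with eq wv(2) l have "P (len (w @ [l]))"
      unfolding P_def by (intro exI[of _ "w @ [l]"] exI[of _ "l # v"]) simp
    then have "n \<le> len (w @ [l])"
      unfolding n_def by (rule Least_le)
    with * wv(4) show False by simp
  qed
  have lw: "len w < len xs" using le ly wv(4) by simp
  have "(m j k = 2 \<and> v = [k]) \<or> (m j k = 3 \<and> (v = [k] \<or> v = [j, k])) \<or>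
      (m j k = 0 \<and> (\<exists>n. v = rev (alternating k j (Suc n))))"
  proof (rule dihedral_tail)
    fix v' assume "v \<asymp> v'"
    then have "xs \<asymp> w @ v'"
      by (rule word_eq_trans[OF wv(1) word_eq_append[OF word_eq_refl]])
    then have "len xs \<le> len w + length v'"
      using len_append_le[of w v'] len_cong[of xs "w @ v'"] by simp
    then show "length v \<le> length v'" using wv(3) by simp
  next
    fix v' assume "v @ [j] \<asymp> v'"
    then have "xs @ [j] \<asymp> w @ v'"
      using word_eq_trans[OF word_eq_append[OF wv(1) word_eq_refl, of "[j]"], of "w @ v'"]
        word_eq_append[OF word_eq_refl, of "v @ [j]" v' w] by simp
    then have "len (xs @ [j]) \<le> len w + length v'"
      using len_append_le[of w v'] len_cong[of "xs @ [j]" "w @ v'"] by simp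
    then show "length v \<le> length v'" using wv(3) assms(1) by simp
  next
    show "v \<noteq> []" using wv(3) lw by fastforce
  qed (fact wv(2), simp add: \<open>k \<noteq> j\<close> not_sym[OF \<open>k \<noteq> j\<close>])
  then show thesis
    using that[OF \<open>k \<noteq> j\<close> wv(1) lw min min] by simp
qed

end

text \<open>Integrality enters here: two positive integers cannot add up to 1. This is what makes
  simple roots indecomposable.\<close>

lemma zero_if_pos_combination_eq_1:
  fixes a b r s :: int
  assumes "a * r + b * s = 1" "a \<ge> 1" "b \<ge> 1" "r \<ge> 0" "s \<ge> 0"
  shows "r = 0 \<or> s = 0"
proof (rule ccontr)
  assume "\<not> ?thesis"
  with assms have "1 * 1 \<le> a * r" "1 * 1 \<le> b * s"
    using mult_mono[of 1 a 1 r] mult_mono[of 1 b 1 s] by auto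
  with assms(1) show False by simp
qed

context simply_laced_coxeter
begin

subsection \<open>Roots\<close>

text \<open>The dual of the geometric representation: \<open>f\<close> lists the values of a functional at the simple
  roots, so that \<open>act (rev xs) f j\<close> is the value of \<open>f\<close> at the root \<open>xs(\<alpha>\<^sub>j)\<close>. No finiteness
  of the index set is needed.\<close>

definition cartan :: "'i \<Rightarrow> 'i \<Rightarrow> int" where
  "cartan i j = (if i = j then 2 else if m i j = 2 then 0 else if m i j = 3 then -1 else -2)"

definition refl :: "'i \<Rightarrow> ('i \<Rightarrow> int) \<Rightarrow> 'i \<Rightarrow> int" where
  "refl i f = (\<lambda>j. f j - cartan i j * f i)"

definition act :: "'i list \<Rightarrow> ('i \<Rightarrow> int) \<Rightarrow> 'i \<Rightarrow> int" where
  "act xs = foldr refl xs"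

lemma act_Nil [simp]: "act [] f = f"
  and act_Cons [simp]: "act (x # xs) f = refl x (act xs f)"
  and act_append: "act (xs @ ys) f = act xs (act ys f)"
  by (simp_all add: act_def)

lemma cartan_sym: "cartan i j = cartan j i"
  by (simp add: cartan_def m_sym)

lemma cartan_diag [simp]: "cartan i i = 2"
  by (simp add: cartan_def)

lemma refl_square: "refl i (refl i f) = f"
  by (rule ext) (simp add: refl_def)

lemma refl_power: "(refl i \<circ> refl j) ^^ m i j = id"
proof (cases "i = j")
  case True
  then show ?thesis by (auto simp: m_diag fun_eq_iff refl_square)
next
  case False
  have "m i j = 2 \<Longrightarrow> refl i (refl j (refl i (refl j f))) = f" for f
    using False by (rule_tac ext) (simp add: refl_def cartan_sym[of j i] cartan_def m_sym[of j i])
  moreover have "refl i (refl j (refl i (refl j (refl i (refl j f))))) = f" if "m i j = 3" for f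
  proof
    fix k
    have "cartan i j = -1" "cartan j i = -1"
      using False that m_sym[of j i] by (simp_all add: cartan_def)
    then show "refl i (refl j (refl i (refl j (refl i (refl j f))))) k = f k"
      by (simp add: refl_def algebra_simps)
  qed
  ultimately show ?thesis
    using m_cases[OF False] by (auto simp: fun_eq_iff numeral_2_eq_2 numeral_3_eq_3)
qed

lemma act_replicate: "act (concat (replicate n [i, j])) f = ((refl i \<circ> refl j) ^^ n) f"
  by (induction n) (auto simp: act_append)

lemma act_cong: "xs \<asymp> ys \<Longrightarrow> act xs = act ys"
  by (rule coxeter_rel_invariant) (auto simp: fun_eq_iff act_append act_replicate refl_power)

lemma act_rev: "act xs (act (rev xs) f) = f" "act (rev xs) (act xs f) = f"
  using act_cong[OF word_eq_rev, of xs] act_cong[OF word_eq_rev', of xs]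
  by (simp_all add: fun_eq_iff act_append)

lemma refl_diff: "refl i (\<lambda>k. f k - g k) = (\<lambda>k. refl i f k - refl i g k)"
  and refl_scale: "refl i (\<lambda>k. c * f k) = (\<lambda>k. c * refl i f k)"
  by (simp_all add: refl_def fun_eq_iff algebra_simps)

lemma act_diff: "act xs (\<lambda>k. f k - g k) = (\<lambda>k. act xs f k - act xs g k)"
  by (induction xs) (simp_all add: refl_diff)

lemma act_scale: "act xs (\<lambda>k. c * f k) = (\<lambda>k. c * act xs f k)"
  by (induction xs) (simp_all add: refl_scale)

text \<open>Positivity of the root xs(alpha_j), tested on the dual cone: coordinates of roots never
  have to be handled.\<close>

definition pos :: "'i list \<Rightarrow> 'i \<Rightarrow> bool" where
  "pos xs j \<longleftrightarrow> (\<forall>f. (\<forall>k. f k \<ge> 0) \<longrightarrow> act (rev xs) f j \<ge> 0)"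

definition neg :: "'i list \<Rightarrow> 'i \<Rightarrow> bool" where
  "neg xs j \<longleftrightarrow> (\<forall>f. (\<forall>k. f k \<ge> 0) \<longrightarrow> act (rev xs) f j \<le> 0)"

text \<open>Both reflections fix the isotropic vector alpha_j + alpha_k, whose value is
  \<open>g j + g k\<close>; the roots of the infinite dihedral group differ by multiples of it, up
  to sign and choice of the simple root.\<close>

lemma act_alternating_infinite:
  assumes "m j k = 0" "j \<noteq> k"
  shows "act (alternating k j n) g j = int n * (g j + g k) + (if even n then g j else g k)"
proof -
  have c: "cartan j k = -2" "cartan k j = -2"
    using assms m_sym[of k j] by (simp_all add: cartan_def)
  \<comment> \<open>A longer word starts with the other letter, so both families are needed at once,
    together with the invariance of the sum.\<close>
  have "act (alternating k j n) g j = int n * (g j + g k) + (if even n then g j else g k) \<and>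
    act (alternating j k n) g k = int n * (g j + g k) + (if even n then g k else g j) \<and>
    act (alternating k j n) g j + act (alternating k j n) g k = g j + g k \<and>
    act (alternating j k n) g j + act (alternating j k n) g k = g j + g k"
    by (induction n) (auto simp: refl_def c algebra_simps)
  then show ?thesis by simp
qed

lemma act_rev_cong: "xs \<asymp> w @ v \<Longrightarrow> act (rev xs) f = act (rev v) (act (rev w) f)"
  using act_cong[OF word_eq_revI, of xs "w @ v"] by (simp add: act_append)

text \<open>For each tail \<open>v\<close> that the decomposition allows, v(alpha_j) is a
  nonnegative combination of alpha_j and alpha_k, and \<open>w\<close> sends both of these to
  positive roots by induction.\<close>

lemma pos_if_len_le: "len xs \<le> len (xs @ [j]) \<Longrightarrow> pos xs j"
proof (induction "len xs" arbitrary: xs j rule: less_induct)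
  case less
  show ?case
  proof (cases "xs \<asymp> []")
    case True
    then show ?thesis
      using act_rev_cong[of xs "[]" "[]"] by (simp add: pos_def)
  next
    case False
    obtain k w v where *: "k \<noteq> j" "xs \<asymp> w @ v" "len w < len xs"
      "len w \<le> len (w @ [j])" "len w \<le> len (w @ [k])"
      "(m j k = 2 \<and> v = [k]) \<or> (m j k = 3 \<and> (v = [k] \<or> v = [j, k])) \<or>
        (m j k = 0 \<and> (\<exists>n. v = rev (alternating k j (Suc n))))"
      by (rule dihedral_decomposition[OF less.prems False])
    have "pos w j" "pos w k"
      using less.hyps[OF *(3)] *(4,5) by auto
    then have nonneg: "act (rev w) f j \<ge> 0" "act (rev w) f k \<ge> 0" if "\<forall>k. f k \<ge> 0" for f
      using that by (auto simp: pos_def)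
    have "act (rev v) g j \<ge> 0" if "g j \<ge> 0" "g k \<ge> 0" for g
      using *(6)
    proof (elim disjE conjE exE)
      fix n assume "m j k = 0" "v = rev (alternating k j (Suc n))"
      then show ?thesis
        using act_alternating_infinite[of j k "Suc n" g] *(1) that by auto
    qed (use *(1) that m_sym[of j k] in \<open>auto simp: refl_def cartan_def\<close>)
    then show ?thesis
      using nonneg by (simp add: pos_def act_rev_cong[OF *(2)])
  qed
qed

text \<open>Appending \<open>j\<close> twice returns to \<open>xs\<close>, so
  \<open>pos_if_len_le\<close> applies to \<open>xs @ [j]\<close>; and s_j negates alpha_j.\<close>

lemma neg_if_len_less: "\<not> len xs \<le> len (xs @ [j]) \<Longrightarrow> neg xs j"
proof -
  assume *: "\<not> len xs \<le> len (xs @ [j])"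
  have "xs @ [j, j] \<asymp> xs"
    using word_eq_context[OF word_eq_square[of j], of xs "[]"] by simp
  then have "len ((xs @ [j]) @ [j]) = len xs"
    using len_cong by simp
  with * have "pos (xs @ [j]) j"
    by (intro pos_if_len_le) simp
  then show ?thesis
    by (simp add: pos_def neg_def refl_def)
qed

lemma pos_or_neg: "pos xs j \<or> neg xs j"
  using pos_if_len_le neg_if_len_less by blast

text \<open>Away from \<open>i\<close>, a functional is the difference of its positive and negative
  parts, and both satisfy the assumption. Thus a root that involves no simple root besides alpha_i
  is a multiple of alpha_i.\<close>

lemma root_vanishing:
  assumes "\<And>f. (\<forall>k. f k \<ge> 0) \<Longrightarrow> f i = 0 \<Longrightarrow> act xs f j = 0"
  shows "act xs f j = f i * act xs (\<lambda>k. if k = i then 1 else 0) j"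
proof -
  let ?e = "\<lambda>k. if k = i then 1 else 0 :: int"
  define g where "g = (\<lambda>k. f k - f i * ?e k)"
  have "act xs (\<lambda>k. max (g k) 0) j = 0" "act xs (\<lambda>k. max (- g k) 0) j = 0"
    by (rule assms; simp add: g_def)+
  moreover have "g = (\<lambda>k. max (g k) 0 - max (- g k) 0)"
    by auto
  ultimately have "act xs g j = 0"
    by (metis act_diff diff_0_right)
  then show ?thesis
    by (simp add: g_def act_diff act_scale)
qed

text \<open>Roots are primitive: some functional takes the value 1, so a root is neither zero nor a
  proper integer multiple.\<close>

lemma root_surj: "act (rev xs) (act xs (\<lambda>_. 1)) j = 1"
  by (simp add: act_rev)

text \<open>Nonnegative terms cannot cancel, so both roots vanish wherever alpha_i does and are
  multiples of alpha_i. Comparing coefficients writes 1 as \<open>a * r + b * s\<close>; one of the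
  roots is then zero, against \<open>root_surj\<close>.\<close>

lemma simple_root_indecomposable:
  assumes "pos w j" "pos w k" "a \<ge> 1" "b \<ge> 1"
    and eq: "\<And>f. a * act (rev w) f j + b * act (rev w) f k = f i"
  shows False
proof -
  let ?e = "\<lambda>k. if k = i then 1 else 0 :: int"
  have nonneg: "act (rev w) f j \<ge> 0" "act (rev w) f k \<ge> 0" if "\<forall>k. f k \<ge> 0" for f
    using assms(1,2) that by (auto simp: pos_def)
  have "act (rev w) f j = 0 \<and> act (rev w) f k = 0" if "\<forall>k. f k \<ge> 0" "f i = 0" for f
  proof -
    have "a * act (rev w) f j \<ge> 0" "b * act (rev w) f k \<ge> 0"
      using nonneg[OF that(1)] assms(3,4) by auto
    with eq[of f] that(2) have "a * act (rev w) f j = 0" "b * act (rev w) f k = 0"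
      by linarith+
    then show ?thesis using assms(3,4) by simp
  qed
  then have vals: "act (rev w) f j = f i * act (rev w) ?e j" "act (rev w) f k = f i * act (rev w) ?e k" for f
    by (auto intro!: root_vanishing)
  have "act (rev w) ?e j = 0 \<or> act (rev w) ?e k = 0"
    using eq[of ?e] assms(3,4) nonneg[of ?e]
    by (intro zero_if_pos_combination_eq_1[of a _ b]) auto
  then show False
    using vals(1)[of "act w (\<lambda>_. 1)"] vals(2)[of "act w (\<lambda>_. 1)"] root_surj[of w] by auto
qed

text \<open>An element mapping a simple root to a simple root is a product of the shortest such elements
  of rank two parabolic subgroups, so it suffices to check a property on these.\<close>

lemma simple_root_transport:
  assumes "\<And>f. act (rev xs) f j = f i"
    and cong: "\<And>xs ys i j. xs \<asymp> ys \<Longrightarrow> P xs i j \<Longrightarrow> P ys i j"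
    and Nil: "\<And>i. P [] i i"
    and two: "\<And>xs i j k. P xs i j \<Longrightarrow> j \<noteq> k \<Longrightarrow> m j k = 2 \<Longrightarrow> P (xs @ [k]) i j"
    and three: "\<And>xs i j k. P xs i k \<Longrightarrow> j \<noteq> k \<Longrightarrow> m j k = 3 \<Longrightarrow> P (xs @ [j, k]) i j"
  shows "P xs i j"
  using assms(1)
proof (induction "len xs" arbitrary: xs j rule: less_induct)
  case less
  show ?case
  proof (cases "xs \<asymp> []")
    case True
    then have "f j = f i" for f :: "'i \<Rightarrow> int"
      using act_rev_cong[of xs "[]" "[]"] less.prems by simp
    from this[of "\<lambda>k. if k = j then 1 else 0"] have "j = i"
      by (simp split: if_splits)
    then show ?thesis
      using cong[OF word_eq_sym[OF True] Nil] by simp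
  next
    case False
    have "\<not> neg xs j"
    proof
      assume "neg xs j"
      then have "act (rev xs) (\<lambda>_. 1) j \<le> 0"
        by (auto simp: neg_def)
      then show False using less.prems by simp
    qed
    then have "len xs \<le> len (xs @ [j])"
      using neg_if_len_less by blast
    then obtain k w v where *: "k \<noteq> j" "xs \<asymp> w @ v" "len w < len xs"
      "len w \<le> len (w @ [j])" "len w \<le> len (w @ [k])"
      "(m j k = 2 \<and> v = [k]) \<or> (m j k = 3 \<and> (v = [k] \<or> v = [j, k])) \<or>
        (m j k = 0 \<and> (\<exists>n. v = rev (alternating k j (Suc n))))"
      by (rule dihedral_decomposition[OF _ False])
    have ps: "pos w j" "pos w k"
      using *(4,5) by (auto intro: pos_if_len_le)
    have val: "act (rev v) (act (rev w) f) j = f i" for f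
      using less.prems act_rev_cong[OF *(2)] by simp
    have "P (w @ v) i j"
      using *(6)
    proof (elim disjE conjE exE)
      assume mv: "m j k = 2" "v = [k]"
      then have "act (rev w) f j = f i" for f
        using val[of f] *(1) m_sym[of j k] by (simp add: refl_def cartan_def)
      then have "P w i j"
        by (rule less.hyps[OF *(3)])
      then show ?thesis
        using two *(1) mv by auto
    next
      \<comment> \<open>Here v(alpha_j) = alpha_j + alpha_k, so alpha_i would be a sum of two
        positive roots.\<close>
      assume mv: "m j k = 3" "v = [k]"
      then have "1 * act (rev w) f j + 1 * act (rev w) f k = f i" for f
        using val[of f] *(1) m_sym[of j k] by (simp add: refl_def cartan_def)
      then show ?thesis
        using simple_root_indecomposable[OF ps, of 1 1 i] by simp
    next
      \<comment> \<open>Here v(alpha_j) = alpha_k, so the shorter \<open>w\<close> carries alpha_k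
        to alpha_i.\<close>
      assume mv: "m j k = 3" "v = [j, k]"
      then have "act (rev w) f k = f i" for f
        using val[of f] *(1) m_sym[of j k] by (simp add: refl_def cartan_def)
      then have "P w i k"
        by (rule less.hyps[OF *(3)])
      then show ?thesis
        using three *(1) mv by auto
    next
      fix n assume mv: "m j k = 0" "v = rev (alternating k j (Suc n))"
      \<comment> \<open>The coefficients of alpha_j and alpha_k in v(alpha_j). Both are positive, so
        this case is impossible too.\<close>
      let ?a = "int (Suc n) + (if even (Suc n) then 1 else 0)"
      let ?b = "int (Suc n) + (if even (Suc n) then 0 else 1)"
      have "?a * act (rev w) f j + ?b * act (rev w) f k = f i" for f
        using val[of f] act_alternating_infinite[OF mv(1), of "Suc n" "act (rev w) f"] *(1) mv(2)
        by (auto simp: algebra_simps)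
      then show ?thesis
        using simple_root_indecomposable[OF ps, of ?a ?b i] by simp
    qed
    then show ?thesis
      by (rule cong[OF word_eq_sym[OF *(2)]])
  qed
qed

text \<open>Allows a simple reflection to be recognised by its root; on the rank two pieces the
  claim is a commutation or a braid relation.\<close>

lemma simple_root_conj:
  assumes "\<And>f. act (rev xs) f j = f i"
  shows "i # xs \<asymp> xs @ [j]"
  using assms
proof (rule simple_root_transport[where P = "\<lambda>xs i j. i # xs \<asymp> xs @ [j]"])
  fix xs ys :: "'i list" and i j
  assume *: "xs \<asymp> ys" and "i # xs \<asymp> xs @ [j]"
  have "i # ys \<asymp> i # xs"
    using word_eq_context[OF word_eq_sym[OF *], of "[i]" "[]"] by simp
  also note \<open>i # xs \<asymp> xs @ [j]\<close>
  also have "xs @ [j] \<asymp> ys @ [j]"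
    using word_eq_context[OF *, of "[]" "[j]"] by simp
  finally show "i # ys \<asymp> ys @ [j]" .
next
  fix xs :: "'i list" and i j k
  assume *: "i # xs \<asymp> xs @ [j]" and m: "m j k = 2"
  have "i # xs @ [k] \<asymp> xs @ [j, k]"
    using word_eq_context[OF *, of "[]" "[k]"] by simp
  also have "\<dots> \<asymp> xs @ [k, j]"
    using word_eq_context[OF word_eq_comm[OF m], of xs "[]"] by simp
  finally show "i # xs @ [k] \<asymp> (xs @ [k]) @ [j]" by simp
next
  fix xs :: "'i list" and i j k
  assume *: "i # xs \<asymp> xs @ [k]" and m: "m j k = 3"
  have "i # xs @ [j, k] \<asymp> xs @ [k, j, k]"
    using word_eq_context[OF *, of "[]" "[j, k]"] by simp
  also have "\<dots> \<asymp> xs @ [j, k, j]"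
    using word_eq_context[OF word_eq_sym[OF word_eq_braid[OF m]], of xs "[]"] by simp
  finally show "i # xs @ [j, k] \<asymp> (xs @ [j, k]) @ [j]" by simp
qed simp_all

text \<open>A reflection subtracts the value at its root times the coroot, here
  \<open>act xs (cartan i)\<close>. The difference from the identity has rank one and so determines
  the root up to a scalar.\<close>

lemma act_reflection:
  "act (xs @ i # rev xs) f = (\<lambda>k. f k - act (rev xs) f i * act xs (cartan i) k)"
proof -
  have "refl i (act (rev xs) f) = (\<lambda>k. act (rev xs) f k - act (rev xs) f i * cartan i k)"
    by (simp add: refl_def fun_eq_iff)
  then have "act (xs @ i # rev xs) f = act xs (\<lambda>k. act (rev xs) f k - act (rev xs) f i * cartan i k)"
    by (simp add: act_append)
  then show ?thesis
    by (simp add: act_diff act_scale act_rev)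
qed

text \<open>Equal rank one operators have proportional factors. The proportionality constant is an
  integer with an integer inverse, hence a sign, and positivity of both roots decides which
  one.\<close>

lemma root_eq_if_reflection_eq:
  assumes eq: "xs @ i # rev xs \<asymp> ys @ j # rev ys" and "pos xs i" "pos ys j"
  shows "act (rev xs) f i = act (rev ys) f j"
proof -
  define \<rho> where "\<rho> = (\<lambda>f. act (rev xs) f i)"
  define \<sigma> where "\<sigma> = (\<lambda>f. act (rev ys) f j)"
  define h where "h = act xs (cartan i)"
  define h' where "h' = act ys (cartan j)"
  have proportional: "\<rho> f * h k = \<sigma> f * h' k" for f k
    using act_cong[OF eq] by (simp add: fun_eq_iff act_reflection \<rho>_def \<sigma>_def h_def h'_def)
  have \<rho>h: "\<rho> h = 2" and \<sigma>h': "\<sigma> h' = 2"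
    by (simp_all add: \<rho>_def \<sigma>_def h_def h'_def act_rev)
  have \<sigma>_scale: "\<sigma> (\<lambda>k. c * f k) = c * \<sigma> f" and \<rho>_scale: "\<rho> (\<lambda>k. c * f k) = c * \<rho> f" for c f
    by (simp_all add: \<rho>_def \<sigma>_def act_scale)
  \<comment> \<open>Primitivity supplies arguments at which the roots take the value 1; inserting
    them makes each coroot an integer multiple of the other.\<close>
  obtain f0 f1 where "\<rho> f0 = 1" "\<sigma> f1 = 1"
    using root_surj unfolding \<rho>_def \<sigma>_def by metis
  then have h: "h = (\<lambda>k. \<sigma> f0 * h' k)" and h': "h' = (\<lambda>k. \<rho> f1 * h k)"
    using proportional[of f0] proportional[of f1] by (simp_all add: fun_eq_iff)
  have "\<rho> h = \<sigma> f0 * \<rho> h'"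
    by (subst h) (rule \<rho>_scale)
  also have "\<rho> h' = \<rho> f1 * \<rho> h"
    by (subst h') (rule \<rho>_scale)
  finally have "\<rho> h = \<sigma> f0 * (\<rho> f1 * \<rho> h)" .
  then have "\<sigma> f0 * \<rho> f1 = 1"
    using \<rho>h by simp
  then have c: "\<sigma> f0 = 1 \<or> \<sigma> f0 = -1"
    using zmult_eq_1_iff by auto
  have "\<rho> f * \<sigma> h = \<sigma> f * \<sigma> h'" for f
    using \<sigma>_scale[of "\<rho> f" h] \<sigma>_scale[of "\<sigma> f" h'] by (simp add: proportional)
  moreover have "\<sigma> h = \<sigma> f0 * \<sigma> h'"
    by (subst h) (rule \<sigma>_scale)
  ultimately have scaled: "\<rho> f * \<sigma> f0 = \<sigma> f" for f
    using \<sigma>h' by simp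
  \<comment> \<open>With the sign -1, a root would be both nonnegative and nonpositive on the cone,
    hence zero.\<close>
  have "\<sigma> f0 \<noteq> -1"
  proof
    assume s: "\<sigma> f0 = -1"
    have "act (rev xs) f i = 0" if "\<forall>k. f k \<ge> 0" for f
    proof -
      have "\<rho> f \<ge> 0" "\<sigma> f \<ge> 0"
        using assms(2,3) that unfolding pos_def \<rho>_def \<sigma>_def by blast+
      then have "\<rho> f = 0"
        using scaled[of f] s by simp
      then show ?thesis by (simp add: \<rho>_def)
    qed
    then have "act (rev xs) f i = f i * 0" for f
      using root_vanishing[of i "rev xs" i f] by simp
    then show False
      using \<open>\<rho> f0 = 1\<close> by (simp add: \<rho>_def)
  qed
  with c scaled show ?thesis
    by (simp add: \<rho>_def \<sigma>_def)
qed

text \<open>A positive root that s_i makes negative can involve only alpha_i. Being primitive, it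
  equals alpha_i, and \<open>simple_root_conj\<close> identifies its reflection with s_i.\<close>

lemma pos_Cons:
  assumes "pos xs j" "\<not> xs @ j # rev xs \<asymp> [i]"
  shows "pos (i # xs) j"
proof (rule ccontr)
  assume "\<not> pos (i # xs) j"
  then have "neg (i # xs) j"
    using pos_or_neg by blast
  have "act (rev xs) f j = 0" if "\<forall>k. f k \<ge> 0" "f i = 0" for f
  proof -
    \<comment> \<open>Functionals vanishing at alpha_i are fixed by s_i, so the root and its
      negative image have the same value there, which must be 0.\<close>
    have "refl i f = f"
      using that(2) by (simp add: refl_def)
    then have "act (rev xs) f j \<le> 0"
      using \<open>neg (i # xs) j\<close> that(1) unfolding neg_def
      by (metis act_append act_Cons act_Nil rev.simps(2))
    moreover have "act (rev xs) f j \<ge> 0"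
      using assms(1) that(1) unfolding pos_def by blast
    ultimately show ?thesis by simp
  qed
  then have *: "act (rev xs) f j = f i * act (rev xs) (\<lambda>k. if k = i then 1 else 0) j" for f
    by (rule root_vanishing)
  then have "act xs (\<lambda>_. 1) i * act (rev xs) (\<lambda>k. if k = i then 1 else 0) j = 1"
    using root_surj by metis
  moreover have "act (rev xs) (\<lambda>k. if k = i then 1 else 0) j \<ge> 0"
    using assms(1) by (simp add: pos_def)
  ultimately have "act (rev xs) (\<lambda>k. if k = i then 1 else 0) j = 1"
    using zmult_eq_1_iff by auto
  with * have "i # xs \<asymp> xs @ [j]"
    by (intro simple_root_conj) simp
  then have "i # xs @ rev xs \<asymp> xs @ j # rev xs"
    using word_eq_context[of "i # xs" "xs @ [j]" "[]" "rev xs"] by simp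
  moreover have "i # xs @ rev xs \<asymp> [i]"
    using word_eq_context[OF word_eq_rev[of xs], of "[i]" "[]"] by simp
  ultimately show False
    using assms(2) by (blast intro: word_eq_sym word_eq_trans)
qed

text \<open>Appending \<open>i\<close> to \<open>xs\<close> negates the root and keeps the
  reflection.\<close>

lemma obtain_pos_root:
  assumes "t \<in> reflections m"
  obtains xs i where "t = cls (xs @ i # rev xs)" "pos xs i"
proof -
  obtain xs i where t: "t = cls (xs @ i # rev xs)"
    using assms by (auto simp: reflections_eq)
  show thesis
  proof (cases "len xs \<le> len (xs @ [i])")
    case True
    then show thesis using that[OF t] pos_if_len_le by blast
  next
    case False
    have e: "xs @ [i, i] \<asymp> xs"
      using word_eq_context[OF word_eq_square[of i], of xs "[]"] by simp
    then have "len ((xs @ [i]) @ [i]) = len xs"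
      using len_cong by simp
    with False have "pos (xs @ [i]) i"
      by (intro pos_if_len_le) simp
    moreover have "(xs @ [i]) @ i # rev (xs @ [i]) \<asymp> xs @ i # rev xs"
      using word_eq_context[OF e, of "[]" "i # rev xs"] by simp
    then have "t = cls ((xs @ [i]) @ i # rev (xs @ [i]))"
      unfolding t cls_eq_iff by (rule word_eq_sym)
    ultimately show thesis using that by blast
  qed
qed

lemma simple_refl_inj: "[i] \<asymp> [j] \<Longrightarrow> i = j"
proof (rule ccontr)
  assume "[i] \<asymp> [j]" "i \<noteq> j"
  then have "refl i f k = refl j f k" for f k
    using act_cong[of "[i]" "[j]"] by (simp add: fun_eq_iff)
  from this[of "\<lambda>k. if k = i then 1 else 0" i] show False
    using \<open>i \<noteq> j\<close> by (simp add: refl_def)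
qed

end

lemma iota_relator:
  assumes "\<And>r. r \<in> R \<Longrightarrow> eps r = 0" "r \<in> Idl\<^bsub>Free\<^esub> R"
  shows "iota R r = 0"
proof -
  have "pres_class R r = pres_class R 0"
    using assms(2) by (simp add: pres_class_eq_iff)
  then show ?thesis
    using iota_eq_iff[of R r 0] assms(1) by (simp add: iota_0)
qed

lemma word_s_replicate: "word_s (concat (replicate n [i, j])) = (gen_s i * gen_s j) ^ n"
  by (induction n) (simp_all add: word_s_append mult.assoc)

lemma eps_hat_relators: "r \<in> hat_relators m \<Longrightarrow> eps r = 0"
  by (auto simp: hat_relators_def)

context simply_laced_coxeter
begin

subsection \<open>The elements \<open>D\<^sub>s\<close>\<close>

abbreviation c where "c \<equiv> pres_class (hat_relators m)"
abbreviation h where "h \<equiv> iota (hat_relators m)"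

text \<open>The bridge between cosets, in which the definitions are phrased, and a type class ring,
  in which the simplifier can compute.\<close>

lemma h_eq_iff: "h p = h q \<longleftrightarrow> c p = c q"
  by (rule iota_eq_iff[OF eps_hat_relators])

lemma h_relator: "r \<in> hat_relators m \<Longrightarrow> h r = 0"
  by (rule iota_relator[OF eps_hat_relators Idl_incl])

lemma h_square: "h (gen_s i) * h (gen_s i) = 1"
proof -
  have "gen_s i ^ 2 - 1 \<in> hat_relators m"
    unfolding hat_relators_def by blast
  from h_relator[OF this] show ?thesis
    by (simp add: iota_simps power2_eq_square)
qed

lemma h_idem: "h (gen_D i) * h (gen_D i) = h (gen_D i)"
proof -
  have "gen_D i ^ 2 - gen_D i \<in> hat_relators m"
    unfolding hat_relators_def by blast
  from h_relator[OF this] show ?thesis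
    by (simp add: iota_simps power2_eq_square)
qed

lemma h_skew: "h (gen_s i) * h (gen_D i) = h (gen_s i) - 1 - h (gen_D i) * h (gen_s i)"
proof -
  have "gen_s i * gen_D i + gen_D i * gen_s i - (gen_s i - 1) \<in> hat_relators m"
    by (auto simp: hat_relators_def)
  from h_relator[OF this] show ?thesis
    by (simp add: iota_simps eq_diff_eq)
qed

lemma h_word_cong: "xs \<asymp> ys \<Longrightarrow> h (word_s xs) = h (word_s ys)"
proof (rule coxeter_rel_invariant[of "\<lambda>xs. h (word_s xs)"])
  fix us vs i j
  have "h ((gen_s i * gen_s j) ^ m i j - 1) = 0"
    by (rule h_relator) (auto simp: hat_relators_def)
  then have "h (word_s (concat (replicate (m i j) [i, j]))) = 1"
    by (simp add: word_s_replicate iota_diff iota_1)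
  then show "h (word_s (us @ concat (replicate (m i j) [i, j]) @ vs)) = h (word_s (us @ vs))"
    by (simp add: word_s_append iota_mult)
qed

lemma h_word_rev: "h (word_s xs) * h (word_s (rev xs)) = 1" "h (word_s (rev xs)) * h (word_s xs) = 1"
  using h_word_cong[OF word_eq_rev, of xs] h_word_cong[OF word_eq_rev', of xs]
  by (simp_all add: word_s_append iota_simps)

lemma h_D_conj:
  assumes "i \<noteq> j" "m i j \<noteq> 0"
  shows "h (gen_D i) * h (word_s (alternating j i (m i j - 1)))
    = h (word_s (alternating j i (m i j - 1))) * h (gen_D (if even (m i j) then i else j))"
proof -
  have "gen_D i * word_s (alternating j i (m i j - 1))
      - word_s (alternating j i (m i j - 1)) * gen_D (if even (m i j) then i else j) \<in> hat_relators m"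
    using assms by (auto simp: hat_relators_def)
  from h_relator[OF this] show ?thesis
    by (simp only: iota_diff iota_mult right_minus_eq)
qed

lemma h_D_conj_two: "m i j = 2 \<Longrightarrow> h (gen_D i) * h (gen_s j) = h (gen_s j) * h (gen_D i)"
  using h_D_conj[of i j] m_diag[of i] by (cases "i = j") (simp_all add: numeral_2_eq_2)

lemma h_D_conj_three: "m i j = 3 \<Longrightarrow>
    h (gen_D i) * (h (gen_s j) * h (gen_s i)) = h (gen_s j) * (h (gen_s i) * h (gen_D j))"
  using h_D_conj[of i j] m_diag[of i]
  by (cases "i = j") (simp_all add: numeral_3_eq_3 iota_simps mult.assoc)

text \<open>The relations between D_i and words in the s_j are exactly the two rank two cases of
  \<open>simple_root_transport\<close>.\<close>

lemma h_simple_root_transport: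
  assumes "\<And>f. act (rev xs) f j = f i"
  shows "h (gen_D i) * h (word_s xs) = h (word_s xs) * h (gen_D j)"
  using assms
proof (rule simple_root_transport[where P = "\<lambda>xs i j. h (gen_D i) * h (word_s xs) = h (word_s xs) * h (gen_D j)"])
  fix xs :: "'i list" and i j k
  assume *: "h (gen_D i) * h (word_s xs) = h (word_s xs) * h (gen_D j)" and "m j k = 2"
  have "h (gen_D i) * h (word_s (xs @ [k])) = (h (gen_D i) * h (word_s xs)) * h (gen_s k)"
    by (simp add: word_s_append iota_simps mult.assoc)
  also have "\<dots> = h (word_s xs) * (h (gen_D j) * h (gen_s k))"
    by (simp only: * mult.assoc)
  also have "\<dots> = h (word_s (xs @ [k])) * h (gen_D j)"
    by (simp add: h_D_conj_two[OF \<open>m j k = 2\<close>] word_s_append iota_simps mult.assoc)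
  finally show "h (gen_D i) * h (word_s (xs @ [k])) = h (word_s (xs @ [k])) * h (gen_D j)" .
next
  fix xs :: "'i list" and i j k
  assume *: "h (gen_D i) * h (word_s xs) = h (word_s xs) * h (gen_D k)" and "m j k = 3"
  then have "m k j = 3" using m_sym by simp
  have "h (gen_D i) * h (word_s (xs @ [j, k])) = (h (gen_D i) * h (word_s xs)) * (h (gen_s j) * h (gen_s k))"
    by (simp add: word_s_append iota_simps mult.assoc)
  also have "\<dots> = h (word_s xs) * (h (gen_D k) * (h (gen_s j) * h (gen_s k)))"
    by (simp only: * mult.assoc)
  also have "\<dots> = h (word_s (xs @ [j, k])) * h (gen_D j)"
    by (simp add: h_D_conj_three[OF \<open>m k j = 3\<close>] word_s_append iota_simps mult.assoc)
  finally show "h (gen_D i) * h (word_s (xs @ [j, k])) = h (word_s (xs @ [j, k])) * h (gen_D j)" .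
qed (simp_all add: h_word_cong iota_simps)

definition conjD :: "'i list \<Rightarrow> 'i \<Rightarrow> 'i gen free_alg" where
  "conjD xs i = word_s xs * gen_D i * word_s (rev xs)"

text \<open>Both words present the same positive root, so ys^-1 xs carries alpha_i to alpha_j and
  therefore intertwines D_i with D_j.\<close>

lemma h_conjD_eq:
  assumes "xs @ i # rev xs \<asymp> ys @ j # rev ys" "pos xs i" "pos ys j"
  shows "h (conjD xs i) = h (conjD ys j)"
proof -
  have "act (rev (rev ys @ xs)) f i = f j" for f
    using root_eq_if_reflection_eq[OF assms, of "act ys f"] by (simp add: act_append act_rev)
  then have "h (gen_D j) * h (word_s (rev ys @ xs)) = h (word_s (rev ys @ xs)) * h (gen_D i)"
    by (rule h_simple_root_transport)
  then have *: "h (gen_D j) * (h (word_s (rev ys)) * h (word_s xs)) =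
      (h (word_s (rev ys)) * h (word_s xs)) * h (gen_D i)"
    by (simp only: word_s_append iota_mult)
  have "h (conjD ys j) = h (word_s ys) * (h (gen_D j) * (h (word_s (rev ys)) * h (word_s xs))) * h (word_s (rev xs))"
    by (simp add: conjD_def iota_mult mult.assoc h_word_rev)
  also have "\<dots> = h (word_s ys) * h (word_s (rev ys)) * h (conjD xs i)"
    by (simp only: *) (simp add: conjD_def iota_mult mult.assoc)
  finally show ?thesis
    by (simp add: h_word_rev)
qed

text \<open>The choice is restricted to words that present \<open>t\<close> by its positive root; by
  \<open>h_conjD_eq\<close> all of these give the same class.\<close>

definition drep :: "'i list set \<Rightarrow> 'i gen free_alg" where
  "drep t = (case (SOME (xs, i). t = cls (xs @ i # rev xs) \<and> pos xs i) of (xs, i) \<Rightarrow> conjD xs i)"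

lemma h_drep:
  assumes "pos xs i"
  shows "h (drep (cls (xs @ i # rev xs))) = h (conjD xs i)"
proof -
  let ?P = "\<lambda>(ys, j). cls (xs @ i # rev xs) = cls (ys @ j # rev ys) \<and> pos ys j"
  obtain ys j where eq: "(SOME q. ?P q) = (ys, j)"
    by (cases "SOME q. ?P q")
  have "?P (SOME q. ?P q)"
    using assms by (intro someI[of ?P "(xs, i)"]) auto
  then have "cls (xs @ i # rev xs) = cls (ys @ j # rev ys)" "pos ys j"
    unfolding eq by simp_all
  then have "h (conjD xs i) = h (conjD ys j)"
    unfolding cls_eq_iff using h_conjD_eq assms by blast
  then show ?thesis
    by (simp add: drep_def eq)
qed

abbreviation refl_conj :: "'i \<Rightarrow> 'i list set \<Rightarrow> 'i list set" where
  "refl_conj i t \<equiv> simple_refl m i \<otimes>\<^bsub>W\<^esub> t \<otimes>\<^bsub>W\<^esub> simple_refl m i"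

lemma refl_conj_cls: "refl_conj i (cls xs) = cls (i # xs @ [i])"
  by (simp only: simple_refl_eq mult_cls) simp

lemma simple_refl_in_carrier [simp]: "simple_refl m i \<in> carrier W"
  by (simp only: simple_refl_eq cls_in_carrier)

lemma simple_refl_square: "simple_refl m i \<otimes>\<^bsub>W\<^esub> simple_refl m i = \<one>\<^bsub>W\<^esub>"
  by (simp only: simple_refl_eq mult_cls one_W cls_eq_iff) (simp add: word_eq_square)

lemma reflections_carrier: "t \<in> reflections m \<Longrightarrow> t \<in> carrier W"
  unfolding reflections_eq by blast

lemma simple_refl_reflection [simp]: "simple_refl m i \<in> reflections m"
  unfolding reflections_eq simple_refl_eq by (auto intro!: exI[of _ "[]"] exI[of _ i])

lemma refl_conj_reflection: "t \<in> reflections m \<Longrightarrow> refl_conj i t \<in> reflections m"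
proof -
  assume "t \<in> reflections m"
  then obtain xs j where "t = cls (xs @ j # rev xs)"
    unfolding reflections_eq by blast
  then have "refl_conj i t = cls ((i # xs) @ j # rev (i # xs))"
    by (simp only: refl_conj_cls) simp
  then show ?thesis
    unfolding reflections_eq by blast
qed

lemma refl_conj_refl_conj [simp]: "t \<in> carrier W \<Longrightarrow> refl_conj i (refl_conj i t) = t"
proof -
  interpret group W by (rule group_W)
  assume "t \<in> carrier W"
  then show ?thesis
    by (metis (no_types, lifting) m_assoc m_closed simple_refl_in_carrier simple_refl_square l_one r_one)
qed

lemma refl_conj_self [simp]: "refl_conj i (simple_refl m i) = simple_refl m i"
proof -
  interpret group W by (rule group_W)
  show ?thesis
    by (simp add: simple_refl_square)
qed

text \<open>Conjugation by s_i fixes s_i, so the step may assume that \<open>t\<close> differs from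
  it. This is the recursion by which \<open>Drefl\<close> is characterised.\<close>

lemma reflection_induct [consumes 1, case_names simple conj]:
  assumes "t \<in> reflections m"
    and simple: "\<And>i. P (simple_refl m i)"
    and conj: "\<And>i t. t \<in> reflections m \<Longrightarrow> t \<noteq> simple_refl m i \<Longrightarrow> P t \<Longrightarrow> P (refl_conj i t)"
  shows "P t"
proof -
  obtain xs j where t: "t = cls (xs @ j # rev xs)"
    using assms(1) unfolding reflections_eq by blast
  have "P (cls (xs @ j # rev xs))"
  proof (induction xs)
    case Nil
    then show ?case using simple[of j] by (simp add: simple_refl_eq)
  next
    case (Cons i xs)
    have "cls ((i # xs) @ j # rev (i # xs)) = refl_conj i (cls (xs @ j # rev xs))"
      by (simp only: refl_conj_cls) simp
    moreover have "cls (xs @ j # rev xs) \<in> reflections m"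
      unfolding reflections_eq by blast
    moreover have "P (refl_conj i (simple_refl m i))"
      using simple[of i] by (simp only: refl_conj_self)
    ultimately show ?case
      using conj[OF _ _ Cons, of i] by (cases "cls (xs @ j # rev xs) = simple_refl m i") simp_all
  qed
  then show ?thesis by (simp only: t)
qed

lemma pos_Nil: "pos [] i"
  by (simp add: pos_def)

lemma h_drep_simple: "h (drep (simple_refl m i)) = h (gen_D i)"
  using h_drep[OF pos_Nil, of i] by (simp add: simple_refl_eq conjD_def)

text \<open>The assumption on \<open>t\<close> is that of \<open>pos_Cons\<close>: the root stays
  positive when \<open>i\<close> is prefixed.\<close>

lemma h_drep_conj:
  assumes "t \<in> reflections m" "t \<noteq> simple_refl m i"
  shows "h (drep (refl_conj i t)) = h (gen_s i * drep t * gen_s i)"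
proof -
  obtain xs j where t: "t = cls (xs @ j # rev xs)" "pos xs j"
    by (rule obtain_pos_root[OF assms(1)])
  then have "\<not> xs @ j # rev xs \<asymp> [i]"
    using assms(2) by (simp only: simple_refl_eq cls_eq_iff) simp
  then have "pos (i # xs) j"
    by (rule pos_Cons[OF t(2)])
  moreover have "refl_conj i t = cls ((i # xs) @ j # rev (i # xs))"
    unfolding t(1) by (simp only: refl_conj_cls) simp
  ultimately have "h (drep (refl_conj i t)) = h (conjD (i # xs) j)"
    by (simp only: h_drep)
  also have "\<dots> = h (gen_s i) * h (conjD xs j) * h (gen_s i)"
    by (simp add: conjD_def word_s_append iota_simps mult.assoc)
  also have "\<dots> = h (gen_s i * drep t * gen_s i)"
    using h_drep[OF t(2)] by (simp only: t(1) iota_mult)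
  finally show ?thesis .
qed

lemma Hhat_eq: "Hhat m = pres (hat_relators m)"
  by (simp add: Hhat_def)

text \<open>The two lemmas above make \<open>drep\<close> a solution of the recursion in
  \<open>THE\<close>; by \<open>reflection_induct\<close> there is no other.\<close>

lemma Drefl_eq: "t \<in> reflections m \<Longrightarrow> Drefl m t = c (drep t)"
proof -
  let ?d = "\<lambda>t\<in>reflections m. c (drep t)"
  have "Drefl m = ?d"
    unfolding Drefl_def
  proof (rule the_equality, intro conjI allI ballI)
    show "?d \<in> reflections m \<rightarrow>\<^sub>E carrier (Hhat m)"
      by (auto simp: Hhat_eq)
    show d_simple: "?d (simple_refl m i) = hD m i" for i
      using h_drep_simple[of i] by (simp add: h_eq_iff hD_def)
    show d_conj: "?d (refl_conj i t) = hs m i \<otimes>\<^bsub>Hhat m\<^esub> ?d t \<otimes>\<^bsub>Hhat m\<^esub> hs m i"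
      if "t \<in> reflections m - {simple_refl m i}" for i t
      using h_drep_conj[of t i] that refl_conj_reflection[of t i]
      by (simp add: h_eq_iff hs_def Hhat_eq pres_class_mult)
    fix d assume d: "d \<in> reflections m \<rightarrow>\<^sub>E carrier (Hhat m) \<and> (\<forall>i. d (simple_refl m i) = hD m i) \<and>
      (\<forall>i. \<forall>s\<in>reflections m - {simple_refl m i}.
         d (refl_conj i s) = hs m i \<otimes>\<^bsub>Hhat m\<^esub> d s \<otimes>\<^bsub>Hhat m\<^esub> hs m i)"
    show "d = ?d"
    proof (rule extensionalityI[of _ "reflections m"])
      fix t assume "t \<in> reflections m"
      then show "d t = ?d t"
      proof (induction rule: reflection_induct)
        case (simple i)
        have "d (simple_refl m i) = hD m i" using d by blast
        then show ?case by (simp only: d_simple)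
      next
        case (conj i t)
        note IH = conj(3)
        from conj(1,2) have "t \<in> reflections m - {simple_refl m i}" by blast
        with d have "d (refl_conj i t) = hs m i \<otimes>\<^bsub>Hhat m\<^esub> d t \<otimes>\<^bsub>Hhat m\<^esub> hs m i" by blast
        then show ?case
          by (simp only: d_conj[OF \<open>t \<in> reflections m - {simple_refl m i}\<close>] IH)
      qed
    next
      show "d \<in> extensional (reflections m)"
        using d by (simp add: PiE_def)
    qed simp
  qed
  then show ?thesis if "t \<in> reflections m" using that by simp
qed

lemma hW_cls: "hW m (cls xs) = c (word_s xs)"
proof -
  have "(\<lambda>xs. c (word_s xs)) ` cls xs = (\<lambda>_. c (word_s xs)) ` cls xs"
  proof (intro image_cong HOL.refl)
    fix ys assume "ys \<in> cls xs"
    then have "xs \<asymp> ys" by simp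
    then have "h (word_s ys) = h (word_s xs)"
      by (rule h_word_cong[symmetric])
    then show "c (word_s ys) = c (word_s xs)"
      by (simp only: h_eq_iff)
  qed
  also have "\<dots> = {c (word_s xs)}"
    by (rule image_constant[of xs]) simp
  finally show ?thesis
    by (simp add: hW_def)
qed


section \<open>A faithful representation\<close>

text \<open>The basis vector \<open>([t\<^sub>1, \<dots>, t\<^sub>k], w)\<close> stands for the product \<open>D\<^bsub>t\<^sub>1\<^esub> \<dots> D\<^bsub>t\<^sub>k\<^esub> w\<close>; only words
  without equal neighbours occur, as the \<open>D\<^sub>t\<close> are idempotent. The operators express left
  multiplication by \<open>D\<^sub>t\<close> and \<open>s\<^sub>i\<close>.\<close>

type_synonym (in -) 'a pbw = "('a list set list \<times> 'a list set) \<Rightarrow>\<^sub>0 int"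

definition mulD :: "'i list set \<Rightarrow> 'i pbw \<Rightarrow> 'i pbw" where
  "mulD t = frag_extend (\<lambda>(u, w). frag_of (if u \<noteq> [] \<and> hd u = t then u else t # u, w))"

fun mulS_basis :: "'i \<Rightarrow> 'i list set list \<Rightarrow> 'i list set \<Rightarrow> 'i pbw" where
  "mulS_basis i [] w = frag_of ([], simple_refl m i \<otimes>\<^bsub>W\<^esub> w)"
| "mulS_basis i (t # u) w =
    (if t = simple_refl m i
     then mulS_basis i u w - frag_of (u, w) - mulD t (mulS_basis i u w)
     else mulD (refl_conj i t) (mulS_basis i u w))"

definition mulS :: "'i \<Rightarrow> 'i pbw \<Rightarrow> 'i pbw" where
  "mulS i = frag_extend (\<lambda>(u, w). mulS_basis i u w)"

text \<open>Letters range over the whole group, which conjugation by s_i clearly preserves;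
  reflections are singled out only later, by \<open>words (reflections m)\<close>.\<close>

definition pbw_basis :: "('i list set list \<times> 'i list set) set" where
  "pbw_basis = {(u, w). distinct_adj u \<and> set u \<subseteq> carrier W \<and> w \<in> carrier W}"

definition pbw :: "'i pbw set" where
  "pbw = {v. Poly_Mapping.keys v \<subseteq> pbw_basis}"

lemma mulD_diff [simp]: "mulD t (a - b) = mulD t a - mulD t b"
  and mulD_0 [simp]: "mulD t 0 = 0"
  and mulD_of: "mulD t (frag_of (u, w)) = frag_of (if u \<noteq> [] \<and> hd u = t then u else t # u, w)"
  and mulS_diff [simp]: "mulS i (a - b) = mulS i a - mulS i b"
  and mulS_0 [simp]: "mulS i 0 = 0"
  and mulS_of [simp]: "mulS i (frag_of (u, w)) = mulS_basis i u w"
  by (simp_all add: mulD_def mulS_def frag_extend_diff)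

lemma pbw_0 [simp]: "0 \<in> pbw"
  and pbw_diff [simp]: "a \<in> pbw \<Longrightarrow> b \<in> pbw \<Longrightarrow> a - b \<in> pbw"
  using keys_diff[of a b] by (auto simp: pbw_def)

lemma pbw_of [simp]: "frag_of (u, w) \<in> pbw \<longleftrightarrow> distinct_adj u \<and> set u \<subseteq> carrier W \<and> w \<in> carrier W"
  by (auto simp: pbw_def pbw_basis_def)

lemma pbw_basis_induct [consumes 1, case_names of zero diff]:
  assumes "v \<in> pbw"
    and "\<And>u w. distinct_adj u \<Longrightarrow> set u \<subseteq> carrier W \<Longrightarrow> w \<in> carrier W \<Longrightarrow> P (frag_of (u, w))"
    and "P 0" "\<And>a b. P a \<Longrightarrow> P b \<Longrightarrow> P (a - b)"
  shows "P v"
  using assms(1) unfolding pbw_def mem_Collect_eq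
  by (rule frag_induction) (use assms(2-4) in \<open>auto simp: pbw_basis_def\<close>)

lemma mulD_pbw [simp]: "v \<in> pbw \<Longrightarrow> t \<in> carrier W \<Longrightarrow> mulD t v \<in> pbw"
proof (induction rule: pbw_basis_induct)
  case (of u w)
  then show ?case
    by (cases u) (auto simp: mulD_of)
qed simp_all

lemma simple_refl_mult_carrier [simp]: "w \<in> carrier W \<Longrightarrow> simple_refl m i \<otimes>\<^bsub>W\<^esub> w \<in> carrier W"
  by (intro monoid.m_closed group.is_monoid group_W) simp_all

lemma refl_conj_carrier [simp]: "t \<in> carrier W \<Longrightarrow> refl_conj i t \<in> carrier W"
  by (intro monoid.m_closed group.is_monoid group_W) simp_all

lemma mulS_basis_pbw: "distinct_adj u \<Longrightarrow> set u \<subseteq> carrier W \<Longrightarrow> w \<in> carrier W \<Longrightarrow> mulS_basis i u w \<in> pbw"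
  by (induction u) (auto dest: distinct_adj_ConsD)

lemma mulS_pbw [simp]: "v \<in> pbw \<Longrightarrow> mulS i v \<in> pbw"
  by (induction rule: pbw_basis_induct) (auto simp: mulS_basis_pbw)

lemma mulD_idem [simp]: "mulD t (mulD t v) = mulD t v"
  using subset_UNIV
proof (induction v rule: frag_induction)
  case (one x)
  then show ?case by (cases x) (auto simp: mulD_of)
qed simp_all

lemma mulS_mulD: 
  assumes "t \<noteq> simple_refl m i"
  shows "mulS i (mulD t v) = mulD (refl_conj i t) (mulS i v)"
  using subset_UNIV
proof (induction v rule: frag_induction)
  case (one x)
  obtain u w where x: "x = (u, w)" by (cases x)
  show ?case
  proof (cases "u \<noteq> [] \<and> hd u = t")
    case True
    then obtain u' where "u = t # u'" by (cases u) auto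
    then show ?thesis using assms by (simp add: x mulD_of)
  next
    case False
    then have "mulS i (mulD t (frag_of x)) = mulS i (frag_of (t # u, w))"
      by (auto simp: x mulD_of)
    then show ?thesis using assms by (simp add: x)
  qed
qed simp_all

lemma mulS_mulD_self:
  assumes "v \<in> pbw"
  shows "mulS i (mulD (simple_refl m i) v) = mulS i v - v - mulD (simple_refl m i) (mulS i v)"
  using assms
proof (induction v rule: pbw_basis_induct)
  case (of u w)
  show ?case
  proof (cases "u \<noteq> [] \<and> hd u = simple_refl m i")
    case True
    then obtain u' where u: "u = simple_refl m i # u'" by (cases u) auto
    \<comment> \<open>The absence of equal neighbours is used here: prepending the letter to
      \<open>u'\<close> restores \<open>u\<close>.\<close>
    with of(1) have "\<not> (u' \<noteq> [] \<and> hd u' = simple_refl m i)"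
      by (cases u') auto
    then have "mulD (simple_refl m i) (frag_of (u', w)) = frag_of (u, w)"
      by (auto simp: mulD_of u)
    then show ?thesis
      using True by (simp add: mulD_of u)
  next
    case False
    then have "mulS i (mulD (simple_refl m i) (frag_of (u, w))) = mulS i (frag_of (simple_refl m i # u, w))"
      by (auto simp: mulD_of)
    then show ?thesis by simp
  qed
qed simp_all

text \<open>Reduces an operator identity to the vectors \<open>([], w)\<close>, where it is a group
  identity, and to moving both sides past one \<open>mulD t\<close>.\<close>

lemma pbw_induct [consumes 1, case_names base mulD zero diff]:
  assumes "v \<in> pbw"
    and base: "\<And>w. w \<in> carrier W \<Longrightarrow> P (frag_of ([], w))"
    and step: "\<And>t v. t \<in> carrier W \<Longrightarrow> v \<in> pbw \<Longrightarrow> P v \<Longrightarrow> P (mulD t v)"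
    and "P 0" "\<And>a b. P a \<Longrightarrow> P b \<Longrightarrow> P (a - b)"
  shows "P v"
  using assms(1)
proof (induction v rule: pbw_basis_induct)
  case (of u w)
  then show ?case
  proof (induction u)
    case (Cons t u)
    then have "P (mulD t (frag_of (u, w)))"
      by (intro step Cons.IH) (auto dest: distinct_adj_ConsD)
    moreover have "mulD t (frag_of (u, w)) = frag_of (t # u, w)"
      using Cons.prems by (cases u) (auto simp: mulD_of)
    ultimately show ?case by simp
  qed (simp add: base)
qed fact+

lemma refl_conj_eq_simple_iff:
  assumes "t \<in> carrier W"
  shows "refl_conj i t = simple_refl m i \<longleftrightarrow> t = simple_refl m i"
  using refl_conj_refl_conj[OF assms, of i] refl_conj_self[of i] by metis

lemma mulS_mulS [simp]: "v \<in> pbw \<Longrightarrow> mulS i (mulS i v) = v"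
proof (induction v rule: pbw_induct)
  case (base w)
  interpret group W by (rule group_W)
  have "simple_refl m i \<otimes>\<^bsub>W\<^esub> (simple_refl m i \<otimes>\<^bsub>W\<^esub> w) = w"
    using base by (simp add: simple_refl_square flip: m_assoc)
  then show ?case by simp
next
  case (mulD t v)
  then show ?case
    by (cases "t = simple_refl m i")
      (auto simp: mulS_mulD mulS_mulD_self refl_conj_eq_simple_iff)
qed simp_all

lemma simple_refl_neq: "i \<noteq> j \<Longrightarrow> simple_refl m i \<noteq> simple_refl m j"
  using simple_refl_inj by (auto simp only: simple_refl_eq cls_eq_iff)

lemma refl_conj_two: "m i j = 2 \<Longrightarrow> refl_conj i (simple_refl m j) = simple_refl m j"
proof -
  assume "m i j = 2"
  have "[i, j, i] \<asymp> [j, i, i]"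
    using word_eq_context[OF word_eq_comm[OF \<open>m i j = 2\<close>], of "[]" "[i]"] by simp
  also have "\<dots> \<asymp> [j]"
    using word_eq_context[OF word_eq_square[of i], of "[j]" "[]"] by simp
  finally show ?thesis
    by (simp only: simple_refl_eq mult_cls cls_eq_iff) simp
qed

lemma refl_conj_three:
  "m i j = 3 \<Longrightarrow> refl_conj i (simple_refl m j) = refl_conj j (simple_refl m i)"
  using word_eq_braid[of i j] by (simp only: simple_refl_eq mult_cls cls_eq_iff) simp

lemma refl_conj_neq_three:
  assumes "i \<noteq> j"
  shows "refl_conj i (simple_refl m j) \<noteq> simple_refl m i"
  using refl_conj_eq_simple_iff[of "simple_refl m j" i] simple_refl_neq[of j i] assms by simp

lemma refl_conj_commute:
  assumes "m i j = 2" "t \<in> carrier W"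
  shows "refl_conj i (refl_conj j t) = refl_conj j (refl_conj i t)"
proof -
  obtain xs where "t = cls xs" using assms(2) unfolding carrier_W by blast
  moreover have "i # (j # xs @ [j]) @ [i] \<asymp> j # (i # xs @ [i]) @ [j]"
    using word_eq_append[OF word_eq_comm[OF assms(1)] word_eq_append[OF word_eq_refl[of xs] word_eq_sym[OF word_eq_comm[OF assms(1)]]]]
    by simp
  ultimately show ?thesis
    by (simp only: refl_conj_cls cls_eq_iff)
qed

lemma refl_conj_braid:
  assumes "m i j = 3" "t \<in> carrier W"
  shows "refl_conj i (refl_conj j (refl_conj i t)) = refl_conj j (refl_conj i (refl_conj j t))"
proof -
  obtain xs where "t = cls xs" using assms(2) unfolding carrier_W by blast
  moreover have "i # (j # (i # xs @ [i]) @ [j]) @ [i] \<asymp> j # (i # (j # xs @ [j]) @ [i]) @ [j]"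
    using word_eq_append[OF word_eq_braid[OF assms(1)] word_eq_append[OF word_eq_refl[of xs] word_eq_braid[OF assms(1)]]]
    by simp
  ultimately show ?thesis
    by (simp only: refl_conj_cls cls_eq_iff)
qed

lemma simple_refl_mult_commute:
  assumes "m i j = 2" "w \<in> carrier W"
  shows "simple_refl m i \<otimes>\<^bsub>W\<^esub> (simple_refl m j \<otimes>\<^bsub>W\<^esub> w) = simple_refl m j \<otimes>\<^bsub>W\<^esub> (simple_refl m i \<otimes>\<^bsub>W\<^esub> w)"
proof -
  obtain xs where "w = cls xs" using assms(2) unfolding carrier_W by blast
  moreover have "[i] @ ([j] @ xs) \<asymp> [j] @ ([i] @ xs)"
    using word_eq_append[OF word_eq_comm[OF assms(1)] word_eq_refl[of xs]] by simp
  ultimately show ?thesis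
    by (simp only: simple_refl_eq mult_cls cls_eq_iff)
qed

lemma simple_refl_mult_braid:
  assumes "m i j = 3" "w \<in> carrier W"
  shows "simple_refl m i \<otimes>\<^bsub>W\<^esub> (simple_refl m j \<otimes>\<^bsub>W\<^esub> (simple_refl m i \<otimes>\<^bsub>W\<^esub> w)) =
    simple_refl m j \<otimes>\<^bsub>W\<^esub> (simple_refl m i \<otimes>\<^bsub>W\<^esub> (simple_refl m j \<otimes>\<^bsub>W\<^esub> w))"
proof -
  obtain xs where "w = cls xs" using assms(2) unfolding carrier_W by blast
  moreover have "[i] @ ([j] @ ([i] @ xs)) \<asymp> [j] @ ([i] @ ([j] @ xs))"
    using word_eq_append[OF word_eq_braid[OF assms(1)] word_eq_refl[of xs]] by simp
  ultimately show ?thesis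
    by (simp only: simple_refl_eq mult_cls cls_eq_iff)
qed

lemma m_off_diagonal: "m i j = 2 \<Longrightarrow> i \<noteq> j" "m i j = 3 \<Longrightarrow> i \<noteq> j"
  using m_diag[of i] by auto

lemma refl_conj_inj:
  "t \<in> carrier W \<Longrightarrow> t' \<in> carrier W \<Longrightarrow> refl_conj i t = refl_conj i t' \<Longrightarrow> t = t'"
  by (metis refl_conj_refl_conj)

lemma mulS_commute:
  assumes "v \<in> pbw" "m i j = 2"
  shows "mulS i (mulS j v) = mulS j (mulS i v)"
  using assms(1)
proof (induction v rule: pbw_induct)
  case (base w)
  then show ?case
    by (simp add: simple_refl_mult_commute[OF assms(2)])
next
  case (mulD t v)
  have m: "i \<noteq> j" "m j i = 2"
    using assms(2) m_off_diagonal m_sym by auto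
  note r = refl_conj_two[OF assms(2)] refl_conj_two[OF m(2)] simple_refl_neq[OF m(1)]
    simple_refl_neq[OF m(1)[symmetric]]
  consider "t = simple_refl m i" | "t = simple_refl m j" |
    "t \<noteq> simple_refl m i" "t \<noteq> simple_refl m j" by blast
  then show ?case
  proof cases
    case 1
    then show ?thesis
      using mulD r by (simp add: mulS_mulD mulS_mulD_self)
  next
    case 2
    then show ?thesis
      using mulD r by (simp add: mulS_mulD mulS_mulD_self)
  next
    case 3
    then have "refl_conj i t \<noteq> simple_refl m j" "refl_conj j t \<noteq> simple_refl m i"
      using refl_conj_inj[of t "simple_refl m j" i] refl_conj_inj[of t "simple_refl m i" j] r mulD(1) by auto
    with 3 show ?thesis
      using mulD by (simp add: mulS_mulD refl_conj_commute[OF assms(2)])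
  qed
qed simp_all

text \<open>On the way past the three operators, D_t meets its own reflection exactly when
  \<open>t\<close> is one of the three reflections of the dihedral group; then the additional terms
  are compared. For any other \<open>t\<close> both sides merely conjugate it, and
  \<open>refl_conj_braid\<close> is enough.\<close>

lemma mulS_braid:
  assumes "v \<in> pbw" "m i j = 3"
  shows "mulS i (mulS j (mulS i v)) = mulS j (mulS i (mulS j v))"
  using assms(1)
proof (induction v rule: pbw_induct)
  case (base w)
  then show ?case
    by (simp add: simple_refl_mult_braid[OF assms(2)])
next
  case (mulD t v)
  let ?r = "refl_conj i (simple_refl m j)"
  have m: "i \<noteq> j" "m j i = 3"
    using assms(2) m_off_diagonal m_sym by auto
  have r1: "refl_conj j (simple_refl m i) = ?r"
    using refl_conj_three[OF assms(2)] by simp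
  have r2: "refl_conj i ?r = simple_refl m j"
    by simp
  have r3: "refl_conj j ?r = simple_refl m i"
    using refl_conj_refl_conj[of "simple_refl m i" j] by (simp only: r1 simple_refl_in_carrier)
  have r4: "?r \<noteq> simple_refl m i" "?r \<noteq> simple_refl m j"
    using refl_conj_neq_three[OF m(1)] refl_conj_neq_three[OF m(1)[symmetric]] r1 by simp_all
  note r = r1 r2 r3 r4 simple_refl_neq[OF m(1)] simple_refl_neq[OF m(1)[symmetric]]
  consider "t = simple_refl m i" | "t = simple_refl m j" | "t = ?r" |
    "t \<noteq> simple_refl m i" "t \<noteq> simple_refl m j" "t \<noteq> ?r" by blast
  then show ?case
  proof cases
    case 1
    then show ?thesis
      using mulD r by (simp add: mulS_mulD mulS_mulD_self)
  next
    case 2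
    then show ?thesis
      using mulD r by (simp add: mulS_mulD mulS_mulD_self)
  next
    case 3
    then show ?thesis
      using mulD r by (simp add: mulS_mulD mulS_mulD_self)
  next
    case 4
    note inj = refl_conj_inj[of t _ i] refl_conj_inj[of t _ j]
    have n: "refl_conj i t \<noteq> simple_refl m j" "refl_conj j t \<noteq> simple_refl m i"
      using 4 inj[of ?r] r mulD(1) by (metis refl_conj_carrier simple_refl_in_carrier)+
    moreover have "refl_conj j (refl_conj i t) \<noteq> simple_refl m i"
      "refl_conj i (refl_conj j t) \<noteq> simple_refl m j"
      using n 4 r mulD(1) refl_conj_inj by (metis refl_conj_carrier simple_refl_in_carrier)+
    ultimately show ?thesis
      using mulD 4 by (simp add: mulS_mulD refl_conj_braid[OF assms(2)])
  qed
qed simp_all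

definition gen_op :: "'i gen \<Rightarrow> 'i pbw \<Rightarrow> 'i pbw" where
  "gen_op g = (case g of GS i \<Rightarrow> mulS i | GD i \<Rightarrow> mulD (simple_refl m i))"

definition op :: "'i gen free_alg \<Rightarrow> 'i pbw \<Rightarrow> 'i pbw" where
  "op p v = frag_extend (\<lambda>xs. foldr gen_op xs v) p"

lemma gen_op_diff: "gen_op g (a - b) = gen_op g a - gen_op g b"
  by (simp add: gen_op_def split: gen.split)

lemma gen_op_pbw: "v \<in> pbw \<Longrightarrow> gen_op g v \<in> pbw"
  by (simp add: gen_op_def split: gen.split)

lemma op_of: "op (frag_of xs) v = foldr gen_op xs v"
  and op_0 [simp]: "op 0 v = 0"
  and op_diff: "op (p - q) v = op p v - op q v"
  and op_add: "op (p + q) v = op p v + op q v"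
  by (simp_all add: op_def frag_extend_diff frag_extend_add)

lemma op_1 [simp]: "op 1 v = v"
  by (simp add: free_alg_one op_of)

lemma op_gen [simp]: "op (gen_s i) v = mulS i v" "op (gen_D i) v = mulD (simple_refl m i) v"
  by (simp_all add: op_of gen_op_def)

lemma op_diff_right: "op p (a - b) = op p a - op p b"
  using subset_UNIV
proof (induction p rule: frag_induction)
  case (one xs)
  then show ?case
    by (induction xs) (simp_all add: op_of gen_op_diff)
qed (simp_all add: op_diff)

lemma op_0_right [simp]: "op p 0 = 0"
  using op_diff_right[of p 0 0] by simp

lemma op_pbw [simp]: "v \<in> pbw \<Longrightarrow> op p v \<in> pbw"
  using subset_UNIV
proof (induction p rule: frag_induction)
  case (one xs)
  then show ?case
    by (induction xs) (simp_all add: op_of gen_op_pbw)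
qed (simp_all add: op_diff)

lemma op_mult [simp]: "op (p * q) v = op p (op q v)"
  using subset_UNIV
proof (induction p rule: frag_induction)
  case (one xs)
  show ?case
    using subset_UNIV
  proof (induction q rule: frag_induction)
    case (one ys)
    show ?case by (simp only: free_alg_mult op_of foldr_append o_apply)
  qed (simp_all add: op_diff op_diff_right algebra_simps)
qed (simp_all add: op_diff algebra_simps)

lemma op_hat_relators:
  assumes "r \<in> hat_relators m" "v \<in> pbw"
  shows "op r v = 0"
proof -
  consider i where "r = gen_s i ^ 2 - 1" | i where "r = gen_D i ^ 2 - gen_D i"
    | i where "r = (gen_s i * gen_D i + gen_D i * gen_s i) - (gen_s i - 1)"
    | i j where "r = (gen_s i * gen_s j) ^ m i j - 1"
    | i j where "r = gen_D i * word_s (alternating j i (m i j - 1))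
        - word_s (alternating j i (m i j - 1)) * gen_D (if even (m i j) then i else j)"
      "i \<noteq> j" "m i j \<noteq> 0"
    using assms(1) unfolding hat_relators_def by blast
  then show ?thesis
  proof cases
    case 4
    consider "i = j" | "m i j = 0" | "m i j = 2" | "m i j = 3"
      using m_cases[of i j] by (cases "i = j") auto
    then show ?thesis
    proof cases
      case 3
      then show ?thesis
        using assms(2) mulS_commute[OF assms(2) 3] by (simp add: 4 op_diff numeral_2_eq_2)
    next
      case a: 4
      have "mulS i (mulS j (mulS i (mulS j (mulS i (mulS j v))))) = v"
        using assms(2) mulS_braid[OF _ a, of "mulS j v"] mulS_braid[OF _ a, of "mulS j (mulS i (mulS j v))"]
          mulS_braid[OF _ a, of v] by simp
      then show ?thesis
        by (simp add: 4 a op_diff numeral_3_eq_3)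
    qed (use assms(2) 4 in \<open>simp_all add: op_diff m_diag\<close>)
  next
    case 5
    then consider "m i j = 2" | "m i j = 3"
      using m_cases[of i j] by (cases "i = j") auto
    then show ?thesis
    proof cases
      case 1
      then have "m j i = 2" using m_sym by simp
      have "mulS j (mulD (simple_refl m i) v) = mulD (simple_refl m i) (mulS j v)"
        using mulS_mulD[of "simple_refl m i" j v] refl_conj_two[OF \<open>m j i = 2\<close>] simple_refl_neq[OF 5(2)] by simp
      then show ?thesis
        by (simp add: 5(1) 1 op_diff numeral_2_eq_2)
    next
      case 2
      then have m: "m j i = 3" using m_sym by simp
      let ?r = "refl_conj i (simple_refl m j)"
      have "mulS j (mulD ?r v') = mulD (simple_refl m i) (mulS j v')" for v'
        using mulS_mulD[of ?r j v'] refl_conj_three[OF 2] refl_conj_neq_three[of j i] 5(2)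
          refl_conj_refl_conj[of "simple_refl m i" j] by simp
      moreover have "mulS i (mulD (simple_refl m j) v) = mulD ?r (mulS i v)"
        using mulS_mulD[of "simple_refl m j" i v] simple_refl_neq[of j i] 5(2) by simp
      ultimately show ?thesis
        by (simp add: 5(1) 2 op_diff numeral_3_eq_3)
    qed
  qed (use assms(2) in \<open>simp_all add: op_diff op_add power2_eq_square mulS_mulD_self\<close>)
qed

text \<open>The elements acting as zero on \<open>pbw\<close> form an ideal containing the relators,
  so coefficients of \<open>op p v\<close> depend only on the class of \<open>p\<close>.\<close>

lemma op_eq_if_h_eq:
  assumes "h p = h q" "v \<in> pbw"
  shows "op p v = op q v"
proof -
  have "ideal {p. \<forall>v\<in>pbw. op p v = 0} Free"
    by (rule ideal_ring_of_type_algebraI) (auto simp: op_diff)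
  then have "Idl\<^bsub>Free\<^esub> (hat_relators m) \<subseteq> {p. \<forall>v\<in>pbw. op p v = 0}"
    by (rule Idl_least) (auto simp: op_hat_relators)
  moreover have "p - q \<in> Idl\<^bsub>Free\<^esub> (hat_relators m)"
    using assms(1) unfolding h_eq_iff pres_class_eq_iff .
  ultimately have "op (p - q) v = 0"
    using assms(2) by blast
  then show ?thesis by (simp add: op_diff)
qed

text \<open>In the conjugation step, \<open>mulS_mulD\<close> moves \<open>mulS i\<close> past
  \<open>mulD t\<close>, where it cancels against the second \<open>mulS i\<close>.\<close>

lemma op_drep:
  assumes "t \<in> reflections m" "v \<in> pbw"
  shows "op (drep t) v = mulD t v"
  using assms
proof (induction t arbitrary: v rule: reflection_induct)
  case (simple i)
  then show ?case
    using op_eq_if_h_eq[OF h_drep_simple[of i]] by simp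
next
  case (conj i t)
  have "op (drep (refl_conj i t)) v = mulS i (mulD t (mulS i v))"
    using op_eq_if_h_eq[OF h_drep_conj[OF conj(1,2)]] conj by simp
  then show ?case
    using conj mulS_mulD[OF conj(2)] by simp
qed


section \<open>Expansion in products of the \<open>D\<^sub>s\<close>\<close>

definition prodD :: "'i list set list \<Rightarrow> 'i gen free_alg" where
  "prodD u = prod_list (map drep u)"

definition evalD :: "('i list set list \<Rightarrow>\<^sub>0 int) \<Rightarrow> 'i gen free_alg" where
  "evalD = frag_extend prodD"

lemma prodD_simps [simp]: "prodD [] = 1" "prodD (t # u) = drep t * prodD u" "prodD (u @ v) = prodD u * prodD v"
  by (simp_all add: prodD_def)

lemma evalD_diff: "evalD (f - g) = evalD f - evalD g"
  and evalD_add: "evalD (f + g) = evalD f + evalD g"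
  and evalD_minus: "evalD (- f) = - evalD f"
  and evalD_of: "evalD (frag_of u) = prodD u"
  and evalD_0: "evalD 0 = 0"
  by (simp_all add: evalD_def frag_extend_diff frag_extend_add frag_extend_minus)

definition words :: "'i list set set \<Rightarrow> 'i list set list set" where
  "words A = {u. distinct_adj u \<and> set u \<subseteq> A}"

text \<open>Applied to \<open>([], w)\<close>, a product reproduces its own index, so the expansion
  of an element can be read off from one vector.\<close>

lemma op_prodD:
  assumes "u \<in> words (reflections m)" "w \<in> carrier W"
  shows "op (prodD u) (frag_of ([], w)) = frag_of (u, w)"
  using assms(1)
proof (induction u)
  case (Cons t u)
  then have u: "distinct_adj u" "set u \<subseteq> carrier W" "t \<in> reflections m" "u = [] \<or> hd u \<noteq> t"
    using reflections_carrier by (auto simp: words_def distinct_adj_Cons)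
  moreover have "u \<in> words (reflections m)"
    using Cons.prems u(1) by (simp add: words_def)
  ultimately show ?case
    using Cons.IH assms(2) by (auto simp: op_drep mulD_of)
qed simp

lemma op_evalD:
  assumes "Poly_Mapping.keys f \<subseteq> words (reflections m)" "w \<in> carrier W"
  shows "op (evalD f) (frag_of ([], w)) = frag_extend (\<lambda>u. frag_of (u, w)) f"
  using assms(1)
  by (induction f rule: frag_induction)
    (simp_all add: evalD_of evalD_diff evalD_0 op_diff op_prodD assms(2) frag_extend_diff)

lemma one_in_carrier: "\<one>\<^bsub>W\<^esub> \<in> carrier W"
  by (simp only: one_W cls_in_carrier)

lemma evalD_inj:
  assumes "h (evalD f) = h (evalD g)" "Poly_Mapping.keys f \<subseteq> words (reflections m)"
    "Poly_Mapping.keys g \<subseteq> words (reflections m)"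
  shows "f = g"
proof -
  \<comment> \<open>Forgetting the group component recovers the coefficients from that
    vector.\<close>
  have fst: "frag_extend (frag_of \<circ> fst) (frag_extend (\<lambda>u. frag_of (u, \<one>\<^bsub>W\<^esub>)) f) = f" for f :: "'i list set list \<Rightarrow>\<^sub>0 int"
    using frag_extend_compose[of "frag_of \<circ> fst" "\<lambda>u. (u, \<one>\<^bsub>W\<^esub>)" f] frag_expansion[of f]
    by (simp add: comp_def)
  have "frag_extend (\<lambda>u. frag_of (u, \<one>\<^bsub>W\<^esub>)) f = frag_extend (\<lambda>u. frag_of (u, \<one>\<^bsub>W\<^esub>)) g"
    using op_eq_if_h_eq[OF assms(1), of "frag_of ([], \<one>\<^bsub>W\<^esub>)"] one_in_carrier
    by (simp add: op_evalD assms(2,3))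
  from arg_cong[OF this, of "frag_extend (frag_of \<circ> fst)"] show ?thesis
    by (simp only: fst)
qed

lemma h_drep_idem: "t \<in> reflections m \<Longrightarrow> h (drep t) * h (drep t) = h (drep t)"
proof (induction rule: reflection_induct)
  case (simple i)
  then show ?case by (simp add: h_drep_simple h_idem)
next
  case (conj i t)
  have "h (drep (refl_conj i t)) * h (drep (refl_conj i t)) =
      h (gen_s i) * (h (drep t) * ((h (gen_s i) * h (gen_s i)) * (h (drep t) * h (gen_s i))))"
    by (simp add: h_drep_conj[OF conj(1,2)] iota_mult mult.assoc)
  also have "\<dots> = h (gen_s i) * ((h (drep t) * h (drep t)) * h (gen_s i))"
    by (simp add: h_square mult.assoc)
  finally show ?case
    by (simp add: conj(3) h_drep_conj[OF conj(1,2)] iota_mult mult.assoc)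
qed

lemma h_prodD_remdups: "set u \<subseteq> reflections m \<Longrightarrow> h (prodD (remdups_adj u)) = h (prodD u)"
proof (induction u rule: remdups_adj.induct)
  case (3 x y u)
  show ?case
  proof (cases "x = y")
    case True
    have "h (prodD (x # x # u)) = (h (drep x) * h (drep x)) * h (prodD u)"
      by (simp add: iota_mult mult.assoc)
    then show ?thesis
      using 3 True by (simp add: h_drep_idem iota_mult)
  qed (use 3 in \<open>simp add: iota_mult\<close>)
qed simp_all

text \<open>Concatenation may create a pair of equal neighbours; idempotency allows one of them to
  be dropped, and the alphabet stays the same.\<close>

lemma evalD_mult:
  assumes "Poly_Mapping.keys f \<subseteq> words A" "Poly_Mapping.keys g \<subseteq> words A" "A \<subseteq> reflections m"
  obtains F where "Poly_Mapping.keys F \<subseteq> words A" "h (evalD F) = h (evalD f * evalD g)"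
proof
  let ?F = "frag_extend (\<lambda>u. frag_extend (\<lambda>v. frag_of (remdups_adj (u @ v))) g) f"
  show "Poly_Mapping.keys ?F \<subseteq> words A"
    using assms(1,2) keys_frag_extend by (fastforce simp: words_def dest!: subsetD[OF keys_frag_extend])
  have *: "h (evalD (frag_extend (\<lambda>v. frag_of (remdups_adj (u @ v))) g)) = h (prodD u * evalD g)"
    if "u \<in> words A" for u
    using assms(2)
  proof (induction g rule: frag_induction)
    case (one v)
    then show ?case
      using that assms(3) h_prodD_remdups[of "u @ v"] by (auto simp: evalD_of words_def)
  qed (simp_all add: evalD_diff evalD_0 frag_extend_diff iota_simps algebra_simps)
  show "h (evalD ?F) = h (evalD f * evalD g)"
    using assms(1)
    by (induction f rule: frag_induction)
      (simp_all add: * evalD_of evalD_diff evalD_0 frag_extend_diff iota_simps algebra_simps)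
qed

abbreviation refls :: "'i set \<Rightarrow> 'i list set set" where
  "refls J \<equiv> reflections m \<inter> parabolic m J"

lemma Dhat_evalD:
  assumes "x \<in> Dhat m J"
  obtains f where "Poly_Mapping.keys f \<subseteq> words (refls J)" "x = c (evalD f)"
proof -
  have "\<exists>f. Poly_Mapping.keys f \<subseteq> words (refls J) \<and> x = c (evalD f)"
    using assms unfolding Dhat_def Hhat_eq
  proof (induction rule: generate_ring.induct)
    case one
    show ?case
      by (rule exI[of _ "frag_of []"]) (simp add: words_def evalD_of pres_class_one)
  next
    case (incl y)
    then obtain t where "t \<in> refls J" "y = Drefl m t" by blast
    then show ?case
      by (intro exI[of _ "frag_of [t]"]) (simp add: words_def evalD_of Drefl_eq)
  next
    case (a_inv y)
    then obtain f where "Poly_Mapping.keys f \<subseteq> words (refls J)" "y = c (evalD f)" by blast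
    then show ?case
      by (intro exI[of _ "- f"]) (simp add: pres_class_minus evalD_minus)
  next
    case (eng_add y z)
    then obtain f g where fg: "Poly_Mapping.keys f \<subseteq> words (refls J)" "y = c (evalD f)"
      "Poly_Mapping.keys g \<subseteq> words (refls J)" "z = c (evalD g)" by blast
    moreover have "Poly_Mapping.keys (f + g) \<subseteq> words (refls J)"
      using fg(1,3) keys_add[of f g] by auto
    ultimately show ?case
      by (intro exI[of _ "f + g"]) (simp add: pres_class_add evalD_add)
  next
    case (eng_mult y z)
    then obtain f g where fg: "Poly_Mapping.keys f \<subseteq> words (refls J)" "y = c (evalD f)"
      "Poly_Mapping.keys g \<subseteq> words (refls J)" "z = c (evalD g)" by blast
    obtain F where "Poly_Mapping.keys F \<subseteq> words (refls J)" "h (evalD F) = h (evalD f * evalD g)"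
      using evalD_mult[OF fg(1,3)] by blast
    then show ?case
      using fg by (intro exI[of _ F]) (simp add: pres_class_mult h_eq_iff)
  qed
  then show thesis using that by blast
qed

lemma foldr_Drefl:
  "set ss \<subseteq> reflections m \<Longrightarrow> foldr (\<otimes>\<^bsub>Hhat m\<^esub>) (map (Drefl m) ss) \<one>\<^bsub>Hhat m\<^esub> = c (prodD ss)"
  by (induction ss) (simp_all add: Hhat_eq pres_class_one pres_class_mult Drefl_eq)

lemma add_monoid_inv: "inv\<^bsub>add_monoid (pres R)\<^esub> pres_class R p = pres_class R (- p)"
  using pres_class_minus[of R p] by (simp add: a_inv_def)

text \<open>Removing repeated neighbours only shortens a word, so the bound on the degree becomes a
  bound on the length.\<close>

lemma deg_le_evalD:
  assumes "x \<in> deg_le m r"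
  obtains f where "Poly_Mapping.keys f \<subseteq> words (reflections m) \<inter> {u. length u \<le> r}" "x = c (evalD f)"
proof -
  have "\<exists>f. Poly_Mapping.keys f \<subseteq> words (reflections m) \<inter> {u. length u \<le> r} \<and> x = c (evalD f)"
    using assms unfolding deg_le_def
  proof (induction rule: generate.induct)
    case one
    show ?case
      by (rule exI[of _ 0]) (simp add: evalD_0 Hhat_eq pres_class_zero)
  next
    case (incl y)
    then obtain ss where ss: "set ss \<subseteq> reflections m" "length ss \<le> r" "y = c (prodD ss)"
      using foldr_Drefl by auto
    then show ?case
      using le_trans[OF remdups_adj_length ss(2)] h_prodD_remdups[OF ss(1)]
      by (intro exI[of _ "frag_of (remdups_adj ss)"]) (auto simp: evalD_of words_def h_eq_iff)
  next
    case (inv y)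
    then obtain ss where ss: "set ss \<subseteq> reflections m" "length ss \<le> r" "y = c (prodD ss)"
      using foldr_Drefl by auto
    have "inv\<^bsub>add_monoid (Hhat m)\<^esub> y = c (- prodD ss)"
      unfolding ss(3) Hhat_eq by (rule add_monoid_inv)
    also have "\<dots> = c (- prodD (remdups_adj ss))"
      unfolding h_eq_iff[symmetric] iota_minus h_prodD_remdups[OF ss(1)] by (rule HOL.refl)
    finally show ?case
      using le_trans[OF remdups_adj_length ss(2)] ss(1)
      by (intro exI[of _ "- frag_of (remdups_adj ss)"]) (simp add: evalD_of evalD_minus words_def)
  next
    case (eng y z)
    then obtain f g where fg: "Poly_Mapping.keys f \<subseteq> words (reflections m) \<inter> {u. length u \<le> r}" "y = c (evalD f)"
      "Poly_Mapping.keys g \<subseteq> words (reflections m) \<inter> {u. length u \<le> r}" "z = c (evalD g)" by blast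
    have "Poly_Mapping.keys (f + g) \<subseteq> words (reflections m) \<inter> {u. length u \<le> r}"
      using fg(1,3) keys_add[of f g] by auto
    then show ?case
      using fg(2,4) by (intro exI[of _ "f + g"])
        (simp add: Hhat_eq pres_class_add evalD_add)
  qed
  then show thesis using that by blast
qed

subsection \<open>The counit\<close>

lemma eps_cong: "c p = c q \<Longrightarrow> eps p = eps q"
proof -
  assume "c p = c q"
  then have "eps (p - q) = 0"
    by (intro eps_Idl[OF eps_hat_relators]) (simp_all add: pres_class_eq_iff)
  then show ?thesis by simp
qed

text \<open>A homomorphism is determined by its values at the generators, and the extensionality
  clause fixes it off the carrier, so \<open>THE\<close> selects the map induced by
  \<open>eps\<close>.\<close>

lemma counit_eq: "counit m (c p) = eps p"
proof -
  define e where "e = (\<lambda>x\<in>carrier (Hhat m). eps (SOME p. x = c p))"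
  have e_c: "e (c p) = eps p" for p
  proof -
    have "c p = c (SOME q. c p = c q)"
      by (rule someI[of "\<lambda>q. c p = c q" p]) simp
    from eps_cong[OF this] show ?thesis
      by (simp add: e_def Hhat_eq)
  qed
  have "counit m = e"
    unfolding counit_def
  proof (rule the_equality, intro conjI allI)
    show "e \<in> ring_hom (Hhat m) \<Z>"
      by (rule ring_hom_memI)
        (auto simp: Hhat_eq carrier_pres pres_class_mult pres_class_add pres_class_one e_c)
    show "e \<in> extensional (carrier (Hhat m))"
      by (simp add: e_def)
    show "e (hs m i) = 1" "e (hD m i) = 0" for i
      by (simp_all add: hs_def hD_def e_c)
    fix e' assume e': "e' \<in> ring_hom (Hhat m) \<Z> \<and> e' \<in> extensional (carrier (Hhat m)) \<and>
      (\<forall>i. e' (hs m i) = 1 \<and> e' (hD m i) = 0)"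
    have mult: "e' (c (p * q)) = e' (c p) * e' (c q)" for p q
      using ring_hom_mult[of e' "Hhat m" \<Z> "c p" "c q"] e' by (simp add: Hhat_eq pres_class_mult)
    have add: "e' (c (p + q)) = e' (c p) + e' (c q)" for p q
      using ring_hom_add[of e' "Hhat m" \<Z> "c p" "c q"] e' by (simp add: Hhat_eq pres_class_add)
    have diff: "e' (c (p - q)) = e' (c p) - e' (c q)" for p q
      using add[of "p - q" q] by simp
    have "e' (c p) = eps p" for p
      using subset_UNIV
    proof (induction p rule: frag_induction)
      case zero
      show ?case using add[of 0 0] by simp
    next
      case (one xs)
      show ?case
      proof (induction xs)
        case Nil
        show ?case
          using ring_hom_one[of e' "Hhat m" \<Z>] e' by (simp add: Hhat_eq pres_class_one flip: free_alg_one)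
      next
        case (Cons x xs)
        have "e' (c (frag_of [x])) = eps (frag_of [x])"
          using e' by (cases x) (auto simp: hs_def hD_def eps_of)
        then show ?case
          using mult[of "frag_of [x]" "frag_of xs"] eps_mult[of "frag_of [x]" "frag_of xs"] Cons
          by (simp add: free_alg_mult)
      qed
    qed (simp add: diff)
    then have "e' x = e x" if "x \<in> carrier (Hhat m)" for x
      using that by (auto simp: Hhat_eq carrier_pres e_c)
    then show "e' = e"
      using e' by (intro extensionalityI[of e' "carrier (Hhat m)" e]) (simp_all add: e_def)
  qed
  then show ?thesis by (simp add: e_c)
qed

lemma eps_drep: "eps (drep t) = 0"
  by (simp add: drep_def conjD_def split: prod.split)

lemma eps_evalD: "eps (evalD f) = Poly_Mapping.lookup f []"
  using subset_UNIV
proof (induction f rule: frag_induction)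
  case (one u)
  then show ?case by (cases u) (auto simp: evalD_of eps_drep lookup_single)
qed (simp_all add: evalD_0 evalD_diff lookup_minus)

subsection \<open>Coefficients of elements of \<open>K\<^sub>i\<^sub>j\<close>\<close>

lemma op_word_s: "op (word_s xs) v = foldr mulS xs v"
  by (induction xs) simp_all

lemma foldr_mulS_extend:
  "foldr mulS xs (frag_extend b f) = frag_extend (\<lambda>u. foldr mulS xs (b u)) f"
  using subset_UNIV
proof (induction f rule: frag_induction)
  case (diff a b)
  have "foldr mulS xs (v - w) = foldr mulS xs v - foldr mulS xs w" for v w
    by (induction xs) simp_all
  then show ?case
    using diff by (simp add: frag_extend_diff)
qed (induction xs; simp)+

lemma foldr_mulS_one: "foldr mulS xs (frag_of ([], \<one>\<^bsub>W\<^esub>)) = frag_of ([], cls xs)"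
proof (induction xs)
  case Nil
  then show ?case by (simp only: one_W foldr.simps id_apply)
next
  case (Cons x xs)
  have "simple_refl m x \<otimes>\<^bsub>W\<^esub> cls xs = cls (x # xs)"
    by (simp only: simple_refl_eq mult_cls append_Cons append_Nil)
  then show ?case
    by (simp only: foldr.simps o_apply Cons mulS_of mulS_basis.simps)
qed

text \<open>For x in K and w0 the class of \<open>xs\<close>, w0^-1 x w0 is again a combination of
  products of the D_t, so it sends \<open>([], 1)\<close> to vectors with group component 1. The sum
  computes the same vector from the coefficients of x: first w0 acts, then x, then w0^-1.\<close>

lemma Kalg_coefficient:
  assumes "c (evalD f) \<in> Kalg m J" "Poly_Mapping.keys f \<subseteq> words (reflections m)"
    "xs \<in> lists J" "w \<noteq> \<one>\<^bsub>W\<^esub>"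
  shows "Poly_Mapping.lookup (frag_extend (\<lambda>u. foldr mulS (rev xs) (frag_of (u, cls xs))) f) (u, w) = 0"
proof -
  have "cls xs \<in> parabolic m J"
    using assms(3) unfolding parabolic_eq by blast
  with assms(1) obtain y where y: "y \<in> Dhat m J"
    "c (evalD f) = hW m (cls xs) \<otimes>\<^bsub>Hhat m\<^esub> y \<otimes>\<^bsub>Hhat m\<^esub> hW m (inv\<^bsub>W\<^esub> cls xs)"
    unfolding Kalg_def by blast
  obtain g where g: "Poly_Mapping.keys g \<subseteq> words (refls J)" "y = c (evalD g)"
    using y(1) by (rule Dhat_evalD)
  have "Poly_Mapping.keys g \<subseteq> words (reflections m)"
    using g(1) by (auto simp: words_def)
  have "c (evalD f) = c (word_s xs * evalD g * word_s (rev xs))"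
    by (simp only: y(2) g(2) inv_cls hW_cls Hhat_eq pres_class_mult)
  then have "h (evalD f) = h (word_s xs * evalD g * word_s (rev xs))"
    by (simp only: h_eq_iff)
  then have "h (word_s (rev xs) * evalD f * word_s xs) =
      (h (word_s (rev xs)) * h (word_s xs)) * h (evalD g) * (h (word_s (rev xs)) * h (word_s xs))"
    by (simp add: iota_mult mult.assoc)
  then have "h (word_s (rev xs) * evalD f * word_s xs) = h (evalD g)"
    by (simp add: h_word_rev)
  then have "op (word_s (rev xs) * evalD f * word_s xs) (frag_of ([], \<one>\<^bsub>W\<^esub>)) = op (evalD g) (frag_of ([], \<one>\<^bsub>W\<^esub>))"
    by (rule op_eq_if_h_eq) (simp add: one_in_carrier)
  then have "frag_extend (\<lambda>u. foldr mulS (rev xs) (frag_of (u, cls xs))) f = frag_extend (\<lambda>u. frag_of (u, \<one>\<^bsub>W\<^esub>)) g"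
    using op_evalD[OF assms(2), of "cls xs"] op_evalD[OF \<open>Poly_Mapping.keys g \<subseteq> words (reflections m)\<close> one_in_carrier]
    by (simp only: op_mult foldr_mulS_one op_word_s foldr_mulS_extend cls_in_carrier)
  moreover have "Poly_Mapping.lookup (frag_extend (\<lambda>u. frag_of (u, \<one>\<^bsub>W\<^esub>)) g) (u, w) = 0"
    using assms(4) keys_frag_extend[of "\<lambda>u. frag_of (u, \<one>\<^bsub>W\<^esub>)" g] by (auto simp: in_keys_iff)
  ultimately show ?thesis by simp
qed

lemma lookup_frag_extend_list:
  assumes "Poly_Mapping.keys f \<subseteq> set L" "distinct L"
  shows "Poly_Mapping.lookup (frag_extend b f) y = (\<Sum>u\<leftarrow>L. Poly_Mapping.lookup f u * Poly_Mapping.lookup (b u) y)"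
proof -
  have "Poly_Mapping.lookup (frag_extend b f) y =
      (\<Sum>u\<in>Poly_Mapping.keys f. Poly_Mapping.lookup f u * Poly_Mapping.lookup (b u) y)"
    by (simp add: frag_extend_def lookup_sum)
  also have "\<dots> = (\<Sum>u\<in>set L. Poly_Mapping.lookup f u * Poly_Mapping.lookup (b u) y)"
    by (rule sum.mono_neutral_left) (use assms(1) in \<open>auto simp: in_keys_iff\<close>)
  finally show ?thesis
    using assms(2) by (simp add: sum_list_distinct_conv_sum_set)
qed

text \<open>The list \<open>L\<close> is a parameter so that the conditions become explicit finite
  sums once the possible words are enumerated.\<close>

lemma obtain_Kij_expansion:
  assumes "x \<in> Kij m i j"
  obtains f where "Poly_Mapping.keys f \<subseteq> {u \<in> words (refls {i, j}). length u \<le> m i j}"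
    "x = c (evalD f)" "Poly_Mapping.lookup f [] = 0"
    "\<forall>L xs w u. xs \<in> lists {i, j} \<longrightarrow> w \<noteq> \<one>\<^bsub>W\<^esub> \<longrightarrow> Poly_Mapping.keys f \<subseteq> set L \<longrightarrow> distinct L \<longrightarrow>
      (\<Sum>v\<leftarrow>L. Poly_Mapping.lookup f v *
        Poly_Mapping.lookup (foldr mulS (rev xs) (frag_of (v, cls xs))) (u, w)) = 0"
proof -
  have x: "x \<in> Kalg m {i, j}" "counit m x = 0" "x \<in> deg_le m (m i j)"
    using assms by (simp_all add: Kij_def)
  obtain f where f: "Poly_Mapping.keys f \<subseteq> words (reflections m) \<inter> {u. length u \<le> m i j}" "x = c (evalD f)"
    using x(3) by (rule deg_le_evalD)
  have "cls [] \<in> parabolic m {i, j}"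
    unfolding parabolic_eq by blast
  then obtain y where y: "y \<in> Dhat m {i, j}" "x = hW m (cls []) \<otimes>\<^bsub>Hhat m\<^esub> y \<otimes>\<^bsub>Hhat m\<^esub> hW m (inv\<^bsub>W\<^esub> cls [])"
    using x(1) unfolding Kalg_def by blast
  obtain g where g: "Poly_Mapping.keys g \<subseteq> words (refls {i, j})" "y = c (evalD g)"
    using y(1) by (rule Dhat_evalD)
  have "x = c (evalD g)"
    unfolding y(2) g(2) inv_cls hW_cls Hhat_eq pres_class_mult by simp
  then have "h (evalD f) = h (evalD g)"
    using f(2) by (simp add: h_eq_iff)
  \<comment> \<open>\<open>f\<close> has short words in all reflections, \<open>g\<close> words of
    any length in the reflections of the rank two subgroup. By independence both restrictions hold
    at once.\<close>
  then have "f = g"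
    by (rule evalD_inj) (use f(1) g(1) in \<open>auto simp: words_def\<close>)
  then have keys: "Poly_Mapping.keys f \<subseteq> {u \<in> words (refls {i, j}). length u \<le> m i j}"
    using f(1) g(1) by blast
  show thesis
  proof (rule that[OF keys f(2)]; (intro allI impI)?)
    show "Poly_Mapping.lookup f [] = 0"
      using x(2) by (simp add: f(2) counit_eq eps_evalD)
    fix L xs u w
    assume *: "xs \<in> lists {i, j}" "w \<noteq> \<one>\<^bsub>W\<^esub>" "Poly_Mapping.keys f \<subseteq> set L" "distinct L"
    have "Poly_Mapping.keys f \<subseteq> words (reflections m)"
      using f(1) by blast
    from Kalg_coefficient[OF x(1)[unfolded f(2)] this *(1,2), of u]
    show "(\<Sum>v\<leftarrow>L. Poly_Mapping.lookup f v *
        Poly_Mapping.lookup (foldr mulS (rev xs) (frag_of (v, cls xs))) (u, w)) = 0"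
      unfolding lookup_frag_extend_list[OF *(3,4)] .
  qed
qed

end

section \<open>Ring identities in rank two\<close>

lemma rank_two_element_conj:
  fixes s A B C :: "'a::ring_1"
  assumes "s * s = 1" "s * A = s - 1 - A * s" "s * B = C * s" "s * C = B * s"
  shows "s * (A * C - B * A + C * B - C) * s = B * C - A * B + C * A - C"
proof -
  have [simp]: "s * (s * x) = x" "s * (A * x) = s * x - x - A * (s * x)"
    "s * (B * x) = C * (s * x)" "s * (C * x) = B * (s * x)" for x
    by (simp_all add: assms left_diff_distrib flip: mult.assoc)
  show ?thesis
    by (simp add: algebra_simps assms)
qed

lemma rank_two_element_relator:
  fixes s A B :: "'a::ring_1"
  assumes "s * s = 1" "s * A = s - 1 - A * s"
  shows "s * (A * (s * B * s) - B * A + (s * B * s) * B - s * B * s) =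
    B * s * B - (s * B * A + A * B * s + s * B * s)"
proof -
  have [simp]: "s * (s * x) = x" "s * (A * x) = s * x - x - A * (s * x)" for x
    by (simp_all add: assms left_diff_distrib flip: mult.assoc)
  show ?thesis
    by (simp add: algebra_simps assms)
qed

text \<open>The left sides are what the coefficients of \<open>[r]\<close>, \<open>[a, b]\<close>,
  \<open>[a, r]\<close>, \<open>[b, r]\<close> and \<open>[a, r, b]\<close> multiply once the others
  are eliminated. Each is a combination of \<open>q\<close> and \<open>q'\<close> with at most one
  additional factor, in accordance with the degree bound 3.\<close>

lemma rank_two_ideal_cubics:
  fixes A B C :: "'a::ring_1"
  assumes idem: "A * A = A" "B * B = B" "C * C = C"
    and Q: "A * C - B * A + C * B - C = 0" and Q': "B * C - A * B + C * A - C = 0"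
  shows "C + B * A - C * A - C * B - B * (A * C) + C * (A * B) = 0"
    "A * B - B * A - A * (B * C) + B * (A * C) - C * (A * B) + C * (B * A) = 0"
    "A * C - C * A - B * (A * C) + C * (A * B) = 0"
    "B * C - C * B - A * (B * C) + C * (B * A) = 0"
    "A * (C * B) - B * (C * A) = 0"
proof -
  define q where "q = A * C - B * A + C * B - C"
  define q' where "q' = B * C - A * B + C * A - C"
  have z: "q = 0" "q' = 0"
    using Q Q' by (simp_all add: q_def q'_def)
  have [simp]: "A * (A * x) = A * x" "B * (B * x) = B * x" "C * (C * x) = C * x" for x
    using idem by (simp_all flip: mult.assoc)
  have "C + B * A - C * A - C * B - B * (A * C) + C * (A * B) = - (B * q + q' - q' * B)"
    by (simp add: q_def q'_def idem algebra_simps)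
  then show "C + B * A - C * A - C * B - B * (A * C) + C * (A * B) = 0"
    by (simp add: z)
  have "A * B - B * A - A * (B * C) + B * (A * C) - C * (A * B) + C * (B * A) =
      B * q - C * q - q' * B + q' * C"
    by (simp add: q_def q'_def idem algebra_simps)
  then show "A * B - B * A - A * (B * C) + B * (A * C) - C * (A * B) + C * (B * A) = 0"
    by (simp add: z)
  have "A * C - C * A - B * (A * C) + C * (A * B) = q * C - C * q'"
    by (simp add: q_def q'_def idem algebra_simps)
  then show "A * C - C * A - B * (A * C) + C * (A * B) = 0"
    by (simp add: z)
  have "B * C - C * B - A * (B * C) + C * (B * A) = q' * C - C * q"
    by (simp add: q_def q'_def idem algebra_simps)
  then show "B * C - C * B - A * (B * C) + C * (B * A) = 0"
    by (simp add: z)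
  have "A * (C * B) - B * (C * A) = A * q - q' * A"
    by (simp add: q_def q'_def idem algebra_simps)
  then show "A * (C * B) - B * (C * A) = 0"
    by (simp add: z)
qed

lemma iota_cmul: "iota R (frag_cmul k p) = of_int k * iota R p"
  by (induction k rule: int_induct[of _ 0])
    (simp_all add: frag_cmul_distrib frag_cmul_diff_distrib iota_simps algebra_simps)

lemma iota_sum: "iota R (sum f A) = (\<Sum>x\<in>A. iota R (f x))"
  by (induction A rule: infinite_finite_induct) (simp_all add: iota_simps)

lemma iota_frag_extend:
  assumes "Poly_Mapping.keys f \<subseteq> set L" "distinct L"
  shows "iota R (frag_extend b f) = (\<Sum>u\<leftarrow>L. of_int (Poly_Mapping.lookup f u) * iota R (b u))"
proof -
  have "iota R (frag_extend b f) =
      (\<Sum>u\<in>Poly_Mapping.keys f. of_int (Poly_Mapping.lookup f u) * iota R (b u))"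
    by (simp add: frag_extend_def iota_sum iota_cmul)
  also have "\<dots> = (\<Sum>u\<in>set L. of_int (Poly_Mapping.lookup f u) * iota R (b u))"
    by (rule sum.mono_neutral_left) (use assms(1) in \<open>auto simp: in_keys_iff\<close>)
  finally show ?thesis
    using assms(2) by (simp add: sum_list_distinct_conv_sum_set)
qed

context simply_laced_coxeter
begin

section \<open>The dihedral group of order six and its linear system\<close>

lemma dihedral_table:
  assumes "m i j = 3"
  defines "a \<equiv> simple_refl m i" and "b \<equiv> simple_refl m j" and "r \<equiv> cls [i, j, i]"
  shows "a \<otimes>\<^bsub>W\<^esub> a = cls []" "a \<otimes>\<^bsub>W\<^esub> b = cls [i, j]" "a \<otimes>\<^bsub>W\<^esub> r = cls [j, i]"
    "b \<otimes>\<^bsub>W\<^esub> a = cls [j, i]" "b \<otimes>\<^bsub>W\<^esub> b = cls []" "b \<otimes>\<^bsub>W\<^esub> r = cls [i, j]"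
    "cls [i, j] \<otimes>\<^bsub>W\<^esub> a = r" "cls [j, i] \<otimes>\<^bsub>W\<^esub> a = b" "cls [i, j] \<otimes>\<^bsub>W\<^esub> b = a" "cls [j, i] \<otimes>\<^bsub>W\<^esub> b = r"
    "a \<otimes>\<^bsub>W\<^esub> cls [i, j] = b" "b \<otimes>\<^bsub>W\<^esub> cls [i, j] = r" "a \<otimes>\<^bsub>W\<^esub> cls [j, i] = r" "b \<otimes>\<^bsub>W\<^esub> cls [j, i] = a"
    "a \<otimes>\<^bsub>W\<^esub> cls [] = a" "b \<otimes>\<^bsub>W\<^esub> cls [] = b" "cls [] \<otimes>\<^bsub>W\<^esub> a = a" "cls [] \<otimes>\<^bsub>W\<^esub> b = b"
proof -
  have sq: "us @ [k, k] @ vs \<asymp> us @ vs" for us k vs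
    using word_eq_context[OF word_eq_square] by force
  have br: "[i, j, i] \<asymp> [j, i, j]"
    by (rule word_eq_braid[OF assms(1)])
  have "[i, i] \<asymp> []" "[j, j] \<asymp> []" "[i, i, j, i] \<asymp> [j, i]" "[j, i, i] \<asymp> [j]" "[i, j, j] \<asymp> [i]"
    "[i, i, j] \<asymp> [j]" "[j, j, i] \<asymp> [i]"
    using sq[of "[]" i "[]"] sq[of "[]" j "[]"] sq[of "[]" i "[j, i]"] sq[of "[j]" i "[]"] sq[of "[i]" j "[]"]
      sq[of "[]" i "[j]"] sq[of "[]" j "[i]"] by simp_all
  moreover have "[j, i, j, i] \<asymp> [i, j]"
    using word_eq_trans[OF word_eq_context[OF br, of "[j]" "[]", simplified], of "[i, j]"]
      sq[of "[]" j "[i, j]"] by simp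
  ultimately show "a \<otimes>\<^bsub>W\<^esub> a = cls []" "a \<otimes>\<^bsub>W\<^esub> b = cls [i, j]" "a \<otimes>\<^bsub>W\<^esub> r = cls [j, i]"
    "b \<otimes>\<^bsub>W\<^esub> a = cls [j, i]" "b \<otimes>\<^bsub>W\<^esub> b = cls []" "b \<otimes>\<^bsub>W\<^esub> r = cls [i, j]"
    "cls [i, j] \<otimes>\<^bsub>W\<^esub> a = r" "cls [j, i] \<otimes>\<^bsub>W\<^esub> a = b" "cls [i, j] \<otimes>\<^bsub>W\<^esub> b = a" "cls [j, i] \<otimes>\<^bsub>W\<^esub> b = r"
    "a \<otimes>\<^bsub>W\<^esub> cls [i, j] = b" "b \<otimes>\<^bsub>W\<^esub> cls [i, j] = r" "a \<otimes>\<^bsub>W\<^esub> cls [j, i] = r" "b \<otimes>\<^bsub>W\<^esub> cls [j, i] = a"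
    "a \<otimes>\<^bsub>W\<^esub> cls [] = a" "b \<otimes>\<^bsub>W\<^esub> cls [] = b" "cls [] \<otimes>\<^bsub>W\<^esub> a = a" "cls [] \<otimes>\<^bsub>W\<^esub> b = b"
    unfolding a_def b_def r_def simple_refl_eq mult_cls cls_eq_iff
    using br word_eq_sym[OF br] by simp_all
qed

lemma odd_neq_even:
  "odd (length xs) \<Longrightarrow> even (length ys) \<Longrightarrow> cls xs \<noteq> cls ys"
  "even (length xs) \<Longrightarrow> odd (length ys) \<Longrightarrow> cls xs \<noteq> cls ys"
  using even_length_word_eq[of xs ys] unfolding cls_eq_iff by auto

text \<open>The linear system looks only at components at reflections. Parity settles the
  comparisons with even elements, which leaves the three reflections among themselves.\<close>

lemma dihedral_distinct:
  assumes "m i j = 3"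
  defines "a \<equiv> simple_refl m i" and "b \<equiv> simple_refl m j" and "r \<equiv> cls [i, j, i]"
  shows "a \<noteq> b" "a \<noteq> r" "b \<noteq> r"
    "cls [] \<noteq> a" "cls [i, j] \<noteq> a" "cls [j, i] \<noteq> a" "cls [] \<noteq> b" "cls [i, j] \<noteq> b" "cls [j, i] \<noteq> b"
    "cls [] \<noteq> r" "cls [i, j] \<noteq> r" "cls [j, i] \<noteq> r"
proof -
  have ij: "i \<noteq> j" using assms(1) m_off_diagonal by simp
  have r: "r = refl_conj i (simple_refl m j)" "r = refl_conj j (simple_refl m i)"
    using word_eq_braid[OF assms(1)] unfolding r_def
    by (simp_all only: simple_refl_eq mult_cls cls_eq_iff append_Cons append_Nil word_eq_refl)
  show "a \<noteq> b" "a \<noteq> r" "b \<noteq> r"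
    using simple_refl_neq[OF ij] refl_conj_neq_three[OF ij] refl_conj_neq_three[OF ij[symmetric]] r
    unfolding a_def b_def by metis+
  show "cls [] \<noteq> a" "cls [i, j] \<noteq> a" "cls [j, i] \<noteq> a" "cls [] \<noteq> b" "cls [i, j] \<noteq> b" "cls [j, i] \<noteq> b"
    "cls [] \<noteq> r" "cls [i, j] \<noteq> r" "cls [j, i] \<noteq> r"
    unfolding a_def b_def r_def simple_refl_eq by (rule odd_neq_even; simp)+
qed

lemma mulD_add: "mulD t (x + y) = mulD t x + mulD t y"
  and mulD_minus: "mulD t (- x) = - mulD t x"
  and mulS_add: "mulS i (x + y) = mulS i x + mulS i y"
  and mulS_minus: "mulS i (- x) = - mulS i x"
  by (simp_all add: mulD_def mulS_def frag_extend_add frag_extend_minus)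

text \<open>The list \<open>L\<close> consists of the words of length at most three. Of the conditions imposed by the six
  elements of the dihedral group, those from \<open>s\<^sub>i\<close> and \<open>s\<^sub>j\<close> and three from \<open>s\<^sub>i s\<^sub>j s\<^sub>i\<close> suffice.
  Besides the constants, a space of dimension five remains; a basis of it is listed in
  \<open>rank_two_ideal_cubics\<close>.\<close>

lemma dihedral_coefficients:
  fixes f :: "'i list set list \<Rightarrow> int"
  assumes m: "m i j = 3"
  defines "a \<equiv> simple_refl m i" and "b \<equiv> simple_refl m j" and "r \<equiv> cls [i, j, i]"
  defines "L \<equiv> [[], [a], [b], [r], [a, b], [a, r], [b, a], [b, r], [r, a], [r, b], [a, b, a], [a, b, r], [a, r, a], [a, r, b], [b, a, b], [b, a, r], [b, r, a], [b, r, b], [r, a, b], [r, a, r], [r, b, a], [r, b, r]]"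
  assumes eq: "\<And>xs w u. xs \<in> lists {i, j} \<Longrightarrow> w \<noteq> \<one>\<^bsub>W\<^esub> \<Longrightarrow>
    (\<Sum>v\<leftarrow>L. f v * Poly_Mapping.lookup (foldr mulS (rev xs) (frag_of (v, cls xs))) (u, w)) = 0"
  shows "f [a] = 0" "f [b] = 0" "f [b, a] = f [r] - f [a, b]" "f [r, a] = - f [r] - f [a, r]"
    "f [r, b] = - f [r] - f [b, r]" "f [b, a, r] = f [a, b] - f [r] - f [a, r]"
    "f [r, a, b] = f [r] - f [a, b] + f [a, r]" "f [a, b, r] = - f [a, b] - f [b, r]"
    "f [r, b, a] = f [a, b] + f [b, r]" "f [b, r, a] = - f [a, r, b]"
    "f [a, b, a] = 0" "f [a, r, a] = 0" "f [b, a, b] = 0" "f [b, r, b] = 0" "f [r, a, r] = 0" "f [r, b, r] = 0"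
proof -
  have names: "simple_refl m i = a" "simple_refl m j = b" "cls [i] = a" "cls [j] = b" "cls [i, j, i] = r"
    by (simp_all only: a_def b_def r_def simple_refl_eq)
  note distinct = dihedral_distinct[OF m, unfolded names]
  note tab = names dihedral_table[OF m, unfolded names] distinct distinct[symmetric] one_W
    L_def mulD_of lookup_minus lookup_add lookup_uminus lookup_single
    mulD_add mulD_minus mulS_add mulS_minus
  \<comment> \<open>After conjugation by s_i, a term has group component \<open>a\<close> exactly if
    s_i was absorbed by the -1 of the skew relation at some letter \<open>a\<close>. Each equation
    collects, for one remaining word, the terms that leave it behind.\<close>
  have e0: "- f [a] = 0"
    using eq[of "[i]" a "[]"] by (simp add: tab)
  have e1: "- f [a, b] - f [r, a] - f [a, r, a] - f [r, a, b] = 0"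
    using eq[of "[i]" a "[b]"] by (simp add: tab)
  have e2: "- f [a, r] - f [b, a] - f [a, b, a] - f [b, a, r] = 0"
    using eq[of "[i]" a "[r]"] by (simp add: tab)
  have e3: "- f [a, b, a] = 0"
    using eq[of "[i]" a "[b, a]"] by (simp add: tab)
  have e4: "f [a, b, a] = 0"
    using eq[of "[i]" a "[a, r]"] by (simp add: tab)
  have e5: "- f [a, b, r] - f [r, a, r] - f [r, b, a] = 0"
    using eq[of "[i]" a "[b, r]"] by (simp add: tab)
  have e6: "- f [a, r, a] = 0"
    using eq[of "[i]" a "[r, a]"] by (simp add: tab)
  have e7: "f [a, r, a] = 0"
    using eq[of "[i]" a "[a, b]"] by (simp add: tab)
  have e8: "- f [a, r, b] - f [b, a, b] - f [b, r, a] = 0"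
    using eq[of "[i]" a "[r, b]"] by (simp add: tab)
  have e9: "- f [b] = 0"
    using eq[of "[j]" b "[]"] by (simp add: tab)
  have e10: "- f [a, b] - f [b, r] - f [a, b, r] - f [b, a, b] = 0"
    using eq[of "[j]" b "[r]"] by (simp add: tab)
  have e11: "- f [b, a] - f [r, b] - f [b, r, b] - f [r, b, a] = 0"
    using eq[of "[j]" b "[a]"] by (simp add: tab)
  have e12: "- f [a, b, a] - f [a, r, b] - f [b, r, a] = 0"
    using eq[of "[j]" b "[r, a]"] by (simp add: tab)
  have e13: "- f [b, a, b] = 0"
    using eq[of "[j]" b "[a, b]"] by (simp add: tab)
  have e14: "f [b, a, b] = 0"
    using eq[of "[j]" b "[b, r]"] by (simp add: tab)
  have e15: "- f [b, a, r] - f [r, a, b] - f [r, b, r] = 0"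
    using eq[of "[j]" b "[a, r]"] by (simp add: tab)
  have e16: "- f [b, r, b] = 0"
    using eq[of "[j]" b "[r, b]"] by (simp add: tab)
  have e17: "f [b, r, b] = 0"
    using eq[of "[j]" b "[b, a]"] by (simp add: tab)
  \<comment> \<open>The conditions from s_i and s_j do not involve \<open>f [r]\<close>; this one
    does. The next two dispose of \<open>[r, a, r]\<close> and \<open>[r, b, r]\<close>.\<close>
  have e18: "- f [r] - f [a, r] - f [b, r] - f [a, b, a] - f [a, b, r] - f [a, r, b] - f [b, a, b] - f [b, a, r] - f [b, r, a] - f [r, a, r] - f [r, b, r] = 0"
    using eq[of "[i, j, i]" r "[]"] by (simp add: tab)
  have e19: "- f [r, a, r] = 0"
    using eq[of "[i, j, i]" r "[a, r]"] by (simp add: tab)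
  have e20: "- f [r, b, r] = 0"
    using eq[of "[i, j, i]" r "[b, r]"] by (simp add: tab)
  show "f [a] = 0" "f [b] = 0" "f [b, a] = f [r] - f [a, b]" "f [r, a] = - f [r] - f [a, r]"
    "f [r, b] = - f [r] - f [b, r]" "f [b, a, r] = f [a, b] - f [r] - f [a, r]"
    "f [r, a, b] = f [r] - f [a, b] + f [a, r]" "f [a, b, r] = - f [a, b] - f [b, r]"
    "f [r, b, a] = f [a, b] + f [b, r]" "f [b, r, a] = - f [a, r, b]"
    "f [a, b, a] = 0" "f [a, r, a] = 0" "f [b, a, b] = 0" "f [b, r, b] = 0" "f [r, a, r] = 0" "f [r, b, r] = 0"
    using e0 e1 e2 e3 e4 e5 e6 e7 e8 e9 e10 e11 e12 e13 e14 e15 e16 e17 e18 e19 e20 by linarith+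
qed

end

lemma eps_simply_laced_relators: "r \<in> simply_laced_relators m \<Longrightarrow> eps r = 0"
  by (auto simp: simply_laced_relators_def)

context simply_laced_coxeter
begin

section \<open>The simply-laced relations\<close>

abbreviation n where "n \<equiv> iota (simply_laced_relators m)"

lemma n_relator: "r \<in> simply_laced_relators m \<Longrightarrow> n r = 0"
  by (rule iota_relator[OF eps_simply_laced_relators Idl_incl])

lemma n_square: "n (gen_s i) * n (gen_s i) = 1"
proof -
  have "gen_s i ^ 2 - 1 \<in> simply_laced_relators m"
    unfolding simply_laced_relators_def by blast
  from n_relator[OF this] show ?thesis
    by (simp add: iota_simps power2_eq_square)
qed

lemma n_idem: "n (gen_D i) * n (gen_D i) = n (gen_D i)"
proof -
  have "gen_D i ^ 2 - gen_D i \<in> simply_laced_relators m"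
    unfolding simply_laced_relators_def by blast
  from n_relator[OF this] show ?thesis
    by (simp add: iota_simps power2_eq_square)
qed

lemma n_skew: "n (gen_s i) * n (gen_D i) = n (gen_s i) - 1 - n (gen_D i) * n (gen_s i)"
proof -
  have "gen_s i * gen_D i + gen_D i * gen_s i - (gen_s i - 1) \<in> simply_laced_relators m"
    unfolding simply_laced_relators_def by blast
  from n_relator[OF this] show ?thesis
    by (simp add: iota_simps eq_diff_eq)
qed

lemma n_two:
  assumes "m i j = 2"
  shows "n (gen_s j) * n (gen_s i) = n (gen_s i) * n (gen_s j)"
    "n (gen_D j) * n (gen_s i) = n (gen_s i) * n (gen_D j)"
    "n (gen_D j) * n (gen_D i) = n (gen_D i) * n (gen_D j)"
proof -
  have "gen_s j * gen_s i - gen_s i * gen_s j \<in> simply_laced_relators m"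
    "gen_D j * gen_s i - gen_s i * gen_D j \<in> simply_laced_relators m"
    "gen_D j * gen_D i - gen_D i * gen_D j \<in> simply_laced_relators m"
    unfolding simply_laced_relators_def using assms by blast+
  from this[THEN n_relator] show "n (gen_s j) * n (gen_s i) = n (gen_s i) * n (gen_s j)"
    "n (gen_D j) * n (gen_s i) = n (gen_s i) * n (gen_D j)"
    "n (gen_D j) * n (gen_D i) = n (gen_D i) * n (gen_D j)"
    by (simp_all add: iota_simps)
qed

lemma n_three:
  assumes "m i j = 3"
  shows "n (gen_s j) * (n (gen_s i) * n (gen_s j)) = n (gen_s i) * (n (gen_s j) * n (gen_s i))"
    "n (gen_D i) * (n (gen_s j) * n (gen_s i)) = n (gen_s j) * (n (gen_s i) * n (gen_D j))"
    "n (gen_D j) * n (gen_s i) * n (gen_D j) = n (gen_s i) * n (gen_D j) * n (gen_D i) +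
      n (gen_D i) * n (gen_D j) * n (gen_s i) + n (gen_s i) * n (gen_D j) * n (gen_s i)"
proof -
  have "gen_s j * gen_s i * gen_s j - gen_s i * gen_s j * gen_s i \<in> simply_laced_relators m"
    "gen_D i * gen_s j * gen_s i - gen_s j * gen_s i * gen_D j \<in> simply_laced_relators m"
    "gen_D j * gen_s i * gen_D j - (gen_s i * gen_D j * gen_D i + gen_D i * gen_D j * gen_s i
      + gen_s i * gen_D j * gen_s i) \<in> simply_laced_relators m"
    unfolding simply_laced_relators_def using assms by blast+
  from this[THEN n_relator] show
    "n (gen_s j) * (n (gen_s i) * n (gen_s j)) = n (gen_s i) * (n (gen_s j) * n (gen_s i))"
    "n (gen_D i) * (n (gen_s j) * n (gen_s i)) = n (gen_s j) * (n (gen_s i) * n (gen_D j))"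
    "n (gen_D j) * n (gen_s i) * n (gen_D j) = n (gen_s i) * n (gen_D j) * n (gen_D i) +
      n (gen_D i) * n (gen_D j) * n (gen_s i) + n (gen_s i) * n (gen_D j) * n (gen_s i)"
    by (simp_all add: iota_simps mult.assoc)
qed

lemma n_hat_relators:
  assumes "r \<in> hat_relators m"
  shows "n r = 0"
proof -
  have sq: "n (gen_s i) * (n (gen_s i) * x) = x" for i x
    by (simp add: n_square flip: mult.assoc)
  consider i where "r = gen_s i ^ 2 - 1" | i where "r = gen_D i ^ 2 - gen_D i"
    | i where "r = (gen_s i * gen_D i + gen_D i * gen_s i) - (gen_s i - 1)"
    | i j where "r = (gen_s i * gen_s j) ^ m i j - 1"
    | i j where "r = gen_D i * word_s (alternating j i (m i j - 1))
        - word_s (alternating j i (m i j - 1)) * gen_D (if even (m i j) then i else j)"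
      "i \<noteq> j" "m i j \<noteq> 0"
    using assms unfolding hat_relators_def by blast
  then show ?thesis
  proof cases
    case 4
    consider "i = j" | "m i j = 0" | "m i j = 2" | "m i j = 3"
      using m_cases[of i j] by (cases "i = j") auto
    then show ?thesis
    proof cases
      case 3
      have "n (gen_s i) * (n (gen_s j) * (n (gen_s i) * n (gen_s j))) = 1"
        by (simp add: n_two(1)[OF 3, symmetric] sq n_square)
      then show ?thesis
        by (simp add: 4 3 iota_simps numeral_2_eq_2 mult.assoc)
    next
      case a: 4
      have "n (gen_s i) * (n (gen_s j) * (n (gen_s i) * (n (gen_s j) * (n (gen_s i) * n (gen_s j))))) = 1"
        by (simp add: n_three(1)[OF a] sq n_square)
      then show ?thesis
        by (simp add: 4 a iota_simps numeral_3_eq_3 mult.assoc)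
    qed (simp_all add: 4 m_diag iota_simps n_square)
  next
    case 5
    consider "m i j = 2" | "m i j = 3"
      using m_cases[OF 5(2)] 5(3) by auto
    then show ?thesis
    proof cases
      case 1
      then have "m j i = 2" using m_sym by simp
      then show ?thesis
        using n_two(2)[of j i] by (simp add: 5(1) 1 iota_simps numeral_2_eq_2)
    next
      case 2
      then show ?thesis
        using n_three(2)[OF 2] by (simp add: 5(1) iota_simps numeral_3_eq_3 mult.assoc)
    qed
  qed (simp_all add: iota_simps power2_eq_square n_square n_idem n_skew)
qed

lemma n_eq_0_iff: "n p = 0 \<longleftrightarrow> p \<in> Idl\<^bsub>Free\<^esub> (simply_laced_relators m)"
  using iota_eq_iff[OF eps_simply_laced_relators, where p = p and q = 0]
  by (simp add: iota_0 pres_class_eq_iff)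

text \<open>The presented algebra is a quotient of \<open>Hhat\<close>, so facts about all D_t, such
  as idempotency, are inherited by it.\<close>

lemma n_cong: "h p = h q \<Longrightarrow> n p = n q"
proof -
  assume "h p = h q"
  then have "p - q \<in> Idl\<^bsub>Free\<^esub> (hat_relators m)"
    by (simp only: h_eq_iff pres_class_eq_iff)
  also have "\<dots> \<subseteq> Idl\<^bsub>Free\<^esub> (simply_laced_relators m)"
    by (rule Idl_least[OF ideal_Idl]) (use n_hat_relators n_eq_0_iff in blast)
  finally have "n (p - q) = 0"
    by (simp only: n_eq_0_iff)
  then show ?thesis by (simp add: iota_diff)
qed

abbreviation D3 where "D3 i j \<equiv> drep (cls [i, j, i])"

text \<open>Written with \<open>D3\<close> instead of s_i D_j s_i, so that it is visibly a
  polynomial of degree two in the D_t.\<close>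

definition Q3 :: "'i \<Rightarrow> 'i \<Rightarrow> 'i gen free_alg" where
  "Q3 i j = gen_D i * D3 i j - gen_D j * gen_D i + D3 i j * gen_D j - D3 i j"

lemma cls_three: "cls [i, j, i] = refl_conj i (simple_refl m j)"
  by (simp only: simple_refl_eq mult_cls append_Cons append_Nil)

lemma cls_three_sym: "m i j = 3 \<Longrightarrow> cls [i, j, i] = cls [j, i, j]"
  by (simp only: cls_eq_iff word_eq_braid)

lemma h_D3:
  assumes "m i j = 3"
  shows "h (D3 i j) = h (gen_s i) * h (gen_D j) * h (gen_s i)"
proof -
  have "simple_refl m j \<noteq> simple_refl m i"
    using m_off_diagonal(2)[OF assms] simple_refl_neq by metis
  from h_drep_conj[OF simple_refl_reflection this] show ?thesis
    by (simp only: cls_three iota_mult h_drep_simple)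
qed

lemma h_s_D:
  assumes "m i j = 3"
  shows "h (gen_s i) * h (gen_D j) = h (D3 i j) * h (gen_s i)"
    "h (gen_s i) * h (D3 i j) = h (gen_D j) * h (gen_s i)"
proof -
  have sq: "h (gen_s i) * (h (gen_s i) * x) = x" for x
    by (simp add: h_square flip: mult.assoc)
  show "h (gen_s i) * h (gen_D j) = h (D3 i j) * h (gen_s i)"
    "h (gen_s i) * h (D3 i j) = h (gen_D j) * h (gen_s i)"
    by (simp_all add: h_D3[OF assms] mult.assoc h_square sq)
qed

text \<open>Together with its companion for s_j, this makes \<open>Q3 i j\<close> and
  \<open>Q3 j i\<close> a pair that both simple reflections interchange.\<close>

lemma h_Q3_conj:
  assumes "m i j = 3"
  shows "h (gen_s i * Q3 i j * gen_s i) = h (Q3 j i)"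
  using rank_two_element_conj[OF h_square h_skew h_s_D[OF assms]]
  by (simp add: Q3_def iota_simps cls_three_sym[OF assms])

lemma h_Q3_conj':
  assumes "m i j = 3"
  shows "h (gen_s j * Q3 i j * gen_s j) = h (Q3 j i)"
proof -
  have sq: "h (gen_s j) * (h (gen_s j) * x) = x" for x
    by (simp add: h_square flip: mult.assoc)
  have "m j i = 3" using assms m_sym by simp
  have "h (gen_s j * Q3 i j * gen_s j) = h (gen_s j) * h (Q3 i j) * h (gen_s j)"
    by (simp only: iota_mult)
  also have "\<dots> = h (gen_s j) * h (gen_s j * Q3 j i * gen_s j) * h (gen_s j)"
    by (simp only: h_Q3_conj[OF \<open>m j i = 3\<close>])
  also have "\<dots> = h (Q3 j i)"
    by (simp add: iota_mult mult.assoc h_square sq)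
  finally show ?thesis .
qed

lemma n_Q3:
  assumes "m i j = 3"
  shows "n (Q3 i j) = 0"
proof -
  have D3: "n (D3 i j) = n (gen_s i) * n (gen_D j) * n (gen_s i)"
  proof -
    have "h (D3 i j) = h (gen_s i * gen_D j * gen_s i)"
      by (simp only: h_D3[OF assms] iota_mult)
    from n_cong[OF this] show ?thesis
      by (simp only: iota_mult)
  qed
  have "n (gen_s i) * n (Q3 i j) = 0"
    using rank_two_element_relator[OF n_square n_skew, of i "n (gen_D j)"] n_three(3)[OF assms]
    by (simp add: Q3_def iota_simps D3)
  then have "n (gen_s i) * n (gen_s i) * n (Q3 i j) = 0"
    by (simp add: mult.assoc)
  then show ?thesis
    by (simp add: n_square)
qed

subsection \<open>The elements of \<open>K\<^sub>i\<^sub>j\<close> are consequences\<close>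

lemma n_drep_idem: "t \<in> reflections m \<Longrightarrow> n (drep t) * n (drep t) = n (drep t)"
proof -
  assume "t \<in> reflections m"
  then have "h (drep t * drep t) = h (drep t)"
    by (simp only: iota_mult h_drep_idem)
  from n_cong[OF this] show ?thesis
    by (simp only: iota_mult)
qed

text \<open>Left multiplication by either generator preserves the four listed classes, so they
  exhaust the subgroup; parity then excludes the even ones.\<close>

lemma parabolic_two:
  assumes "m i j = 2"
  shows "refls {i, j} \<subseteq> {simple_refl m i, simple_refl m j}"
proof
  have *: "cls xs \<in> {cls [], cls [i], cls [j], cls [i, j]}" if "xs \<in> lists {i, j}" for xs
    using that
  proof (induction xs)
    case (Cons x xs)
    have sq: "[i, i] \<asymp> []" "[j, j] \<asymp> []" "[i, i, j] \<asymp> [j]" "[j, j, i] \<asymp> [i]"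
      using word_eq_square[of i] word_eq_square[of j] word_eq_context[OF word_eq_square[of i], of "[]" "[j]"]
        word_eq_context[OF word_eq_square[of j], of "[]" "[i]"] by simp_all
    have "[j, i, j] \<asymp> [j, j, i]"
      using word_eq_context[OF word_eq_comm[OF assms], of "[j]" "[]"] by simp
    then have jij: "[j, i, j] \<asymp> [i]"
      using sq(4) by (rule word_eq_trans)
    have tab: "cls [i] \<otimes>\<^bsub>W\<^esub> cls [] = cls [i]" "cls [i] \<otimes>\<^bsub>W\<^esub> cls [i] = cls []" "cls [i] \<otimes>\<^bsub>W\<^esub> cls [j] = cls [i, j]"
      "cls [i] \<otimes>\<^bsub>W\<^esub> cls [i, j] = cls [j]" "cls [j] \<otimes>\<^bsub>W\<^esub> cls [] = cls [j]" "cls [j] \<otimes>\<^bsub>W\<^esub> cls [i] = cls [i, j]"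
      "cls [j] \<otimes>\<^bsub>W\<^esub> cls [j] = cls []" "cls [j] \<otimes>\<^bsub>W\<^esub> cls [i, j] = cls [i]"
      unfolding mult_cls cls_eq_iff using sq jij word_eq_sym[OF word_eq_comm[OF assms]] by simp_all
    have "cls (x # xs) = cls [x] \<otimes>\<^bsub>W\<^esub> cls xs"
      by (simp only: mult_cls append_Cons append_Nil)
    moreover have "cls xs \<in> {cls [], cls [i], cls [j], cls [i, j]}" "x = i \<or> x = j"
      using Cons by auto
    moreover have "cls [k] \<otimes>\<^bsub>W\<^esub> w \<in> {cls [], cls [i], cls [j], cls [i, j]}"
      if "w \<in> {cls [], cls [i], cls [j], cls [i, j]}" "k = i \<or> k = j" for k w
      using that unfolding insert_iff empty_iff
      by (elim disjE) (simp_all only: tab simp_thms)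
    ultimately show ?case by (simp only:)
  qed simp
  fix t assume t: "t \<in> refls {i, j}"
  then obtain xs where xs: "t = cls xs" "xs \<in> lists {i, j}"
    unfolding parabolic_eq by blast
  have "cls [] \<notin> reflections m" "cls [i, j] \<notin> reflections m"
    using odd_length_reflection[of "[]"] odd_length_reflection[of "[i, j]"] by auto
  then show "t \<in> {simple_refl m i, simple_refl m j}"
    using *[OF xs(2)] t unfolding xs(1) simple_refl_eq insert_iff empty_iff Int_iff by metis
qed

lemma parabolic_three:
  assumes "m i j = 3"
  shows "refls {i, j} \<subseteq> {simple_refl m i, simple_refl m j, cls [i, j, i]}"
proof
  let ?S = "{cls [], simple_refl m i, simple_refl m j, cls [i, j], cls [j, i], cls [i, j, i]}"
  note tab = dihedral_table[OF assms]
  have *: "cls xs \<in> ?S" if "xs \<in> lists {i, j}" for xs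
    using that
  proof (induction xs)
    case (Cons x xs)
    have "cls (x # xs) = simple_refl m x \<otimes>\<^bsub>W\<^esub> cls xs"
      by (simp only: simple_refl_eq mult_cls append_Cons append_Nil)
    moreover have "cls xs \<in> ?S" "x = i \<or> x = j"
      using Cons by auto
    moreover have "simple_refl m k \<otimes>\<^bsub>W\<^esub> w \<in> ?S" if "w \<in> ?S" "k = i \<or> k = j" for k w
      using that unfolding insert_iff empty_iff
      by (elim disjE) (simp_all only: tab simp_thms)
    ultimately show ?case by (simp only:)
  qed simp
  fix t assume t: "t \<in> refls {i, j}"
  then obtain xs where xs: "t = cls xs" "xs \<in> lists {i, j}"
    unfolding parabolic_eq by blast
  have "cls [] \<notin> reflections m" "cls [i, j] \<notin> reflections m" "cls [j, i] \<notin> reflections m"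
    using odd_length_reflection[of "[]"] odd_length_reflection[of "[i, j]"] odd_length_reflection[of "[j, i]"] by auto
  then show "t \<in> {simple_refl m i, simple_refl m j, cls [i, j, i]}"
    using *[OF xs(2)] t unfolding xs(1) insert_iff empty_iff Int_iff by metis
qed

lemma words_le_2:
  "{u \<in> words {a, b}. length u \<le> 2} \<subseteq> set [[], [a], [b], [a, b], [b, a]]"
proof
  fix u assume "u \<in> {u \<in> words {a, b}. length u \<le> 2}"
  then show "u \<in> set [[], [a], [b], [a, b], [b, a]]"
    by (cases u; cases "tl u") (auto simp: words_def)
qed

lemma words_le_3:
  "{u \<in> words {a, b, r}. length u \<le> 3} \<subseteq> set [[], [a], [b], [r], [a, b], [a, r], [b, a], [b, r], [r, a], [r, b], [a, b, a], [a, b, r], [a, r, a], [a, r, b], [b, a, b], [b, a, r], [b, r, a], [b, r, b], [r, a, b], [r, a, r], [r, b, a], [r, b, r]]"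
proof
  fix u assume "u \<in> {u \<in> words {a, b, r}. length u \<le> 3}"
  then show "u \<in> set [[], [a], [b], [r], [a, b], [a, r], [b, a], [b, r], [r, a], [r, b], [a, b, a], [a, b, r], [a, r, a], [a, r, b], [b, a, b], [b, a, r], [b, r, a], [b, r, b], [r, a, b], [r, a, r], [r, b, a], [r, b, r]]"
  proof -
    have u: "distinct_adj u" "set u \<subseteq> {a, b, r}" "length u \<le> 3"
      using \<open>u \<in> _\<close> by (simp_all add: words_def)
    consider "u = []" | x where "u = [x]" | x y where "u = [x, y]" | x y z where "u = [x, y, z]"
      using u(3) by (cases u; cases "tl u"; cases "tl (tl u)") auto
    then show ?thesis
    proof cases
      case (4 x y z)
      then have "x = a \<or> x = b \<or> x = r" "y = a \<or> y = b \<or> y = r" "z = a \<or> z = b \<or> z = r"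
        "x \<noteq> y" "y \<noteq> z"
        using u by auto
      then show ?thesis
        unfolding 4 by (elim disjE) simp_all
    qed (use u in auto)
  qed
qed

lemma Kij_in_ideal:
  assumes "x \<in> Kij m i j" "i \<noteq> j"
  obtains p where "p \<in> Idl\<^bsub>Free\<^esub> (simply_laced_relators m)" "x = c p"
proof -
  obtain f where f: "Poly_Mapping.keys f \<subseteq> {u \<in> words (refls {i, j}). length u \<le> m i j}"
    "x = c (evalD f)" "Poly_Mapping.lookup f [] = 0"
    and "\<forall>L xs w u. xs \<in> lists {i, j} \<longrightarrow> w \<noteq> \<one>\<^bsub>W\<^esub> \<longrightarrow> Poly_Mapping.keys f \<subseteq> set L \<longrightarrow> distinct L \<longrightarrow>
      (\<Sum>v\<leftarrow>L. Poly_Mapping.lookup f v *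
        Poly_Mapping.lookup (foldr mulS (rev xs) (frag_of (v, cls xs))) (u, w)) = 0"
    using assms(1) by (rule obtain_Kij_expansion)
  note eq = this(4)[rule_format]
  let ?f = "Poly_Mapping.lookup f"
  have mono: "words A \<subseteq> words B" if "A \<subseteq> B" for A B
    using that by (auto simp: words_def)
  consider "m i j = 0" | "m i j = 2" | "m i j = 3"
    using m_cases[OF assms(2)] by auto
  then have "n (evalD f) = 0"
  proof cases
    case 1
    \<comment> \<open>Degree 0 leaves only the empty word, and its coefficient is the
      counit.\<close>
    then have "Poly_Mapping.keys f \<subseteq> {[]}"
      using f(1) by auto
    moreover have "[] \<notin> Poly_Mapping.keys f"
      using f(3) by (simp add: in_keys_iff)
    ultimately have "Poly_Mapping.keys f = {}" by blast
    then show ?thesis by (simp add: evalD_0 iota_0)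
  next
    case 2
    define a b where "a = simple_refl m i" and "b = simple_refl m j"
    let ?L = "[[], [a], [b], [a, b], [b, a]]"
    have keys: "Poly_Mapping.keys f \<subseteq> set ?L"
      using f(1) mono[OF parabolic_two[OF 2]] words_le_2[of a b] unfolding 2 a_def b_def by blast
    have ab: "a \<noteq> b"
      using simple_refl_neq[OF assms(2)] by (simp add: a_def b_def)
    then have dist: "distinct ?L" by auto
    have names: "simple_refl m i = a" "simple_refl m j = b" "cls [i] = a" "cls [j] = b"
      by (simp_all only: a_def b_def simple_refl_eq)
    have tab: "a \<otimes>\<^bsub>W\<^esub> b \<otimes>\<^bsub>W\<^esub> a = b" "b \<otimes>\<^bsub>W\<^esub> a \<otimes>\<^bsub>W\<^esub> b = a"
      using refl_conj_two[OF 2] refl_conj_two[of j i] 2 m_sym[of j i] by (simp_all add: a_def b_def)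
    have e: "a \<otimes>\<^bsub>W\<^esub> a = \<one>\<^bsub>W\<^esub>" "b \<otimes>\<^bsub>W\<^esub> b = \<one>\<^bsub>W\<^esub>"
      by (simp_all only: a_def b_def simple_refl_square)
    have ne: "a \<noteq> \<one>\<^bsub>W\<^esub>" "b \<noteq> \<one>\<^bsub>W\<^esub>"
      unfolding a_def b_def simple_refl_eq one_W by (rule odd_neq_even; simp)+
    note simps = names tab e ne ne[symmetric] ab ab[symmetric] mulD_of lookup_minus lookup_add
      lookup_uminus lookup_single mulD_add mulD_minus
    have fa: "?f [a] = 0"
      using eq[of "[i]" a ?L "[]", OF _ ne(1) keys dist] by (simp add: simps)
    have fb: "?f [b] = 0"
      using eq[of "[j]" b ?L "[]", OF _ ne(2) keys dist] by (simp add: simps)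
    \<comment> \<open>In both products the letter \<open>a\<close> absorbs s_i and leaves
      \<open>b\<close> behind, with group component \<open>a\<close>.\<close>
    have "- ?f [a, b] - ?f [b, a] = 0"
      using eq[of "[i]" a ?L "[b]", OF _ ne(1) keys dist] by (simp add: simps)
    then have fba: "?f [b, a] = - ?f [a, b]" by simp
    have "n (drep a) = n (gen_D i)" "n (drep b) = n (gen_D j)"
      unfolding a_def b_def by (simp_all only: n_cong[OF h_drep_simple])
    then show ?thesis
      using n_two(3)[OF 2] unfolding evalD_def iota_frag_extend[OF keys dist]
      by (simp add: f(3) fa fb fba iota_simps)
  next
    case 3
    define a b r where "a = simple_refl m i" and "b = simple_refl m j" and "r = cls [i, j, i]"
    have names: "simple_refl m i = a" "simple_refl m j = b" "cls [i, j, i] = r"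
      by (simp_all only: a_def b_def r_def)
    let ?L = "[[], [a], [b], [r], [a, b], [a, r], [b, a], [b, r], [r, a], [r, b], [a, b, a], [a, b, r], [a, r, a], [a, r, b], [b, a, b], [b, a, r], [b, r, a], [b, r, b], [r, a, b], [r, a, r], [r, b, a], [r, b, r]]"
    have keys: "Poly_Mapping.keys f \<subseteq> set ?L"
      using f(1) mono[OF parabolic_three[OF 3]] words_le_3[of a b r] unfolding 3 names by blast
    note distinct = dihedral_distinct[OF 3, unfolded names]
    have dist: "distinct ?L"
      using distinct(1-3) by auto
    note coeffs = dihedral_coefficients[OF 3, of ?f, unfolded names, OF eq[OF _ _ keys dist]]
    define A B C where "A = n (drep a)" and "B = n (drep b)" and "C = n (drep r)"
    have refl: "a \<in> reflections m" "b \<in> reflections m" "r \<in> reflections m"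
      unfolding a_def b_def r_def cls_three by (intro simple_refl_reflection refl_conj_reflection)+
    have D: "A = n (gen_D i)" "B = n (gen_D j)"
      unfolding A_def B_def a_def b_def by (simp_all only: n_cong[OF h_drep_simple])
    have "m j i = 3" using 3 m_sym by simp
    have idem: "A * A = A" "B * B = B" "C * C = C"
      unfolding A_def B_def C_def using refl by (simp_all only: n_drep_idem)
    have Q: "A * C - B * A + C * B - C = 0" "B * C - A * B + C * A - C = 0"
      using n_Q3[OF 3] n_Q3[OF \<open>m j i = 3\<close>]
      by (simp_all add: Q3_def iota_simps D C_def r_def cls_three_sym[OF \<open>m j i = 3\<close>])
    note cubics = rank_two_ideal_cubics[OF idem Q]
    \<comment> \<open>Five coefficients remain free, and each multiplies an element that vanishes
      because \<open>Q3 i j\<close> and \<open>Q3 j i\<close> do.\<close>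
    have "n (evalD f) = of_int (?f [r]) * (C + B * A - C * A - C * B - B * (A * C) + C * (A * B)) +
        of_int (?f [a, b]) * (A * B - B * A - A * (B * C) + B * (A * C) - C * (A * B) + C * (B * A)) +
        of_int (?f [a, r]) * (A * C - C * A - B * (A * C) + C * (A * B)) +
        of_int (?f [b, r]) * (B * C - C * B - A * (B * C) + C * (B * A)) +
        of_int (?f [a, r, b]) * (A * (C * B) - B * (C * A))"
      unfolding evalD_def iota_frag_extend[OF keys dist]
      by (simp add: f(3) coeffs iota_simps algebra_simps flip: A_def B_def C_def)
    then show ?thesis
      by (simp only: cubics) simp
  qed
  then show thesis
    using that[OF _ f(2)] by (simp only: n_eq_0_iff)
qed

end

lemma rank_two_commutator_conj:
  fixes s A B :: "'a::ring_1"
  assumes "s * s = 1" "s * A = s - 1 - A * s" "s * B = B * s"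
  shows "s * (B * A - A * B) * s = A * B - B * A"
proof -
  have [simp]: "s * (s * x) = x" "s * (A * x) = s * x - x - A * (s * x)" "s * (B * x) = B * (s * x)" for x
    by (simp_all add: assms left_diff_distrib flip: mult.assoc)
  show ?thesis
    by (simp add: algebra_simps assms)
qed

context simply_laced_coxeter
begin

subsection \<open>The relators lie in the ideal\<close>

lemma Dhat_drep: "t \<in> refls J \<Longrightarrow> c (drep t) \<in> Dhat m J"
  unfolding Dhat_def by (rule generate_ring.incl) (auto simp flip: Drefl_eq)

lemma Dhat_gen_D: "i \<in> J \<Longrightarrow> c (gen_D i) \<in> Dhat m J"
proof -
  assume "i \<in> J"
  then have "[i] \<in> lists J" by simp
  then have "simple_refl m i \<in> refls J"
    unfolding parabolic_eq simple_refl_eq[symmetric] Int_iff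
    using simple_refl_reflection simple_refl_eq by blast
  from Dhat_drep[OF this] show ?thesis
    using h_drep_simple[of i] by (simp add: h_eq_iff)
qed

lemma Dhat_mult: "c p \<in> Dhat m J \<Longrightarrow> c q \<in> Dhat m J \<Longrightarrow> c (p * q) \<in> Dhat m J"
  and Dhat_add: "c p \<in> Dhat m J \<Longrightarrow> c q \<in> Dhat m J \<Longrightarrow> c (p + q) \<in> Dhat m J"
  and Dhat_minus: "c p \<in> Dhat m J \<Longrightarrow> c (- p) \<in> Dhat m J"
  using generate_ring.eng_mult[of "c p" "Hhat m" _ "c q"] generate_ring.eng_add[of "c p" "Hhat m" _ "c q"]
    generate_ring.a_inv[of "c p" "Hhat m"]
  unfolding Dhat_def Hhat_eq pres_class_mult pres_class_add pres_class_minus by blast+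

lemma Dhat_diff: "c p \<in> Dhat m J \<Longrightarrow> c q \<in> Dhat m J \<Longrightarrow> c (p - q) \<in> Dhat m J"
  using Dhat_add[of p J "- q"] Dhat_minus[of q J] by simp

lemma deg_le_prodD: "set ss \<subseteq> reflections m \<Longrightarrow> length ss \<le> r \<Longrightarrow> c (prodD ss) \<in> deg_le m r"
  unfolding deg_le_def by (rule generate.incl) (auto simp flip: foldr_Drefl)

lemma deg_le_minus_prodD: "set ss \<subseteq> reflections m \<Longrightarrow> length ss \<le> r \<Longrightarrow> c (- prodD ss) \<in> deg_le m r"
  unfolding deg_le_def add_monoid_inv[symmetric] Hhat_eq
  by (rule generate.inv) (use foldr_Drefl in \<open>auto simp: Hhat_eq\<close>)

lemma deg_le_add: "c p \<in> deg_le m r \<Longrightarrow> c q \<in> deg_le m r \<Longrightarrow> c (p + q) \<in> deg_le m r"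
  using generate.eng[of "c p" "add_monoid (Hhat m)" _ "c q"]
  unfolding deg_le_def by (simp add: Hhat_eq pres_class_add)

lemma deg_le_diff_prodD:
  assumes "c p \<in> deg_le m r" "set ss \<subseteq> reflections m" "length ss \<le> r"
  shows "c (p - prodD ss) \<in> deg_le m r"
  using deg_le_add[OF assms(1) deg_le_minus_prodD[OF assms(2,3)]] by simp

text \<open>If conjugation by s_i and s_j maps \<open>S\<close> into itself, then w^-1 p w stays in
  \<open>S\<close> for every w in the dihedral group, and hence in
  \<open>Dhat m {i, j}\<close>.\<close>

lemma KijI:
  assumes "p \<in> S" "eps p = 0" "c p \<in> deg_le m (m i j)"
    and Dhat: "\<And>q. q \<in> S \<Longrightarrow> c q \<in> Dhat m {i, j}"
    and conj: "\<And>q k. q \<in> S \<Longrightarrow> k \<in> {i, j} \<Longrightarrow> \<exists>q'\<in>S. h (gen_s k * q * gen_s k) = h q'"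
  shows "c p \<in> Kij m i j"
proof -
  have *: "\<exists>q'\<in>S. h q = h (word_s xs * q' * word_s (rev xs))" if "xs \<in> lists {i, j}" "q \<in> S" for xs q
    using that
  proof (induction xs arbitrary: q rule: list.induct)
    case Nil
    then show ?case by (intro bexI[of _ q]) simp_all
  next
    case (Cons x xs)
    then have "x \<in> {i, j}" by simp
    then obtain q1 where q1: "q1 \<in> S" "h (gen_s x * q * gen_s x) = h q1"
      using conj[of q x] Cons.prems(2) by blast
    then obtain q' where q': "q' \<in> S" "h q1 = h (word_s xs * q' * word_s (rev xs))"
      using Cons.IH[of q1] Cons.prems(1) by auto
    have sq: "h (gen_s x) * (h (gen_s x) * y) = y" for y
      by (simp add: h_square flip: mult.assoc)
    have "h q = h (gen_s x) * h (gen_s x * q * gen_s x) * h (gen_s x)"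
      by (simp add: iota_mult mult.assoc h_square sq)
    also have "\<dots> = h (word_s (x # xs) * q' * word_s (rev (x # xs)))"
      unfolding q1(2) q'(2) by (simp add: iota_simps word_s_append mult.assoc)
    finally show ?case using q'(1) by blast
  qed
  have "c p \<in> (\<lambda>x. hW m w \<otimes>\<^bsub>Hhat m\<^esub> x \<otimes>\<^bsub>Hhat m\<^esub> hW m (inv\<^bsub>W\<^esub> w)) ` Dhat m {i, j}"
    if "w \<in> parabolic m {i, j}" for w
  proof -
    obtain xs where xs: "w = cls xs" "xs \<in> lists {i, j}"
      using \<open>w \<in> _\<close> unfolding parabolic_eq by blast
    obtain q where "q \<in> S" "h p = h (word_s xs * q * word_s (rev xs))"
      using *[OF xs(2) assms(1)] by blast
    then have "c p = hW m w \<otimes>\<^bsub>Hhat m\<^esub> c q \<otimes>\<^bsub>Hhat m\<^esub> hW m (inv\<^bsub>W\<^esub> w)"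
      unfolding xs(1) inv_cls hW_cls Hhat_eq pres_class_mult h_eq_iff by blast
    then show ?thesis
      using Dhat[OF \<open>q \<in> S\<close>] by blast
  qed
  then show ?thesis
    using assms(2,3) unfolding Kij_def Kalg_def by (simp add: counit_eq)
qed

text \<open>Conjugation by either simple reflection changes the sign of the commutator, so the set
  of it and its negative serves in \<open>KijI\<close>.\<close>

lemma commutator_in_Kij:
  assumes "m i j = 2"
  shows "c (gen_D j * gen_D i - gen_D i * gen_D j) \<in> Kij m i j"
proof (rule KijI)
  let ?p = "gen_D j * gen_D i - gen_D i * gen_D j"
  have mji: "m j i = 2" using assms m_sym by simp
  have comm: "h (gen_s i) * h (gen_D j) = h (gen_D j) * h (gen_s i)"
    "h (gen_s j) * h (gen_D i) = h (gen_D i) * h (gen_s j)"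
    using h_D_conj_two[OF assms] h_D_conj_two[OF mji] by simp_all
  have i: "h (gen_s i * ?p * gen_s i) = h (- ?p)"
    using rank_two_commutator_conj[OF h_square h_skew comm(1)] by (simp add: iota_simps)
  have "h (gen_s j * (- ?p) * gen_s j) = h ?p"
    using rank_two_commutator_conj[OF h_square h_skew comm(2)] by (simp add: iota_simps)
  moreover have neg: "h (gen_s k * (- ?p) * gen_s k) = - h (gen_s k * ?p * gen_s k)" for k
    by (simp only: iota_minus iota_mult mult_minus_left mult_minus_right)
  ultimately have j: "h (gen_s j * ?p * gen_s j) = h (- ?p)"
    by (metis iota_minus minus_minus)
  show "?p \<in> {?p, - ?p}" by simp
  show "eps ?p = 0" by simp
  have "c (gen_D j * gen_D i - gen_D i * gen_D j) =
      c (prodD [simple_refl m j, simple_refl m i] - prodD [simple_refl m i, simple_refl m j])"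
    unfolding h_eq_iff[symmetric] by (simp add: iota_simps h_drep_simple)
  then show "c ?p \<in> deg_le m (m i j)"
    using deg_le_diff_prodD[OF deg_le_prodD, of "[simple_refl m j, simple_refl m i]" "m i j"
        "[simple_refl m i, simple_refl m j]"] assms by simp
  have "c ?p \<in> Dhat m {i, j}"
    by (intro Dhat_diff Dhat_mult Dhat_gen_D) simp_all
  then show "c q \<in> Dhat m {i, j}" if "q \<in> {?p, - ?p}" for q
    using that Dhat_minus by blast
  show "\<exists>q'\<in>{?p, - ?p}. h (gen_s k * q * gen_s k) = h q'" if "q \<in> {?p, - ?p}" "k \<in> {i, j}" for q k
  proof -
    have "h (gen_s k * ?p * gen_s k) = h (- ?p)"
      using that(2) i j by blast
    moreover from this have "h (gen_s k * (- ?p) * gen_s k) = h ?p"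
      by (simp only: neg iota_minus minus_minus)
    ultimately show ?thesis
      using that(1) by blast
  qed
qed

lemma Q3_in_Kij:
  assumes "m i j = 3"
  shows "c (Q3 i j) \<in> Kij m i j"
proof (rule KijI)
  have mji: "m j i = 3" using assms m_sym by simp
  have refl: "cls [i, j, i] \<in> reflections m"
    unfolding cls_three by (intro refl_conj_reflection simple_refl_reflection)
  have "cls [i, j, i] \<in> parabolic m {i, j}"
    unfolding parabolic_eq by (rule imageI) simp
  with refl have D3: "c (D3 i j) \<in> Dhat m {i, j}" "c (D3 j i) \<in> Dhat m {i, j}"
    unfolding cls_three_sym[OF mji] by (auto intro: Dhat_drep)
  show "Q3 i j \<in> {Q3 i j, Q3 j i}" by simp
  show "eps (Q3 i j) = 0"
    by (simp add: Q3_def eps_drep)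
  let ?a = "simple_refl m i" and ?b = "simple_refl m j" and ?r = "cls [i, j, i]"
  have "c (Q3 i j) = c (prodD [?a, ?r] - prodD [?b, ?a] + prodD [?r, ?b] - prodD [?r])"
    \<comment> \<open>Spelled out in words of length at most two, which makes the bound on the
      degree evident.\<close>
    unfolding h_eq_iff[symmetric] by (simp add: Q3_def iota_simps h_drep_simple)
  moreover have "c (prodD [?a, ?r] - prodD [?b, ?a] + prodD [?r, ?b] - prodD [?r]) \<in> deg_le m (m i j)"
    using refl assms by (intro deg_le_diff_prodD deg_le_add deg_le_prodD) simp_all
  ultimately show "c (Q3 i j) \<in> deg_le m (m i j)" by simp
  have "c (Q3 i j) \<in> Dhat m {i, j}" "c (Q3 j i) \<in> Dhat m {i, j}"
    unfolding Q3_def using D3 by (intro Dhat_diff Dhat_add Dhat_mult Dhat_gen_D; simp)+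
  then show "c q \<in> Dhat m {i, j}" if "q \<in> {Q3 i j, Q3 j i}" for q
    using that by blast
  show "\<exists>q'\<in>{Q3 i j, Q3 j i}. h (gen_s k * q * gen_s k) = h q'"
    if "q \<in> {Q3 i j, Q3 j i}" "k \<in> {i, j}" for q k
    using that h_Q3_conj[OF assms] h_Q3_conj'[OF assms] h_Q3_conj[OF mji] h_Q3_conj'[OF mji] by blast
qed

section \<open>The ideal \<open>Jideal\<close> and the isomorphism\<close>

lemma ring_Hhat: "ring (Hhat m)"
  unfolding Hhat_eq by (rule ring_pres)

lemma ideal_Jideal: "ideal (Jideal m) (Hhat m)"
  unfolding Jideal_def
proof (rule ring.genideal_ideal[OF ring_Hhat])
  have "Kij m i j \<subseteq> carrier (Hhat m)" for i j
    by (auto elim: obtain_Kij_expansion simp: Hhat_eq)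
  then show "(\<Union>i. \<Union>j\<in>- {i}. Kij m i j) \<subseteq> carrier (Hhat m)" by blast
qed

lemma Kij_subset_Jideal: "i \<noteq> j \<Longrightarrow> Kij m i j \<subseteq> Jideal m"
proof -
  assume "i \<noteq> j"
  have "(\<Union>i. \<Union>j\<in>- {i}. Kij m i j) \<subseteq> carrier (Hhat m)"
    by (auto elim: obtain_Kij_expansion simp: Hhat_eq)
  from ring.genideal_self[OF ring_Hhat this]
  have "(\<Union>i. \<Union>j\<in>- {i}. Kij m i j) \<subseteq> Jideal m"
    by (simp only: Jideal_def)
  moreover have "Kij m i j \<subseteq> (\<Union>i. \<Union>j\<in>- {i}. Kij m i j)"
    using \<open>i \<noteq> j\<close> by (intro subsetI UN_I[of i] UN_I[of j]) simp_all
  ultimately show ?thesis by (rule subset_trans[rotated])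
qed

text \<open>All families except two already vanish in \<open>Hhat\<close>. The exceptions are the
  commutators of D_i and D_j, which lie in K_ij themselves, and the last family, which consists of
  the elements s_i times \<open>Q3 i j\<close>.\<close>

lemma simply_laced_relators_in_Jideal:
  assumes "r \<in> simply_laced_relators m"
  shows "c r \<in> Jideal m"
proof -
  interpret J: ideal "Jideal m" "Hhat m" by (rule ideal_Jideal)
  have zero: "c r \<in> Jideal m" if "h r = 0" for r
  proof -
    have "c r = \<zero>\<^bsub>Hhat m\<^esub>"
      using that h_eq_iff[of r 0] by (simp add: iota_0 Hhat_eq pres_class_zero)
    then show ?thesis
      using additive_subgroup.zero_closed[OF ideal.axioms(1)[OF ideal_Jideal]] by simp
  qed
  consider (hat) "r \<in> {gen_s i ^ 2 - 1 | i. True} \<union> {gen_D i ^ 2 - gen_D i | i. True}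
      \<union> {(gen_s i * gen_D i + gen_D i * gen_s i) - (gen_s i - 1) | i. True}"
    | (s_two) i j where "m i j = 2" "r = gen_s j * gen_s i - gen_s i * gen_s j"
    | (D_s_two) i j where "m i j = 2" "r = gen_D j * gen_s i - gen_s i * gen_D j"
    | (D_two) i j where "m i j = 2" "r = gen_D j * gen_D i - gen_D i * gen_D j"
    | (s_three) i j where "m i j = 3" "r = gen_s j * gen_s i * gen_s j - gen_s i * gen_s j * gen_s i"
    | (D_s_three) i j where "m i j = 3" "r = gen_D i * gen_s j * gen_s i - gen_s j * gen_s i * gen_D j"
    | (D_three) i j where "m i j = 3" "r = gen_D j * gen_s i * gen_D j
        - (gen_s i * gen_D j * gen_D i + gen_D i * gen_D j * gen_s i + gen_s i * gen_D j * gen_s i)"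
    using assms unfolding simply_laced_relators_def by blast
  then show ?thesis
  proof cases
    case hat
    then have "r \<in> hat_relators m"
      unfolding hat_relators_def by blast
    then show ?thesis by (intro zero h_relator)
  next
    case s_two
    have "h (word_s [i, j]) = h (word_s [j, i])"
      by (rule h_word_cong[OF word_eq_comm[OF s_two(1)]])
    then show ?thesis
      by (intro zero) (simp add: s_two(2) iota_simps)
  next
    case D_s_two
    then have "m j i = 2" using m_sym by simp
    then show ?thesis
      using h_D_conj_two[of j i] by (intro zero) (simp add: D_s_two(2) iota_simps)
  next
    case D_two
    then show ?thesis
      using commutator_in_Kij[OF D_two(1)] Kij_subset_Jideal[OF m_off_diagonal(1)[OF D_two(1)]] by auto
  next
    case s_three
    have "h (word_s [i, j, i]) = h (word_s [j, i, j])"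
      by (rule h_word_cong[OF word_eq_braid[OF s_three(1)]])
    then show ?thesis
      by (intro zero) (simp add: s_three(2) iota_simps mult.assoc)
  next
    case D_s_three
    then show ?thesis
      using h_D_conj_three[of i j] by (intro zero) (simp add: D_s_three(2) iota_simps mult.assoc)
  next
    case D_three
    have "h r = h (gen_s i * Q3 i j)"
      using rank_two_element_relator[OF h_square h_skew, of i "h (gen_D j)"] h_D3[OF D_three(1)]
      by (simp add: D_three(2) Q3_def iota_simps)
    then have "c r = c (gen_s i) \<otimes>\<^bsub>Hhat m\<^esub> c (Q3 i j)"
      by (simp add: h_eq_iff Hhat_eq pres_class_mult)
    moreover have "c (Q3 i j) \<in> Jideal m"
      using Q3_in_Kij[OF D_three(1)] Kij_subset_Jideal[OF m_off_diagonal(2)[OF D_three(1)]] by auto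
    ultimately show ?thesis
      using J.I_l_closed[of "c (Q3 i j)" "c (gen_s i)"] by (simp add: Hhat_eq)
  qed
qed

text \<open>From left to right, the image of the relator ideal in \<open>Hhat\<close> is an ideal
  containing every K_ij; from right to left, the preimage of \<open>Jideal\<close> is an ideal
  containing every relator.\<close>

lemma pres_class_in_Jideal_iff: "c p \<in> Jideal m \<longleftrightarrow> p \<in> Idl\<^bsub>Free\<^esub> (simply_laced_relators m)"
proof
  let ?I = "Idl\<^bsub>Free\<^esub> (simply_laced_relators m)"
  assume p: "c p \<in> Jideal m"
  have "ideal ((+>\<^bsub>Free\<^esub>) (Idl\<^bsub>Free\<^esub> (hat_relators m)) ` ?I) (Free Quot Idl\<^bsub>Free\<^esub> (hat_relators m))"
    by (rule ring.ring_ideal_imp_quot_ideal[OF ring_ring_of_type_algebra ideal_Idl ideal_Idl])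
  then have "ideal (c ` ?I) (Hhat m)"
    by (simp add: Hhat_eq pres_def pres_class_def[abs_def])
  moreover have "(\<Union>i. \<Union>j\<in>- {i}. Kij m i j) \<subseteq> c ` ?I"
    using Kij_in_ideal by blast
  ultimately have "Jideal m \<subseteq> c ` ?I"
    unfolding Jideal_def by (rule ring.genideal_minimal[OF ring_Hhat])
  with p obtain q where "q \<in> ?I" "c p = c q" by blast
  \<comment> \<open>\<open>p\<close> agrees with a member of the ideal only modulo the relators of
    \<open>Hhat\<close>; by \<open>n_cong\<close> these belong to the ideal as well.\<close>
  then have "n p = 0"
    using n_cong[of p q] by (simp add: h_eq_iff n_eq_0_iff)
  then show "p \<in> ?I" by (simp only: n_eq_0_iff)
next
  have "ring_hom_ring Free (Hhat m) c"
    unfolding Hhat_eq by (intro ring_hom_ringI2 ring_ring_of_type_algebra ring_pres pres_class_hom)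
  then have "ideal {p \<in> carrier Free. c p \<in> Jideal m} Free"
    by (rule ring_hom_ring.ideal_vimage[OF _ ideal_Jideal])
  then have "Idl\<^bsub>Free\<^esub> (simply_laced_relators m) \<subseteq> {p \<in> carrier Free. c p \<in> Jideal m}"
    by (rule Idl_least) (auto simp: simply_laced_relators_in_Jideal)
  then show "p \<in> Idl\<^bsub>Free\<^esub> (simply_laced_relators m) \<Longrightarrow> c p \<in> Jideal m" by blast
qed

text \<open>The first isomorphism theorem for the composite surjection from the free algebra through
  \<open>Hhat\<close>; its kernel was computed in \<open>pres_class_in_Jideal_iff\<close>.\<close>

lemma pres_iso_HeckeHopf:
  "\<exists>\<phi> \<in> ring_iso (pres (simply_laced_relators m)) (HeckeHopf m).
     \<forall>i. \<phi> (pres_class (simply_laced_relators m) (gen_s i)) = Hs m i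
       \<and> \<phi> (pres_class (simply_laced_relators m) (gen_D i)) = HD m i"
proof -
  let ?I = "Idl\<^bsub>Free\<^esub> (simply_laced_relators m)"
  define g where "g p = Jideal m +>\<^bsub>Hhat m\<^esub> c p" for p
  interpret J: ideal "Jideal m" "Hhat m" by (rule ideal_Jideal)
  have "g = (+>\<^bsub>Hhat m\<^esub>) (Jideal m) \<circ> c"
    by (auto simp: g_def)
  then have "g \<in> ring_hom Free (HeckeHopf m)"
    using ring_hom_trans[OF pres_class_hom J.rcos_ring_hom[unfolded Hhat_eq]]
    by (simp add: HeckeHopf_def Hhat_eq)
  then interpret g: ring_hom_ring Free "HeckeHopf m" g
    by (intro ring_hom_ringI2 ring_ring_of_type_algebra) (simp_all add: HeckeHopf_def J.quotient_is_ring)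
  have surj: "g ` carrier Free = carrier (HeckeHopf m)"
    by (auto simp: HeckeHopf_def FactRing_def A_RCOSETS_def' g_def Hhat_eq carrier_pres)
  have "g p = \<zero>\<^bsub>HeckeHopf m\<^esub> \<longleftrightarrow> p \<in> ?I" for p
  proof -
    have "c p \<in> carrier (Hhat m)"
      by (simp add: Hhat_eq)
    then have "g p = Jideal m \<longleftrightarrow> c p \<in> Jideal m"
      using J.rcos_const_imp_mem[of "c p"] abelian_subgroup.a_rcos_const[OF abelian_subgroupI3[OF J.additive_subgroup_axioms J.is_abelian_group], of "c p"] unfolding g_def by blast
    then show ?thesis
      by (simp add: pres_class_in_Jideal_iff HeckeHopf_def FactRing_def)
  qed
  then have ker: "a_kernel Free (HeckeHopf m) g = ?I"
    unfolding a_kernel_def' by (simp only: ring_of_type_algebra_simps UNIV_I simp_thms Collect_mem_eq)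
  have iso: "(\<lambda>x. the_elem (g ` x)) \<in> ring_iso (pres (simply_laced_relators m)) (HeckeHopf m)"
    using g.FactRing_iso_set[OF surj] by (simp add: ker pres_def)
  have val: "the_elem (g ` pres_class (simply_laced_relators m) p) = g p" for p
    using g.the_elem_simp[of p] by (simp add: ker pres_class_def)
  show ?thesis
    by (rule bexI[OF _ iso]) (simp only: val, simp add: g_def Hs_def HD_def hs_def hD_def)
qed

end

theorem theorem1p25:
  fixes m :: "'i \<Rightarrow> 'i \<Rightarrow> nat"
  assumes "coxeter_matrix m" and "simply_laced m"
  shows "\<exists>\<phi> \<in> ring_iso (pres (simply_laced_relators m)) (HeckeHopf m).
           \<forall>i. \<phi> (pres_class (simply_laced_relators m) (gen_s i)) = Hs m i
             \<and> \<phi> (pres_class (simply_laced_relators m) (gen_D i)) = HD m i"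
proof -
  interpret simply_laced_coxeter m
    by unfold_locales (fact assms)+
  show ?thesis by (rule pres_iso_HeckeHopf)
qed

end
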